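(* Let $\nabla$ be a connection on the vector bundle $\pi:W\rightarrow M$, and let $\widetilde{W}\subseteq W$ be the subset obtained as the terminal member of the derived flag of $(W,\nabla)$. (i) If $X:U\subseteq M\rightarrow W$ is a local parallel section (i.e. $U$ is open and $\nabla X=0$ on $U$), then the image of $X$ lies in $\widetilde{W}$. (ii) Suppose that $\nabla$ is regular at $x\in M$. Then for every $w\in\widetilde{W}_x=\widetilde{W}\cap W_x$ there exists a local parallel section $X:U\subseteq M\rightarrow\widetilde{W}$, defined on an open neighbourhood $U$ of $x$, with $X(x)=w$.
   Context: $M$ is a connected manifold and $W$ is a real vector bundle of finite rank over $M$; manifolds, bundles, connections and sections are smooth (the statement may equally be read with everything real analytic). $W_x=\pi^{-1}(x)$. A connection $\nabla$ on $W$ maps local sections of $W$ to local sections of $W\otimes T^*M$; $R:TM\otimes TM\otimes W\to W$ is its curvature tensor. Properties of a subset $W'\subseteq W$: (P1) for each $x\in M$, $W'_x:=W_x\cap W'$ is a linear subspace of $W_x$; (P2) for each $w\in W'$ there are an open neighbourhood $U$ of $\pi(w)$ and a smooth local section $X:U\to W$ with values in $W'$ such that $X(\pi(w))=w$. For $W'$ satisfying P1 and P2, the second fundamental 1-form $\alpha_{W'}:W'\to(W/W')\otimes T^*M$ (quotient taken fibrewise) is the fibrewise linear map sending $w\in W'$ to the class of $(\nabla X)(\pi(w))$ in $(W_{\pi(w)}/W'_{\pi(w)})\otimes T^*_{\pi(w)}M$, where $X$ is a local section with values in $W'$ and $X(\pi(w))=w$. For $V\subseteq W$ satisfying P1, $\mathcal{S}(V)$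 is the set of $v\in V$ for which there is a smooth local section $X$ of $W$ near $\pi(v)$ with values in $V$ and $X(\pi(v))=v$. Derived flag: $V^{(0)}=\{w\in W: R(\cdot,\cdot)(w)=0\}$, $W^{(i)}=\mathcal{S}(V^{(i)})$, $V^{(i+1)}=\ker\alpha_{W^{(i)}}=\{w\in W^{(i)}:\alpha_{W^{(i)}}(w)=0\}$. This gives a decreasing sequence $W\supseteq W^{(0)}\supseteq W^{(1)}\supseteq\cdots$, which stabilizes: for some $k$, $W^{(l)}=W^{(k)}$ for all $l\ge k$. Define $\widetilde{W}=W^{(k)}$, with projection $\tilde\pi=\pi|_{\widetilde{W}}$. $\nabla$ is regular at $x\in M$ if there is an open neighbourhood $U$ of $x$ such that $\tilde\pi^{-1}(U)\subseteq\widetilde{W}$ is a vector bundle over $U$ (a subbundle of $W|_U$).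
   Formalization: The second fundamental form need not be well defined on members of the derived flag, since the class of ∇X may depend on X; its kernel is taken as those w for which some local section X of W' through w has ∇X zero modulo W' at π(w). *)

theory Defs
  imports "HOL-Analysis.Analysis"
begin

section \<open>Model spaces and smooth maps\<close>

text \<open>Finite-dimensional inner product spaces, i.e. \<open>\<real>\<^sup>n\<close> with \<open>n \<ge> 0\<close>. The class
  \<^class>\<open>euclidean_space\<close> is not used because it excludes dimension 0 and would rule out
  zero-dimensional manifolds and bundles of rank 0. The parent classes \<^class>\<open>banach\<close> and
  \<^class>\<open>heine_borel\<close> are automatic in finite dimension.\<close>

class fin_dim_inner = real_inner + banach + heine_borel +
  assumes ex_finite_spanning: "\<exists>B::'a set. finite B \<and> (\<forall>x. \<exists>r. x = (\<Sum>b\<in>B. r b *\<^sub>R b))"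

instance euclidean_space \<subseteq> fin_dim_inner
proof
  have "x = (\<Sum>b\<in>Basis. (x \<bullet> b) *\<^sub>R b)" for x :: 'a
    by (simp add: euclidean_representation)
  then show "\<exists>B::'a set. finite B \<and> (\<forall>x. \<exists>r. x = (\<Sum>b\<in>B. r b *\<^sub>R b))"
    by (metis finite_Basis)
qed

text \<open>Only used for open \<open>S\<close> and finite-dimensional \<open>'a\<close>, where it is the usual notion of class
  \<open>C\<^sup>k\<close> (all iterated directional derivatives exist and are continuous).\<close>

primrec Ck_on :: "nat \<Rightarrow> 'a set \<Rightarrow> ('a::real_normed_vector \<Rightarrow> 'b::real_normed_vector) \<Rightarrow> bool" where
  "Ck_on 0 S f \<longleftrightarrow> continuous_on S f"
| "Ck_on (Suc k) S f \<longleftrightarrow>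
     (\<forall>x\<in>S. f differentiable (at x)) \<and> (\<forall>v. Ck_on k S (\<lambda>x. frechet_derivative f (at x) v))"

definition smooth_on :: "'a set \<Rightarrow> ('a::real_normed_vector \<Rightarrow> 'b::real_normed_vector) \<Rightarrow> bool" where
  "smooth_on S f \<longleftrightarrow> (\<forall>k. Ck_on k S f)"


section \<open>Smooth manifolds\<close>

type_synonym ('m, 'e) chart = "'m set \<times> ('m \<Rightarrow> 'e)"

text \<open>A tangent vector at \<open>x\<close> is a family of vectors, one for each chart around \<open>x\<close>, which transforms
  by the derivatives of the coordinate changes. The family is put to 0 outside the charts around
  \<open>x\<close>, so that it is determined by its value in any one chart around \<open>x\<close>.\<close>

type_synonym ('m, 'e) tangent = "('m, 'e) chart \<Rightarrow> 'e"

text \<open>The manifold is the whole type \<open>'m\<close>. The atlas need not be maximal.\<close>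

locale smooth_manifold =
  fixes atlas :: "('m::{t2_space, second_countable_topology}, 'e::fin_dim_inner) chart set"
  assumes atlas_open: "(D, \<phi>) \<in> atlas \<Longrightarrow> open D \<and> open (\<phi> ` D)"
    and atlas_homeo: "(D, \<phi>) \<in> atlas \<Longrightarrow> homeomorphism D (\<phi> ` D) \<phi> (inv_into D \<phi>)"
    and atlas_cover: "(\<Union>c\<in>atlas. fst c) = UNIV"
    and atlas_compat: "\<lbrakk>(D, \<phi>) \<in> atlas; (D', \<phi>') \<in> atlas\<rbrakk> \<Longrightarrow>
      smooth_on (\<phi> ` (D \<inter> D')) (\<phi>' \<circ> inv_into D \<phi>)"
begin

definition charts_at :: "'m \<Rightarrow> ('m, 'e) chart set" where
  "charts_at x = {c \<in> atlas. x \<in> fst c}"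

definition in_chart :: "('m, 'e) chart \<Rightarrow> ('m \<Rightarrow> 'v) \<Rightarrow> 'e \<Rightarrow> 'v" where
  "in_chart c f = f \<circ> inv_into (fst c) (snd c)"

definition smooth_map_on :: "'m set \<Rightarrow> ('m \<Rightarrow> 'v::real_normed_vector) \<Rightarrow> bool" where
  "smooth_map_on U f \<longleftrightarrow> (\<forall>c\<in>atlas. smooth_on (snd c ` (U \<inter> fst c)) (in_chart c f))"

text \<open>Derivative of the local representation of \<open>f\<close> in the chart \<open>c\<close>, at the point \<open>x\<close>.\<close>

definition chart_deriv ::
    "('m, 'e) chart \<Rightarrow> ('m \<Rightarrow> 'v::real_normed_vector) \<Rightarrow> 'm \<Rightarrow> 'e \<Rightarrow> 'v" where
  "chart_deriv c f x = frechet_derivative (in_chart c f) (at (snd c x))"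

definition tangent_space :: "'m \<Rightarrow> ('m, 'e) tangent set" where
  "tangent_space x = {v.
     (\<forall>c\<in>charts_at x. \<forall>d\<in>charts_at x. v d = chart_deriv c (snd d) x (v c)) \<and>
     (\<forall>c. c \<notin> charts_at x \<longrightarrow> v c = 0)}"

text \<open>The value \<open>df(v)\<close>, independent of the chosen chart around \<open>x\<close>.\<close>

definition differential :: "('m \<Rightarrow> real) \<Rightarrow> 'm \<Rightarrow> ('m, 'e) tangent \<Rightarrow> real" where
  "differential f x v = (let c = (SOME c. c \<in> charts_at x) in chart_deriv c f x (v c))"

definition smooth_vector_field :: "'m set \<Rightarrow> ('m \<Rightarrow> ('m, 'e) tangent) \<Rightarrow> bool" where
  "smooth_vector_field U A \<longleftrightarrow> open U \<and> (\<forall>y\<in>U. A y \<in> tangent_space y) \<and>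
     (\<forall>c\<in>atlas. smooth_map_on (U \<inter> fst c) (\<lambda>y. A y c))"

definition lie_bracket ::
    "('m \<Rightarrow> ('m, 'e) tangent) \<Rightarrow> ('m \<Rightarrow> ('m, 'e) tangent) \<Rightarrow> 'm \<Rightarrow> ('m, 'e) tangent" where
  "lie_bracket A B x = (\<lambda>c. if c \<in> charts_at x
     then chart_deriv c (\<lambda>y. B y c) x (A x c) - chart_deriv c (\<lambda>y. A y c) x (B x c)
     else 0)"

end


section \<open>Smooth vector bundles\<close>

type_synonym ('m, 'w, 'f) trivialization = "'m set \<times> ('w \<Rightarrow> 'f)"

text \<open>Total space \<open>'w\<close>, typical fibre \<open>'f\<close>. The fibrewise operations are only relevant for
  arguments in a common fibre. A trivialization is given by its domain \<open>N\<close> and the second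
  component \<open>\<psi>\<close> of the map \<open>\<pi>\<^sup>-\<^sup>1(N) \<rightarrow> N \<times> \<real>\<^sup>r\<close>.\<close>

record ('m, 'w, 'f) vbundle =
  proj :: "'w \<Rightarrow> 'm"
  fadd :: "'w \<Rightarrow> 'w \<Rightarrow> 'w"
  fscale :: "real \<Rightarrow> 'w \<Rightarrow> 'w"
  fzero :: "'m \<Rightarrow> 'w"
  trivs :: "('m, 'w, 'f) trivialization set"

definition fibre :: "('m, 'w, 'f) vbundle \<Rightarrow> 'm \<Rightarrow> 'w set" where
  "fibre W x = {w. proj W w = x}"

definition fibrewise_iso ::
    "('m, 'w, 'f::real_vector) vbundle \<Rightarrow> 'm set \<Rightarrow> ('w \<Rightarrow> 'f) \<Rightarrow> bool" where
  "fibrewise_iso W N \<psi> \<longleftrightarrow> (\<forall>x\<in>N. bij_betw \<psi> (fibre W x) UNIV \<and> \<psi> (fzero W x) = 0 \<and>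
     (\<forall>v\<in>fibre W x. \<forall>w\<in>fibre W x. \<psi> (fadd W v w) = \<psi> v + \<psi> w) \<and>
     (\<forall>w\<in>fibre W x. \<forall>r. \<psi> (fscale W r w) = r *\<^sub>R \<psi> w))"

definition smooth_transition ::
    "('m::{t2_space, second_countable_topology}, 'e::fin_dim_inner) chart set \<Rightarrow>
     ('m, 'w, 'f::fin_dim_inner) vbundle \<Rightarrow>
     ('m, 'w, 'f) trivialization \<Rightarrow> ('m, 'w, 'f) trivialization \<Rightarrow> bool" where
  "smooth_transition atlas W s t \<longleftrightarrow>
     (\<forall>a. smooth_manifold.smooth_map_on atlas (fst s \<inter> fst t)
            (\<lambda>x. snd t (inv_into (fibre W x) (snd s) a)))"

text \<open>The vector space axioms in the fibres, the topology and the smooth structure of the total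
  space are determined by the trivializations.\<close>

locale vector_bundle = smooth_manifold atlas
  for atlas :: "('m::{t2_space, second_countable_topology}, 'e::fin_dim_inner) chart set" +
  fixes W :: "('m, 'w, 'f::fin_dim_inner) vbundle"
  assumes fzero_fibre: "fzero W x \<in> fibre W x"
    and fadd_fibre: "\<lbrakk>v \<in> fibre W x; w \<in> fibre W x\<rbrakk> \<Longrightarrow> fadd W v w \<in> fibre W x"
    and fscale_fibre: "w \<in> fibre W x \<Longrightarrow> fscale W r w \<in> fibre W x"
    and triv_open: "(N, \<psi>) \<in> trivs W \<Longrightarrow> open N"
    and triv_cover: "(\<Union>t\<in>trivs W. fst t) = UNIV"
    and triv_iso: "(N, \<psi>) \<in> trivs W \<Longrightarrow> fibrewise_iso W N \<psi>"
    and triv_compat: "\<lbrakk>s \<in> trivs W; t \<in> trivs W\<rbrakk> \<Longrightarrow> smooth_transition atlas W s t"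
begin

text \<open>Local sections are represented by total functions, of which only the values on \<open>U\<close> matter.\<close>

definition smooth_section :: "'m set \<Rightarrow> ('m \<Rightarrow> 'w) \<Rightarrow> bool" where
  "smooth_section U X \<longleftrightarrow> open U \<and> (\<forall>y\<in>U. X y \<in> fibre W y) \<and>
     (\<forall>(N, \<psi>)\<in>trivs W. smooth_map_on (U \<inter> N) (\<psi> \<circ> X))"

definition section_through :: "'w set \<Rightarrow> 'w \<Rightarrow> 'm set \<Rightarrow> ('m \<Rightarrow> 'w) \<Rightarrow> bool" where
  "section_through S w U X \<longleftrightarrow>
     smooth_section U X \<and> X ` U \<subseteq> S \<and> proj W w \<in> U \<and> X (proj W w) = w"

definition section_part :: "'w set \<Rightarrow> 'w set" ("\<S>") where
  "\<S> V = {v \<in> V. \<exists>U X. section_through V v U X}"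

definition local_trivialization :: "'m set \<Rightarrow> ('w \<Rightarrow> 'f) \<Rightarrow> bool" where
  "local_trivialization N \<psi> \<longleftrightarrow> open N \<and> fibrewise_iso W N \<psi> \<and>
     (\<forall>t\<in>trivs W. smooth_transition atlas W (N, \<psi>) t \<and> smooth_transition atlas W t (N, \<psi>))"

text \<open>The part of \<open>S\<close> over the open set \<open>U\<close> is a smooth subbundle of \<open>W\<close> over \<open>U\<close>: around every
  point of \<open>U\<close> some local trivialization of \<open>W\<close> maps it onto a product with a fixed subspace.\<close>

definition subbundle_over :: "'m set \<Rightarrow> 'w set \<Rightarrow> bool" where
  "subbundle_over U S \<longleftrightarrow> open U \<and>
     (\<forall>x\<in>U. \<exists>N \<psi> F. x \<in> N \<and> N \<subseteq> U \<and> local_trivialization N \<psi> \<and> subspace F \<and>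
        (\<forall>y\<in>N. \<psi> ` (S \<inter> fibre W y) = F))"

text \<open>The class of \<open>w\<close> in the quotient of its fibre by the fibre of \<open>S\<close>.\<close>

definition fibre_class :: "'w set \<Rightarrow> 'w \<Rightarrow> 'w set" where
  "fibre_class S w = {fadd W w s | s. s \<in> S \<inter> fibre W (proj W w)}"

end


section \<open>Connections and the derived flag\<close>

text \<open>\<open>nabla X x v\<close> is \<open>(\<nabla>\<^sub>v X)(x)\<close>, for a section \<open>X\<close> which is smooth near \<open>x\<close> and
  \<open>v \<in> T\<^sub>xM\<close>. By \<open>nabla_local\<close> the value only depends on the germ of \<open>X\<close> at \<open>x\<close>, so \<open>nabla\<close> acts
  on local sections over any open set, compatibly with restriction. Over \<open>\<real>\<close>, homogeneity in \<open>X\<close> is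
  the case of constant \<open>f\<close> in \<open>nabla_Leibniz\<close>.\<close>

locale linear_connection = vector_bundle atlas W
  for atlas :: "('m::{t2_space, second_countable_topology}, 'e::fin_dim_inner) chart set"
    and W :: "('m, 'w, 'f::fin_dim_inner) vbundle" +
  fixes nabla :: "('m \<Rightarrow> 'w) \<Rightarrow> 'm \<Rightarrow> ('m, 'e) tangent \<Rightarrow> 'w"
  assumes nabla_fibre: "\<lbrakk>smooth_section U X; x \<in> U; v \<in> tangent_space x\<rbrakk> \<Longrightarrow>
      nabla X x v \<in> fibre W x"
    and nabla_local: "\<lbrakk>smooth_section U X; smooth_section U Y; \<And>y. y \<in> U \<Longrightarrow> X y = Y y;
      x \<in> U; v \<in> tangent_space x\<rbrakk> \<Longrightarrow> nabla X x v = nabla Y x v"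
    and nabla_tangent_add: "\<lbrakk>smooth_section U X; x \<in> U; u \<in> tangent_space x; v \<in> tangent_space x\<rbrakk> \<Longrightarrow>
      nabla X x (\<lambda>c. u c + v c) = fadd W (nabla X x u) (nabla X x v)"
    and nabla_tangent_scale: "\<lbrakk>smooth_section U X; x \<in> U; v \<in> tangent_space x\<rbrakk> \<Longrightarrow>
      nabla X x (\<lambda>c. r *\<^sub>R v c) = fscale W r (nabla X x v)"
    and nabla_smooth: "\<lbrakk>smooth_section U X; smooth_vector_field U A\<rbrakk> \<Longrightarrow>
      smooth_section U (\<lambda>y. nabla X y (A y))"
    and nabla_add: "\<lbrakk>smooth_section U X; smooth_section U Y; x \<in> U; v \<in> tangent_space x\<rbrakk> \<Longrightarrow>
      nabla (\<lambda>y. fadd W (X y) (Y y)) x v = fadd W (nabla X x v) (nabla Y x v)"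
    and nabla_Leibniz: "\<lbrakk>smooth_map_on U f; smooth_section U X; x \<in> U; v \<in> tangent_space x\<rbrakk> \<Longrightarrow>
      nabla (\<lambda>y. fscale W (f y) (X y)) x v =
        fadd W (fscale W (f x) (nabla X x v)) (fscale W (differential f x v) (X x))"
begin

definition parallel_section :: "'m set \<Rightarrow> ('m \<Rightarrow> 'w) \<Rightarrow> bool" where
  "parallel_section U X \<longleftrightarrow>
     smooth_section U X \<and> (\<forall>y\<in>U. \<forall>v\<in>tangent_space y. nabla X y v = fzero W y)"

definition curvature_fields ::
    "('m \<Rightarrow> ('m, 'e) tangent) \<Rightarrow> ('m \<Rightarrow> ('m, 'e) tangent) \<Rightarrow> ('m \<Rightarrow> 'w) \<Rightarrow> 'm \<Rightarrow> 'w" where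
  "curvature_fields A B X x =
     fadd W (nabla (\<lambda>y. nabla X y (B y)) x (A x))
       (fadd W (fscale W (- 1) (nabla (\<lambda>y. nabla X y (A y)) x (B x)))
         (fscale W (- 1) (nabla X x (lie_bracket A B x))))"

text \<open>The curvature tensor \<open>R(u, v)(w)\<close>: by tensoriality, the value at \<open>\<pi>(w)\<close> of the above
  expression does not depend on the extensions of \<open>u\<close>, \<open>v\<close>, \<open>w\<close>.\<close>

definition curvature :: "('m, 'e) tangent \<Rightarrow> ('m, 'e) tangent \<Rightarrow> 'w \<Rightarrow> 'w" where
  "curvature u v w = (THE r. \<exists>U A B X.
     smooth_vector_field U A \<and> A (proj W w) = u \<and>
     smooth_vector_field U B \<and> B (proj W w) = v \<and>
     section_through UNIV w U X \<and> r = curvature_fields A B X (proj W w))"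

definition curvature_kernel :: "'w set" where
  "curvature_kernel = {w. \<forall>u\<in>tangent_space (proj W w). \<forall>v\<in>tangent_space (proj W w).
     curvature u v w = fzero W (proj W w)}"

text \<open>The second fundamental 1-form of \<open>S\<close>: the set of its values at \<open>w\<close>, a value being a map from
  tangent vectors to classes modulo \<open>S\<close> (only its restriction to the tangent space at \<open>\<pi>(w)\<close>
  matters). Where \<open>S\<close> is a subbundle the value is unique. In general the class of \<open>(\<nabla>X)(\<pi>(w))\<close> can
  depend on the section \<open>X\<close> of \<open>S\<close> through \<open>w\<close>, even for the members of the derived flag. For the
  connection on the trivial bundle of rank 3 over \<open>\<real>\<^sup>2\<close> with
  \<open>\<nabla>e\<^sub>1 = (x\<^sup>2/2) dy \<otimes> e\<^sub>3\<close>, \<open>\<nabla>e\<^sub>2 = xy dy \<otimes> e\<^sub>3\<close>, \<open>\<nabla>e\<^sub>3 = 0\<close>, the curvature kernel is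
  \<open>{(p,q,r). xp + yq = 0}\<close>, and \<open>S = W\<^sup>(\<^sup>0\<^sup>)\<close> has fibre spanned by \<open>e\<^sub>3\<close> at the origin: there
  the sections \<open>0\<close> and \<open>(y, -x, 0)\<close> of \<open>S\<close> agree, but the derivative of the second one does not take
  values in that span. The form is therefore a fibrewise linear relation, and its kernel consists of
  the \<open>w\<close> at which the zero class is a value.\<close>

definition second_fundamental_form :: "'w set \<Rightarrow> 'w \<Rightarrow> (('m, 'e) tangent \<Rightarrow> 'w set) set" where
  "second_fundamental_form S w =
     {\<lambda>v. fibre_class S (nabla X (proj W w) v) | U X. section_through S w U X}"

definition second_fundamental_kernel :: "'w set \<Rightarrow> 'w set" where
  "second_fundamental_kernel S = {w \<in> S. \<exists>\<alpha>\<in>second_fundamental_form S w.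
     \<forall>v\<in>tangent_space (proj W w). \<alpha> v = fibre_class S (fzero W (proj W w))}"

text \<open>\<open>flag_V i\<close> and \<open>flag_W i\<close> are \<open>V\<^sup>(\<^sup>i\<^sup>)\<close> and \<open>W\<^sup>(\<^sup>i\<^sup>)\<close>.\<close>

primrec flag_V :: "nat \<Rightarrow> 'w set" where
  "flag_V 0 = curvature_kernel"
| "flag_V (Suc i) = second_fundamental_kernel (\<S> (flag_V i))"

definition flag_W :: "nat \<Rightarrow> 'w set" where
  "flag_W i = \<S> (flag_V i)"

definition flag_terminal :: "'w set" where
  "flag_terminal = flag_W (LEAST k. \<forall>l\<ge>k. flag_W l = flag_W k)"

definition regular_at :: "'m \<Rightarrow> bool" where
  "regular_at x \<longleftrightarrow> (\<exists>U. open U \<and> x \<in> U \<and> subbundle_over U flag_terminal)"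

end

end

theory Submission
  imports Defs
begin

text \<open>A parallel section \<open>X\<close> lies in every member of the derived flag. The curvature annihilates it,
  since both iterated covariant derivatives in the curvature are covariant derivatives of the zero
  section. If \<open>X\<close> takes values in \<open>W\<^sup>(\<^sup>i\<^sup>)\<close>, then \<open>X\<close> is a section of \<open>W\<^sup>(\<^sup>i\<^sup>)\<close> through each of its values
  whose covariant derivative \<open>0\<close> lies in \<open>W\<^sup>(\<^sup>i\<^sup>)\<close>, so that \<open>X\<close> takes values in \<open>W\<^sup>(\<^sup>i\<^sup>+\<^sup>1\<^sup>)\<close>
  (\<open>parallel_in_flag_W\<close>).

  For the converse, the terminal member \<open>W\<^sup>(\<^sup>k\<^sup>)\<close> satisfies \<open>W\<^sup>(\<^sup>k\<^sup>+\<^sup>1\<^sup>) = W\<^sup>(\<^sup>k\<^sup>)\<close>, which says that through each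
  of its points there is a section of \<open>W\<^sup>(\<^sup>k\<^sup>)\<close> whose derivative at that point lies in \<open>W\<^sup>(\<^sup>k\<^sup>)\<close> again. Where
  \<open>W\<^sup>(\<^sup>k\<^sup>)\<close> has constant rank, the same follows for all of its sections
  (\<open>nabla_closed_if_constant_rank\<close>): the difference of two sections with equal value at \<open>x\<close> vanishes
  at \<open>x\<close>, its derivative is a limit of difference quotients, which lie in neighbouring fibres of
  \<open>W\<^sup>(\<^sup>k\<^sup>)\<close>, and a family of subspaces of constant rank contains such limits. Hence near a regular point
  the connection restricts to the subbundle \<open>W\<^sup>(\<^sup>k\<^sup>)\<close>, and its curvature vanishes there because
  \<open>W\<^sup>(\<^sup>k\<^sup>) \<subseteq> V\<^sup>(\<^sup>0\<^sup>)\<close>. In coordinates a parallel section is a solution of a linear system \<open>ds = - G s\<close> with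
  vanishing curvature, and such a system has a solution with any prescribed value at one point
  (\<open>flat_linear_system_solvable\<close>).

  That the flag stabilizes at all needs an argument, since its members need not be subbundles. The
  rank of \<open>W\<^sup>(\<^sup>i\<^sup>)\<close> is lower semicontinuous, because sections of \<open>W\<^sup>(\<^sup>i\<^sup>)\<close> pass through all points of
  \<open>W\<^sup>(\<^sup>i\<^sup>)\<close>. Therefore every nonempty open set contains a nonempty open set on which the first \<open>r + 2\<close>
  ranks are constant, \<open>r\<close> being the rank of \<open>W\<close>, and two consecutive ones among them agree; on such a
  set the flag has come to rest and all sections of the stable member have their derivatives in it.
  A section that lies in the stable member over all these sets is called settled. Its
  derivatives are again settled, and it is annihilated by the curvature on a dense set, hence
  everywhere. By induction it lies in all members of the flag (\<open>settled_section_in_flag\<close>). Sections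
  of \<open>W\<^sup>(\<^sup>r\<^sup>)\<close> are settled, and so the flag is stationary from \<open>W\<^sup>(\<^sup>r\<^sup>)\<close> on.\<close>

section \<open>Finite-dimensional inner product spaces\<close>

lemma ex_orthonormal_basis:
  "\<exists>B::'a::fin_dim_inner set. finite B \<and> independent B \<and> (\<forall>x. x = (\<Sum>b\<in>B. (x \<bullet> b) *\<^sub>R b))"
proof -
  obtain B0 :: "'a set" where "finite B0 \<and> (\<forall>x. \<exists>r. x = (\<Sum>b\<in>B0. r b *\<^sub>R b))"
    using ex_finite_spanning[where 'a='a] by (rule exE)
  then have B0: "finite B0" "\<And>x. \<exists>r. x = (\<Sum>b\<in>B0. r b *\<^sub>R b)" by simp_all
  have "span B0 = UNIV"
  proof -
    have "x \<in> span B0" for x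
    proof -
      obtain r where r: "x = (\<Sum>b\<in>B0. r b *\<^sub>R b)" using B0(2)[of x] by (rule exE)
      show ?thesis unfolding r by (intro span_sum span_scale span_base)
    qed
    then show ?thesis by auto
  qed
  then obtain C :: "'a set" where C: "finite C" "span C = UNIV" "pairwise orthogonal C"
    using basis_orthogonal[OF B0(1)] by auto
  \<comment> \<open>Orthogonalizing a dependent set produces \<open>0\<close>, which cannot be normalized.\<close>
  define D where "D = C - {0}"
  have D: "finite D" "span D = UNIV" "pairwise orthogonal D" "0 \<notin> D"
    using C unfolding D_def
    by (auto simp: pairwise_def span_delete_0)
  define n where "n = (\<lambda>b::'a. b /\<^sub>R norm b)"
  define E where "E = n ` D"
  have ortho: "(\<Sum>b\<in>D. (x \<bullet> n b) *\<^sub>R n b) = x" for x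
  proof -
    have "x \<in> span D" using D by auto
    then obtain r where r: "x = (\<Sum>b\<in>D. r b *\<^sub>R b)"
      using D(1) by (auto simp: span_finite)
    have "(x \<bullet> n b) *\<^sub>R n b = r b *\<^sub>R b" if "b \<in> D" for b
    proof -
      have "x \<bullet> b = (\<Sum>c\<in>D. r c * (c \<bullet> b))"
        by (subst r) (simp add: inner_sum_left)
      also have "\<dots> = (\<Sum>c\<in>D. if c = b then r b * (b \<bullet> b) else 0)"
        using D(3) that by (intro sum.cong) (auto simp: pairwise_def orthogonal_def)
      also have "\<dots> = r b * (b \<bullet> b)" using D(1) that by simp
      finally have "x \<bullet> b = r b * (norm b * norm b)" by (simp add: dot_square_norm power2_eq_square)
      moreover have "norm b \<noteq> 0" using that D(4) by auto
      ultimately show ?thesis unfolding n_def by (simp add: field_simps)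
    qed
    then have "(\<Sum>b\<in>D. (x \<bullet> n b) *\<^sub>R n b) = (\<Sum>b\<in>D. r b *\<^sub>R b)" by (rule sum.cong[OF refl])
    then show ?thesis using r by simp
  qed
  have inj: "inj_on n D"
  proof
    fix b c assume bc: "b \<in> D" "c \<in> D" "n b = n c"
    have nz: "norm b \<noteq> 0" "norm c \<noteq> 0" using bc D(4) by auto
    show "b = c"
    proof (rule ccontr)
      assume "b \<noteq> c"
      then have "b \<bullet> c = 0" using D(3) bc by (auto simp: pairwise_def orthogonal_def)
      then have "n b \<bullet> n c = 0" by (simp add: n_def)
      then have "n b = 0" using bc(3) by simp
      then show False using nz by (simp add: n_def)
    qed
  qed
  have "independent E" unfolding E_def
  proof (rule pairwise_orthogonal_independent)
    show "pairwise orthogonal (n ` D)"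
      using D(3) by (force simp: pairwise_def orthogonal_def n_def)
    show "0 \<notin> n ` D" using D(4) by (auto simp: n_def)
  qed
  moreover have "x = (\<Sum>b\<in>E. (x \<bullet> b) *\<^sub>R b)" for x
    unfolding E_def using inj ortho[of x] by (simp add: sum.reindex)
  moreover have "finite E" unfolding E_def using D by simp
  ultimately show ?thesis by blast
qed

definition onb :: "'a::fin_dim_inner set" where
  "onb = (SOME B. finite B \<and> independent B \<and> (\<forall>x. x = (\<Sum>b\<in>B. (x \<bullet> b) *\<^sub>R b)))"

lemma onb: "finite (onb :: 'a::fin_dim_inner set)" "independent (onb :: 'a set)"
    "(\<Sum>b\<in>onb. (x \<bullet> b) *\<^sub>R b) = (x::'a)"
  using someI_ex[OF ex_orthonormal_basis[where 'a='a]] unfolding onb_def by metis+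

lemma span_onb: "span (onb :: 'a::fin_dim_inner set) = UNIV"
proof -
  have "x \<in> span onb" for x :: 'a
    by (subst onb(3)[symmetric]) (intro span_sum span_scale span_base)
  then show ?thesis by auto
qed

lemma linear_onb:
  assumes "linear f"
  shows "f (x::'a::fin_dim_inner) = (\<Sum>b\<in>onb. (x \<bullet> b) *\<^sub>R f b)"
proof -
  have "f x = f (\<Sum>b\<in>onb. (x \<bullet> b) *\<^sub>R b)" by (simp add: onb)
  also have "\<dots> = (\<Sum>b\<in>onb. (x \<bullet> b) *\<^sub>R f b)"
    by (simp add: linear_sum[OF assms] linear_cmul[OF assms] o_def)
  finally show ?thesis .
qed

lemma linear_imp_bounded_linear:
  fixes f :: "'a::fin_dim_inner \<Rightarrow> 'b::real_normed_vector"
  assumes "linear f"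
  shows "bounded_linear f"
proof -
  have "bounded_linear (\<lambda>x. \<Sum>b\<in>onb. (x \<bullet> b) *\<^sub>R f b)"
    by (intro bounded_linear_intros)
  then show ?thesis
    by (rule ssubst[where P=bounded_linear, rotated]) (rule ext, rule linear_onb[OF assms])
qed

lemma finite_dimensional_vector_space_onb:
  "finite_dimensional_vector_space (scaleR :: real \<Rightarrow> 'a \<Rightarrow> 'a) (onb :: 'a::fin_dim_inner set)"
proof unfold_locales
  show "finite (onb :: 'a set)" by (rule onb)
  show "real_vector.independent (onb :: 'a set)"
    unfolding dependent_raw_def[symmetric] by (rule onb)
  show "module.span (scaleR :: real \<Rightarrow> 'a \<Rightarrow> 'a) onb = UNIV"
    unfolding span_raw_def[symmetric] by (rule span_onb)
qed

text \<open>The constants for real vector spaces are those of the vector space locales, specialized to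
  scalar multiplication; folding them back gives the facts on finite-dimensional spaces in terms of \<open>dim\<close>, \<open>span\<close> and
  \<open>independent\<close>.\<close>

lemmas fd_folded = dim_raw_def[symmetric] span_raw_def[symmetric] dependent_raw_def[symmetric]
  subspace_raw_def[symmetric]

lemma fd_finiteI_independent: "independent B \<Longrightarrow> finite (B :: 'a::fin_dim_inner set)"
  by (rule finite_dimensional_vector_space.finiteI_independent[OF finite_dimensional_vector_space_onb,
        unfolded fd_folded])

lemma fd_independent_card_le_dim:
  "B \<subseteq> V \<Longrightarrow> independent B \<Longrightarrow> card (B :: 'a::fin_dim_inner set) \<le> dim V"
  by (rule finite_dimensional_vector_space.independent_card_le_dim[OF
        finite_dimensional_vector_space_onb, unfolded fd_folded])

lemma fd_subspace_dim_equal: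
  fixes S :: "'a::fin_dim_inner set"
  shows "subspace S \<Longrightarrow> subspace T \<Longrightarrow> S \<subseteq> T \<Longrightarrow> dim S \<ge> dim T \<Longrightarrow> S = T"
  by (rule finite_dimensional_vector_space.subspace_dim_equal[OF
        finite_dimensional_vector_space_onb, unfolded fd_folded])

lemma fd_dim_subset: "S \<subseteq> T \<Longrightarrow> dim (S :: 'a::fin_dim_inner set) \<le> dim T"
  by (rule finite_dimensional_vector_space.dim_subset[OF
        finite_dimensional_vector_space_onb, unfolded fd_folded])

lemma ex_projection:
  fixes F :: "'a::fin_dim_inner set"
  assumes "subspace F"
  shows "\<exists>P. bounded_linear P \<and> range P \<subseteq> F \<and> (\<forall>v\<in>F. P v = v)"
proof -
  obtain P :: "'a \<Rightarrow> 'a" where "P ` UNIV \<subseteq> F" "linear P" "\<forall>v\<in>F. P (id v) = v"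
    using linear_exists_left_inverse_on[OF linear_id assms] by (auto simp: Pi_iff)
  then show ?thesis using linear_imp_bounded_linear by auto
qed

text \<open>Linear independence is an open condition. The functionals \<open>l b\<close> are dual to the given vectors,
  so that a small perturbation of these vectors leaves the matrix of values of the functionals
  diagonally dominant; evaluating \<open>l i\<close> on a vanishing combination, where \<open>i\<close> has the largest
  coefficient, then gives a contradiction.\<close>

lemma independent_open:
  fixes B :: "'a::fin_dim_inner set"
  assumes "independent B"
  shows "\<exists>e>0. \<forall>g. (\<forall>b\<in>B. dist (g b) b < e) \<longrightarrow> inj_on g B \<and> independent (g ` B)"
proof -
  have fin: "finite B" using assms by (rule fd_finiteI_independent)
  have "\<exists>l::'a \<Rightarrow> real. linear l \<and> (\<forall>c\<in>B. l c = (if c = b then 1 else 0))" for b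
    using linear_independent_extend[OF assms, of "\<lambda>c. if c = b then 1 else 0 :: real"] by blast
  then obtain l :: "'a \<Rightarrow> 'a \<Rightarrow> real" where l: "\<And>b. linear (l b)"
      "\<And>b c. c \<in> B \<Longrightarrow> l b c = (if c = b then 1 else 0)"
    by metis
  have "\<exists>K>0. \<forall>x. norm (l b x) \<le> norm x * K" for b
    using bounded_linear.pos_bounded[OF linear_imp_bounded_linear[OF l(1)]] by blast
  then obtain K where K: "\<And>b. K b > 0" "\<And>b x. norm (l b x) \<le> norm x * K b"
    by metis
  define M where "M = (\<Sum>b\<in>B. K b) + 1"
  have M: "M > 0" "\<And>b. b \<in> B \<Longrightarrow> K b \<le> M"
  proof -
    have "(\<Sum>b\<in>B. K b) \<ge> 0" using K(1) by (simp add: less_imp_le sum_nonneg)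
    then show "M > 0" unfolding M_def by simp
    show "K b \<le> M" if "b \<in> B" for b
      using member_le_sum[of b B K] that fin K(1) unfolding M_def by (simp add: less_imp_le)
  qed
  define e where "e = 1 / (2 * M * (real (card B) + 1))"
  have e: "e > 0" unfolding e_def using M by simp
  have main: "\<forall>b\<in>B. c b = 0"
    if g: "\<forall>b\<in>B. dist (g b) b < e" and 0: "(\<Sum>b\<in>B. c b *\<^sub>R g b) = 0" for g c
  proof (rule ccontr)
    assume "\<not> (\<forall>b\<in>B. c b = 0)"
    then have ne: "B \<noteq> {}" by auto
    define m where "m = Max ((\<lambda>b. \<bar>c b\<bar>) ` B)"
    have le: "\<bar>c b\<bar> \<le> m" if "b \<in> B" for b
      unfolding m_def using fin that by simp
    have mpos: "m > 0"
      using \<open>\<not> (\<forall>b\<in>B. c b = 0)\<close> le by force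
    have "m \<in> (\<lambda>b. \<bar>c b\<bar>) ` B" unfolding m_def using fin ne by (intro Max_in) auto
    then obtain i where i: "i \<in> B" "\<bar>c i\<bar> = m" by auto
    have "0 = l i (\<Sum>b\<in>B. c b *\<^sub>R g b)"
      by (simp add: 0 linear_0[OF l(1)])
    also have "\<dots> = (\<Sum>b\<in>B. c b * l i (g b))"
      by (simp add: linear_sum[OF l(1)] linear_cmul[OF l(1)] o_def)
    also have "\<dots> = (\<Sum>b\<in>B. c b * l i b) + (\<Sum>b\<in>B. c b * l i (g b - b))"
      by (simp add: linear_diff[OF l(1)] sum.distrib[symmetric] algebra_simps)
    also have "(\<Sum>b\<in>B. c b * l i b) = c i"
    proof -
      have "(\<Sum>b\<in>B. c b * l i b) = (\<Sum>b\<in>B. if b = i then c i else 0)"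
        by (rule sum.cong) (auto simp: l(2))
      then show ?thesis using fin i by simp
    qed
    finally have "m = \<bar>\<Sum>b\<in>B. c b * l i (g b - b)\<bar>" using i(2) by linarith
    also have "\<dots> \<le> (\<Sum>b\<in>B. m * (e * M))"
    proof (rule order.trans[OF sum_abs], rule sum_mono)
      fix b assume b: "b \<in> B"
      have "norm (l i (g b - b)) \<le> norm (g b - b) * K i" by (rule K)
      also have "\<dots> \<le> e * M"
        using g b M i K(1) e by (intro mult_mono) (auto simp: dist_norm less_imp_le)
      finally show "\<bar>c b * l i (g b - b)\<bar> \<le> m * (e * M)"
        using le[OF b] mpos by (simp add: abs_mult mult_mono)
    qed
    also have "\<dots> = m * (real (card B) / (2 * (real (card B) + 1)))"
      using M(1) unfolding e_def by simp
    also have "\<dots> < m * 1"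
      using mpos by (intro mult_strict_left_mono) (auto simp: field_simps)
    finally show False by simp
  qed
  have "inj_on g B \<and> independent (g ` B)" if g: "\<forall>b\<in>B. dist (g b) b < e" for g
  proof
    show inj: "inj_on g B"
    proof
      fix x y assume xy: "x \<in> B" "y \<in> B" "g x = g y"
      show "x = y"
      proof (rule ccontr)
        assume ne: "x \<noteq> y"
        define c :: "'a \<Rightarrow> real" where "c b = (if b = x then 1 else if b = y then -1 else 0)" for b
        have "(\<Sum>b\<in>B. c b *\<^sub>R g b) = (\<Sum>b\<in>{x,y}. c b *\<^sub>R g b)"
          by (rule sum.mono_neutral_right) (use fin xy in \<open>auto simp: c_def\<close>)
        also have "\<dots> = 0" using ne xy by (simp add: c_def)
        finally have "c x = 0" using main[OF g] xy by blast
        then show False by (simp add: c_def)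
      qed
    qed
    show "independent (g ` B)"
    proof (rule independent_if_scalars_zero)
      show "finite (g ` B)" using fin by simp
      fix f x assume f: "(\<Sum>x\<in>g ` B. f x *\<^sub>R x) = 0" and x: "x \<in> g ` B"
      then have "(\<Sum>b\<in>B. f (g b) *\<^sub>R g b) = 0" using inj by (simp add: sum.reindex)
      then show "f x = 0" using main[OF g, of "\<lambda>b. f (g b)"] x by auto
    qed
  qed
  then show ?thesis using e by blast
qed

section \<open>Smooth maps between finite-dimensional spaces\<close>

lemma Ck_on_imp_continuous_on:
  "open S \<Longrightarrow> Ck_on k S f \<Longrightarrow> continuous_on S f"
  by (cases k)
    (auto intro!: continuous_at_imp_continuous_on differentiable_imp_continuous_within)

lemma Ck_on_cong:
  assumes "open S" "\<And>x. x \<in> S \<Longrightarrow> f x = g x" "Ck_on k S f"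
  shows "Ck_on k S g"
  using assms(2,3)
proof (induction k arbitrary: f g)
  case 0
  then show ?case by (simp cong: continuous_on_cong)
next
  case (Suc k)
  have der: "(g has_derivative frechet_derivative f (at x)) (at x)" if "x \<in> S" for x
  proof (rule has_derivative_transform_within_open[OF _ assms(1) that])
    show "(f has_derivative frechet_derivative f (at x)) (at x)"
      using Suc.prems(2) that by (simp add: frechet_derivative_works[symmetric])
  qed (use Suc.prems in auto)
  then have eq: "frechet_derivative g (at x) = frechet_derivative f (at x)" if "x \<in> S" for x
    using that frechet_derivative_at by metis
  have "Ck_on k S (\<lambda>x. frechet_derivative g (at x) v)" for v
    by (rule Suc.IH[of "\<lambda>x. frechet_derivative f (at x) v"]) (use Suc.prems eq in auto)
  then show ?case using der by (auto simp: differentiable_def)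
qed

lemma Ck_on_SucI:
  assumes "open S" "\<And>x. x \<in> S \<Longrightarrow> (f has_derivative f' x) (at x)"
    "\<And>v. Ck_on k S (\<lambda>x. f' x v)"
  shows "Ck_on (Suc k) S f"
proof -
  have "Ck_on k S (\<lambda>x. frechet_derivative f (at x) v)" for v
    by (rule Ck_on_cong[OF assms(1) _ assms(3)[of v]])
      (use frechet_derivative_at[OF assms(2)] in auto)
  then show ?thesis using assms(2) by (auto simp: differentiable_def)
qed

lemma Ck_on_SucD:
  assumes "Ck_on (Suc k) S f"
  shows "x \<in> S \<Longrightarrow> (f has_derivative frechet_derivative f (at x)) (at x)"
    "Ck_on k S (\<lambda>x. frechet_derivative f (at x) v)"
  using assms by (simp_all add: frechet_derivative_works[symmetric])

lemma Ck_on_Suc_imp: "open S \<Longrightarrow> Ck_on (Suc k) S f \<Longrightarrow> Ck_on k S f"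
proof (induction k arbitrary: f)
  case 0
  then show ?case using Ck_on_imp_continuous_on by fastforce
next
  case (Suc k)
  then show ?case using Ck_on.simps(2) by blast
qed

lemma Ck_on_subset: "Ck_on k S f \<Longrightarrow> T \<subseteq> S \<Longrightarrow> Ck_on k T f"
  by (induction k arbitrary: f) (auto intro: continuous_on_subset)

lemma Ck_on_local:
  assumes "\<And>x. x \<in> S \<Longrightarrow> \<exists>T. open T \<and> x \<in> T \<and> Ck_on k T f"
  shows "Ck_on k S f"
  using assms
proof (induction k arbitrary: f)
  case 0
  show ?case
    unfolding Ck_on.simps
  proof (rule continuous_at_imp_continuous_on, rule ballI)
    fix x assume "x \<in> S"
    then obtain T where "open T" "x \<in> T" "continuous_on T f" using 0 by auto
    then show "isCont f x" by (simp add: continuous_on_eq_continuous_at)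
  qed
next
  case (Suc k)
  show ?case
    unfolding Ck_on.simps
  proof (intro conjI ballI allI)
    fix x assume "x \<in> S"
    then show "f differentiable (at x)" using Suc.prems by auto
  next
    fix v show "Ck_on k S (\<lambda>x. frechet_derivative f (at x) v)"
      by (rule Suc.IH) (use Suc.prems in \<open>auto; blast\<close>)
  qed
qed

lemma Ck_on_const: "open S \<Longrightarrow> Ck_on k S (\<lambda>x. c)"
proof (induction k arbitrary: c)
  case (Suc k)
  show ?case by (rule Ck_on_SucI[OF Suc.prems, where f'="\<lambda>_ _. 0"]) (use Suc in auto)
qed simp

lemma Ck_on_bounded_linear:
  assumes "bounded_linear L" "open S"
  shows "Ck_on k S f \<Longrightarrow> Ck_on k S (\<lambda>x. L (f x))"
proof (induction k arbitrary: f)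
  case 0
  then show ?case using assms(1) by (simp add: bounded_linear.continuous_on)
next
  case (Suc k)
  show ?case
    by (rule Ck_on_SucI[OF assms(2), where f'="\<lambda>x v. L (frechet_derivative f (at x) v)"])
      (use bounded_linear.has_derivative[OF assms(1) Ck_on_SucD(1)[OF Suc.prems]]
        Suc.IH[OF Ck_on_SucD(2)[OF Suc.prems]] in auto)
qed

lemma Ck_on_add:
  assumes "open S"
  shows "Ck_on k S f \<Longrightarrow> Ck_on k S g \<Longrightarrow> Ck_on k S (\<lambda>x. f x + g x)"
proof (induction k arbitrary: f g)
  case 0
  then show ?case by (simp add: continuous_on_add)
next
  case (Suc k)
  show ?case
    by (rule Ck_on_SucI[OF assms,
          where f'="\<lambda>x v. frechet_derivative f (at x) v + frechet_derivative g (at x) v"])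
      (use has_derivative_add[OF Ck_on_SucD(1)[OF Suc.prems(1)] Ck_on_SucD(1)[OF Suc.prems(2)]]
        Suc.IH[OF Ck_on_SucD(2)[OF Suc.prems(1)] Ck_on_SucD(2)[OF Suc.prems(2)]] in auto)
qed

lemma Ck_on_bilinear:
  assumes "bounded_bilinear B" "open S"
  shows "Ck_on k S f \<Longrightarrow> Ck_on k S g \<Longrightarrow> Ck_on k S (\<lambda>x. B (f x) (g x))"
proof (induction k arbitrary: f g)
  case 0
  then show ?case using assms(1) by (simp add: bounded_bilinear.continuous_on)
next
  case (Suc k)
  note f = Suc.prems(1) and g = Suc.prems(2)
  show ?case
  proof (rule Ck_on_SucI[OF assms(2)])
    show "((\<lambda>x. B (f x) (g x)) has_derivative
        (\<lambda>v. B (f x) (frechet_derivative g (at x) v) + B (frechet_derivative f (at x) v) (g x))) (at x)"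
      if "x \<in> S" for x
      using bounded_bilinear.FDERIV[OF assms(1) Ck_on_SucD(1)[OF f that] Ck_on_SucD(1)[OF g that]] .
    show "Ck_on k S (\<lambda>x. B (f x) (frechet_derivative g (at x) v) +
        B (frechet_derivative f (at x) v) (g x))" for v
      by (intro Ck_on_add[OF assms(2)] Suc.IH Ck_on_SucD(2)[OF f] Ck_on_SucD(2)[OF g]
          Ck_on_Suc_imp[OF assms(2) f] Ck_on_Suc_imp[OF assms(2) g])
  qed
qed

lemma Ck_on_sum:
  assumes "open S"
  shows "(\<And>i. i \<in> I \<Longrightarrow> Ck_on k S (f i)) \<Longrightarrow> Ck_on k S (\<lambda>x. \<Sum>i\<in>I. f i x)"
  by (induction I rule: infinite_finite_induct) (auto intro: Ck_on_const Ck_on_add assms)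

text \<open>The class \<open>C\<^sup>k\<close> is defined by derivatives in fixed directions. The chain rule produces the derivative
  of \<open>f\<close> in the variable direction \<open>Dg(x) v\<close>, which is therefore expanded in a basis.\<close>

lemma Ck_on_compose:
  fixes g :: "'a::real_normed_vector \<Rightarrow> 'b::fin_dim_inner"
  assumes "open S" "open T" "g ` S \<subseteq> T"
  shows "Ck_on k T f \<Longrightarrow> Ck_on k S g \<Longrightarrow> Ck_on k S (\<lambda>x. f (g x))"
proof (induction k arbitrary: f)
  case 0
  then show ?case using continuous_on_compose2[OF _ _ assms(3)] by simp
next
  case (Suc k)
  note f = Suc.prems(1) and g = Suc.prems(2)
  let ?f' = "\<lambda>x v. \<Sum>b\<in>onb. (frechet_derivative g (at x) v \<bullet> b) *\<^sub>R frechet_derivative f (at (g x)) b"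
  show ?case
  proof (rule Ck_on_SucI[OF assms(1)])
    fix x assume x: "x \<in> S"
    have "g x \<in> T" using x assms(3) by auto
    then have d: "(f has_derivative frechet_derivative f (at (g x))) (at (g x))"
      using Ck_on_SucD(1)[OF f] by blast
    have "((\<lambda>x. f (g x)) has_derivative
        (\<lambda>v. frechet_derivative f (at (g x)) (frechet_derivative g (at x) v))) (at x)"
      by (rule has_derivative_compose[OF Ck_on_SucD(1)[OF g x] d])
    then show "((\<lambda>x. f (g x)) has_derivative ?f' x) (at x)"
      by (rule has_derivative_eq_rhs) (rule ext, rule linear_onb[OF has_derivative_linear[OF d]])
  next
    fix v
    show "Ck_on k S (\<lambda>x. ?f' x v)"
    proof (rule Ck_on_sum[OF assms(1)], rule Ck_on_bilinear[OF bounded_bilinear_scaleR assms(1)])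
      fix b :: 'b
      show "Ck_on k S (\<lambda>x. frechet_derivative g (at x) v \<bullet> b)"
        by (rule Ck_on_bounded_linear[OF bounded_linear_inner_left assms(1) Ck_on_SucD(2)[OF g]])
      show "Ck_on k S (\<lambda>x. frechet_derivative f (at (g x)) b)"
        by (rule Suc.IH[OF Ck_on_SucD(2)[OF f] Ck_on_Suc_imp[OF assms(1) g]])
    qed
  qed
qed

lemma smooth_on_cong: "open S \<Longrightarrow> (\<And>x. x \<in> S \<Longrightarrow> f x = g x) \<Longrightarrow> smooth_on S f \<Longrightarrow> smooth_on S g"
  unfolding smooth_on_def by (intro allI, rule Ck_on_cong[of S f g]) auto

lemma smooth_on_subset: "smooth_on S f \<Longrightarrow> T \<subseteq> S \<Longrightarrow> smooth_on T f"
  unfolding smooth_on_def by (intro allI, rule Ck_on_subset[of _ S f T]) auto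

lemma smooth_on_local:
  "(\<And>x. x \<in> S \<Longrightarrow> \<exists>T. open T \<and> x \<in> T \<and> smooth_on T f) \<Longrightarrow> smooth_on S f"
  unfolding smooth_on_def by (intro allI Ck_on_local) auto

lemma smooth_on_const: "open S \<Longrightarrow> smooth_on S (\<lambda>x. c)"
  unfolding smooth_on_def by (intro allI, rule Ck_on_const[of S]) auto

lemma smooth_on_bounded_linear:
  "bounded_linear L \<Longrightarrow> open S \<Longrightarrow> smooth_on S f \<Longrightarrow> smooth_on S (\<lambda>x. L (f x))"
  unfolding smooth_on_def by (intro allI, rule Ck_on_bounded_linear[of L S _ f]) auto

lemma smooth_on_add:
  "open S \<Longrightarrow> smooth_on S f \<Longrightarrow> smooth_on S g \<Longrightarrow> smooth_on S (\<lambda>x. f x + g x)"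
  unfolding smooth_on_def by (intro allI, rule Ck_on_add[of S _ f g]) auto

lemma smooth_on_bilinear:
  "bounded_bilinear B \<Longrightarrow> open S \<Longrightarrow> smooth_on S f \<Longrightarrow> smooth_on S g \<Longrightarrow>
    smooth_on S (\<lambda>x. B (f x) (g x))"
  unfolding smooth_on_def by (intro allI, rule Ck_on_bilinear[of B S _ f g]) auto

lemma smooth_on_sum:
  "open S \<Longrightarrow> (\<And>i. i \<in> I \<Longrightarrow> smooth_on S (f i)) \<Longrightarrow> smooth_on S (\<lambda>x. \<Sum>i\<in>I. f i x)"
  unfolding smooth_on_def by (intro allI, rule Ck_on_sum[of S I _ f]) auto

lemma smooth_on_compose:
  fixes g :: "'a::real_normed_vector \<Rightarrow> 'b::fin_dim_inner"
  shows "open S \<Longrightarrow> open T \<Longrightarrow> g ` S \<subseteq> T \<Longrightarrow> smooth_on T f \<Longrightarrow> smooth_on S g \<Longrightarrow>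
    smooth_on S (\<lambda>x. f (g x))"
  unfolding smooth_on_def by (intro allI, rule Ck_on_compose[of S T g _ f]) auto

lemma smooth_on_imp_continuous_on: "open S \<Longrightarrow> smooth_on S f \<Longrightarrow> continuous_on S f"
  unfolding smooth_on_def by (rule Ck_on_imp_continuous_on[of S 0]) auto

lemma smooth_on_has_derivative:
  "smooth_on S f \<Longrightarrow> x \<in> S \<Longrightarrow> (f has_derivative frechet_derivative f (at x)) (at x)"
  unfolding smooth_on_def using Ck_on_SucD(1)[of 0 S f x] by simp

lemma smooth_on_frechet_derivative:
  "smooth_on S f \<Longrightarrow> smooth_on S (\<lambda>x. frechet_derivative f (at x) v)"
  unfolding smooth_on_def using Ck_on_SucD(2)[of _ S f v] by simp

lemma smooth_on_id: "open S \<Longrightarrow> smooth_on S (\<lambda>x. x)"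
proof -
  assume S: "open S"
  have "Ck_on k S (\<lambda>x. x)" for k
    by (cases k) (auto intro!: Ck_on_SucI[OF S, where f'="\<lambda>_ v. v"] Ck_on_const S simp del: Ck_on.simps(2))
  then show ?thesis by (simp add: smooth_on_def)
qed

text \<open>A map into a space of linear operators is assembled from its values on an orthonormal basis.
  Writing the derivative in this way shows that it is again smooth, now as a map into the Banach
  space of operators.\<close>

definition onb_blinfun :: "('a::fin_dim_inner \<Rightarrow> 'b::real_normed_vector) \<Rightarrow> 'a \<Rightarrow>\<^sub>L 'b" where
  "onb_blinfun f = (\<Sum>b\<in>onb. blinfun_scaleR_left (f b) o\<^sub>L blinfun_inner_left b)"

lemma onb_blinfun_apply: "linear f \<Longrightarrow> blinfun_apply (onb_blinfun f) v = f v"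
  unfolding onb_blinfun_def by (simp add: blinfun.sum_left linear_onb[of f v])

lemma bounded_linear_rank_one:
  "bounded_linear (\<lambda>a. blinfun_scaleR_left a o\<^sub>L blinfun_inner_left b)"
  by (rule bounded_linear_compose[OF
        bounded_bilinear.bounded_linear_left[OF bounded_bilinear_blinfun_compose]
        bounded_linear_blinfun_scaleR_left])

lemma smooth_on_onb_blinfun:
  fixes f :: "'x::real_normed_vector \<Rightarrow> 'a::fin_dim_inner \<Rightarrow> 'b::real_normed_vector"
  assumes "open S" "\<And>v. smooth_on S (\<lambda>x. f x v)"
  shows "smooth_on S (\<lambda>x. onb_blinfun (f x))"
  unfolding onb_blinfun_def
  by (rule smooth_on_sum[OF assms(1)], rule smooth_on_bounded_linear[OF bounded_linear_rank_one])
    (use assms in auto)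

definition fderiv :: "('a::fin_dim_inner \<Rightarrow> 'b::real_normed_vector) \<Rightarrow> 'a \<Rightarrow> 'a \<Rightarrow>\<^sub>L 'b" where
  "fderiv f x = onb_blinfun (frechet_derivative f (at x))"

lemma fderiv_apply:
  "smooth_on S f \<Longrightarrow> x \<in> S \<Longrightarrow> blinfun_apply (fderiv f x) = frechet_derivative f (at x)"
  unfolding fderiv_def
  by (rule ext) (rule onb_blinfun_apply[OF has_derivative_linear[OF smooth_on_has_derivative]])

lemma has_derivative_fderiv:
  "smooth_on S f \<Longrightarrow> x \<in> S \<Longrightarrow> (f has_derivative fderiv f x) (at x)"
  using smooth_on_has_derivative[of S f x] fderiv_apply[of S f x] by simp

lemma smooth_on_fderiv: "open S \<Longrightarrow> smooth_on S f \<Longrightarrow> smooth_on S (fderiv f)"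
  unfolding fderiv_def[abs_def] by (intro smooth_on_onb_blinfun smooth_on_frechet_derivative)

text \<open>The second difference quotient on the parallelogram with sides \<open>t u\<close> and \<open>t v\<close> tends to the second
  derivative. By the mean value theorem it suffices that the derivative
  \<open>f' (x + s u + t v) u - f' (x + s u) u\<close> of \<open>s \<mapsto> f (x + s u + t v) - f (x + s u)\<close> differs from
  \<open>t f'' v u\<close> by a small multiple of \<open>t\<close>, and this only needs that \<open>f'\<close> is differentiable at \<open>x\<close>.\<close>

lemma second_difference_limit:
  fixes f :: "'a::real_normed_vector \<Rightarrow> 'b::real_normed_vector" and f' :: "'a \<Rightarrow> 'a \<Rightarrow>\<^sub>L 'b"
  assumes S: "open S" "x \<in> S" and f: "\<And>y. y \<in> S \<Longrightarrow> (f has_derivative f' y) (at y)"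
    and f': "(f' has_derivative f'') (at x)" and e: "e > 0"
  shows "\<exists>d>0. \<forall>t. 0 < t \<and> t < d \<longrightarrow>
    norm (f (x + t *\<^sub>R u + t *\<^sub>R v) - f (x + t *\<^sub>R u) - f (x + t *\<^sub>R v) + f x - (t * t) *\<^sub>R f'' v u)
      \<le> e * (t * t)"
proof -
  define K where "K = norm u + norm v + 1"
  have K: "K > 0" "norm u \<le> K" unfolding K_def by (simp_all add: add_nonneg_pos)
  define e' where "e' = e / (2 * K * K)"
  have e': "e' > 0" using e K by (simp add: e'_def)
  interpret f'': bounded_linear f'' using f' by (rule has_derivative_bounded_linear)
  obtain d1 where d1: "d1 > 0"
    "\<And>y. norm (y - x) < d1 \<Longrightarrow> norm (f' y - f' x - f'' (y - x)) \<le> e' * norm (y - x)"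
    using f' e' unfolding has_derivative_at_alt by blast
  obtain d2 where d2: "d2 > 0" "ball x d2 \<subseteq> S" using S by (meson open_contains_ball)
  define d where "d = min d1 d2 / K"
  have d: "d > 0" using d1 d2 K by (simp add: d_def)
  have "norm (f (x + t *\<^sub>R u + t *\<^sub>R v) - f (x + t *\<^sub>R u) - f (x + t *\<^sub>R v) + f x - (t * t) *\<^sub>R f'' v u)
      \<le> e * (t * t)" if t: "0 < t" "t < d" for t
  proof -
    have tK: "t * K < d1" "t * K < d2"
      using t K by (auto simp: d_def field_simps)
    have near: "norm (s *\<^sub>R u + r *\<^sub>R v) \<le> t * K" if "s \<in> {0..t}" "r \<in> {0..t}" for s r
    proof -
      have "norm (s *\<^sub>R u + r *\<^sub>R v) \<le> s * norm u + r * norm v"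
        using norm_triangle_ineq[of "s *\<^sub>R u" "r *\<^sub>R v"] that by simp
      also have "\<dots> \<le> t * norm u + t * norm v"
        using that by (intro add_mono mult_right_mono) auto
      also have "\<dots> \<le> t * K" using t unfolding K_def by (simp add: algebra_simps)
      finally show ?thesis .
    qed
    have inS: "x + s *\<^sub>R u + r *\<^sub>R v \<in> S" if "s \<in> {0..t}" "r \<in> {0..t}" for s r
      using near[OF that] tK d2 by (auto simp: dist_norm subset_iff norm_minus_commute add.assoc)
    define \<phi> where "\<phi> s = f (x + s *\<^sub>R u + t *\<^sub>R v) - f (x + s *\<^sub>R u) - (s * t) *\<^sub>R f'' v u" for s
    define \<phi>' where "\<phi>' s = f' (x + s *\<^sub>R u + t *\<^sub>R v) u - f' (x + s *\<^sub>R u) u - t *\<^sub>R f'' v u" for s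
    have "norm (\<phi> t - \<phi> 0) \<le> (e * t) * norm (t - 0)"
    proof (rule differentiable_bound[where S="{0..t}" and f'="\<lambda>s h. h *\<^sub>R \<phi>' s"])
      fix s assume s: "s \<in> {0..t}"
      have "((\<lambda>s. f (x + s *\<^sub>R u + t *\<^sub>R v)) has_derivative
          (\<lambda>h. f' (x + s *\<^sub>R u + t *\<^sub>R v) (h *\<^sub>R u))) (at s)"
        by (rule has_derivative_compose[of "\<lambda>s. x + s *\<^sub>R u + t *\<^sub>R v" "\<lambda>h. h *\<^sub>R u", OF _ f])
          (use s t inS in \<open>auto intro!: derivative_eq_intros\<close>)
      moreover have "((\<lambda>s. f (x + s *\<^sub>R u)) has_derivative (\<lambda>h. f' (x + s *\<^sub>R u) (h *\<^sub>R u))) (at s)"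
        by (rule has_derivative_compose[of "\<lambda>s. x + s *\<^sub>R u" "\<lambda>h. h *\<^sub>R u", OF _ f])
          (use s t inS[of s 0] in \<open>auto intro!: derivative_eq_intros\<close>)
      moreover have "((\<lambda>s. (s * t) *\<^sub>R f'' v u) has_derivative (\<lambda>h. (h * t) *\<^sub>R f'' v u)) (at s)"
        by (auto intro!: derivative_eq_intros)
      ultimately have "(\<phi> has_derivative (\<lambda>h. f' (x + s *\<^sub>R u + t *\<^sub>R v) (h *\<^sub>R u)
          - f' (x + s *\<^sub>R u) (h *\<^sub>R u) - (h * t) *\<^sub>R f'' v u)) (at s)"
        unfolding \<phi>_def[abs_def] by (intro has_derivative_diff)
      also have "(\<lambda>h. f' (x + s *\<^sub>R u + t *\<^sub>R v) (h *\<^sub>R u)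
          - f' (x + s *\<^sub>R u) (h *\<^sub>R u) - (h * t) *\<^sub>R f'' v u) = (\<lambda>h. h *\<^sub>R \<phi>' s)"
        by (simp add: \<phi>'_def blinfun.scaleR_right algebra_simps)
      finally show "(\<phi> has_derivative (\<lambda>h. h *\<^sub>R \<phi>' s)) (at s within {0..t})"
        by (rule has_derivative_at_withinI)
      have est: "norm (f' (x + w) - f' x - f'' w) \<le> e' * (t * K)" if "norm w \<le> t * K" for w
      proof -
        have "norm (f' (x + w) - f' x - f'' w) \<le> e' * norm w"
          using d1(2)[of "x + w"] that tK by simp
        also have "\<dots> \<le> e' * (t * K)" using that e' by simp
        finally show ?thesis .
      qed
      let ?y = "s *\<^sub>R u + t *\<^sub>R v" and ?z = "s *\<^sub>R u"
      have "\<phi>' s = (f' (x + ?y) - f' x - f'' ?y) u - (f' (x + ?z) - f' x - f'' ?z) u"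
        by (simp add: \<phi>'_def blinfun.diff_left blinfun.add_left blinfun.scaleR_left f''.add f''.scaleR
            add.assoc)
      also have "norm \<dots> \<le> norm (f' (x + ?y) - f' x - f'' ?y) * norm u
          + norm (f' (x + ?z) - f' x - f'' ?z) * norm u"
        by (rule order.trans[OF norm_triangle_ineq4]) (intro add_mono norm_blinfun)
      also have "\<dots> \<le> (e' * (t * K)) * K + (e' * (t * K)) * K"
        using near[of s t] near[of s 0] s t K e' by (intro add_mono mult_mono est) auto
      also have "\<dots> = e * t" using K by (simp add: e'_def)
      finally have "norm (\<phi>' s) \<le> e * t" .
      then show "onorm (\<lambda>h. h *\<^sub>R \<phi>' s) \<le> e * t"
        using e t by (intro onorm_bound) (auto simp: mult.commute intro!: mult_left_mono)
    qed (use t in auto)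
    then show ?thesis using t by (simp add: \<phi>_def algebra_simps)
  qed
  then show ?thesis using d by blast
qed

text \<open>Schwarz's theorem: the second difference does not change when \<open>u\<close> and \<open>v\<close> are exchanged.\<close>

lemma symmetric_second_derivative:
  fixes f :: "'a::real_normed_vector \<Rightarrow> 'b::real_normed_vector" and f' :: "'a \<Rightarrow> 'a \<Rightarrow>\<^sub>L 'b"
  assumes S: "open S" "x \<in> S" and f: "\<And>y. y \<in> S \<Longrightarrow> (f has_derivative f' y) (at y)"
    and f': "(f' has_derivative f'') (at x)"
  shows "blinfun_apply (f'' u) v = f'' v u"
proof (rule ccontr)
  assume ne: "f'' u v \<noteq> f'' v u"
  define e where "e = norm (f'' u v - f'' v u) / 3"
  have e: "e > 0" using ne by (simp add: e_def)
  obtain d1 where d1: "d1 > 0" "\<And>t. 0 < t \<and> t < d1 \<Longrightarrow>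
      norm (f (x + t *\<^sub>R u + t *\<^sub>R v) - f (x + t *\<^sub>R u) - f (x + t *\<^sub>R v) + f x - (t * t) *\<^sub>R f'' v u)
      \<le> e * (t * t)"
    using second_difference_limit[OF S f f' e, of u v] by blast
  obtain d2 where d2: "d2 > 0" "\<And>t. 0 < t \<and> t < d2 \<Longrightarrow>
      norm (f (x + t *\<^sub>R v + t *\<^sub>R u) - f (x + t *\<^sub>R v) - f (x + t *\<^sub>R u) + f x - (t * t) *\<^sub>R f'' u v)
      \<le> e * (t * t)"
    using second_difference_limit[OF S f f' e, of v u] by blast
  define t where "t = min d1 d2 / 2"
  have t: "0 < t" "t < d1" "t < d2" using d1(1) d2(1) by (auto simp: t_def)
  define D where "D = f (x + t *\<^sub>R u + t *\<^sub>R v) - f (x + t *\<^sub>R u) - f (x + t *\<^sub>R v) + f x"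
  have "f (x + t *\<^sub>R v + t *\<^sub>R u) - f (x + t *\<^sub>R v) - f (x + t *\<^sub>R u) + f x = D"
    unfolding D_def by (simp add: algebra_simps)
  then have "norm (D - (t * t) *\<^sub>R f'' u v) \<le> e * (t * t)" using d2(2)[of t] t by simp
  moreover have "norm (D - (t * t) *\<^sub>R f'' v u) \<le> e * (t * t)"
    using d1(2)[of t] t unfolding D_def by simp
  ultimately have "norm ((D - (t * t) *\<^sub>R f'' v u) - (D - (t * t) *\<^sub>R f'' u v)) \<le> e * (t * t) + e * (t * t)"
    using norm_triangle_ineq4[of "D - (t * t) *\<^sub>R f'' v u" "D - (t * t) *\<^sub>R f'' u v"] by linarith
  also have "(D - (t * t) *\<^sub>R f'' v u) - (D - (t * t) *\<^sub>R f'' u v) = (t * t) *\<^sub>R (f'' u v - f'' v u)"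
    by (simp add: algebra_simps)
  also have "norm \<dots> = (t * t) * (3 * e)" by (simp add: e_def)
  finally show False using t e by (simp add: field_simps)
qed

lemma fderiv_fderiv_symmetric:
  assumes "open S" "smooth_on S f" "x \<in> S"
  shows "fderiv (fderiv f) x u v = fderiv (fderiv f) x v u"
  using symmetric_second_derivative[OF assms(1,3) has_derivative_fderiv[OF assms(2)]
      has_derivative_fderiv[OF smooth_on_fderiv[OF assms(1,2)] assms(3)]] .

section \<open>Flat linear systems\<close>

lemma continuous_on_onb_blinfun:
  fixes f :: "'x::topological_space \<Rightarrow> 'a::fin_dim_inner \<Rightarrow> 'b::real_normed_vector"
  assumes "\<And>v. continuous_on S (\<lambda>x. f x v)"
  shows "continuous_on S (\<lambda>x. onb_blinfun (f x))"
  unfolding onb_blinfun_def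
  by (rule continuous_on_sum, rule bounded_linear.continuous_on[OF bounded_linear_rank_one])
    (rule assms)

text \<open>The system \<open>ds = - G s\<close> with initial value \<open>s p = w\<close>. The last condition is the vanishing of the
  curvature of the connection \<open>d + G\<close>. The ball is taken so small that \<open>C r \<le> 1/4\<close>, which makes the
  Picard iteration converge geometrically.\<close>

locale flat_system =
  fixes G :: "'e::fin_dim_inner \<Rightarrow> 'e \<Rightarrow>\<^sub>L 'f::banach \<Rightarrow>\<^sub>L 'f"
    and G' :: "'e \<Rightarrow> 'e \<Rightarrow>\<^sub>L 'e \<Rightarrow>\<^sub>L 'f \<Rightarrow>\<^sub>L 'f"
    and p :: 'e and r C :: real and w :: 'f
  assumes r: "0 < r" and C: "0 < C" "C * r \<le> 1/4"
    and G: "y \<in> ball p r \<Longrightarrow> (G has_derivative G' y) (at y)"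
    and G'_cont: "continuous_on (ball p r) G'"
    and G_bound: "y \<in> ball p r \<Longrightarrow> norm (G y) \<le> C"
    and G'_bound: "y \<in> ball p r \<Longrightarrow> norm (G' y) \<le> C"
    and flat: "y \<in> ball p r \<Longrightarrow> G' y u v a - G' y v u a + G y u (G y v a) - G y v (G y u a) = 0"
begin

definition ray :: "'e \<Rightarrow> real \<Rightarrow> 'e" where "ray y t = p + t *\<^sub>R (y - p)"

text \<open>A solution satisfies a linear ordinary differential equation along each ray from \<open>p\<close>, and the
  iteration solves all these equations simultaneously. Whether the limit is differentiable
  transversally to the rays, and solves the system in all directions, is a matter of flatness.\<close>

primrec picard :: "nat \<Rightarrow> 'e \<Rightarrow> 'f" where
  "picard 0 y = w"
| "picard (Suc n) y = w - integral {0..1} (\<lambda>t. G (ray y t) (y - p) (picard n (ray y t)))"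

text \<open>The derivative with respect to \<open>y\<close> of the integrand in the iteration, for a function \<open>s\<close> with
  derivative \<open>D\<close>.\<close>

definition integrand_deriv :: "('e \<Rightarrow> 'f) \<Rightarrow> ('e \<Rightarrow> 'e \<Rightarrow>\<^sub>L 'f) \<Rightarrow> 'e \<Rightarrow> real \<Rightarrow> 'e \<Rightarrow>\<^sub>L 'f" where
  "integrand_deriv s D y t = onb_blinfun (\<lambda>v. t *\<^sub>R G' (ray y t) v (y - p) (s (ray y t))
      + G (ray y t) v (s (ray y t)) + t *\<^sub>R G (ray y t) (y - p) (D (ray y t) v))"

primrec picard_deriv :: "nat \<Rightarrow> 'e \<Rightarrow> 'e \<Rightarrow>\<^sub>L 'f" where
  "picard_deriv 0 y = 0"
| "picard_deriv (Suc n) y = - integral {0..1} (integrand_deriv (picard n) (picard_deriv n) y)"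

lemma integrand_deriv_apply:
  "integrand_deriv s D y t v = t *\<^sub>R G' (ray y t) v (y - p) (s (ray y t))
      + G (ray y t) v (s (ray y t)) + t *\<^sub>R G (ray y t) (y - p) (D (ray y t) v)"
  unfolding integrand_deriv_def
  by (rule onb_blinfun_apply) (intro linearI; simp add: blinfun.bilinear_simps algebra_simps)

lemma ray_in_ball: "y \<in> ball p r \<Longrightarrow> t \<in> {0..1} \<Longrightarrow> ray y t \<in> ball p r"
  unfolding ray_def
  by (auto simp: dist_norm norm_minus_commute intro: le_less_trans[OF mult_left_le_one_le])

lemma G_cont: "continuous_on (ball p r) G"
  by (rule has_derivative_continuous_on) (use G in \<open>auto intro: has_derivative_at_withinI\<close>)

lemma ray_cont: "continuous_on A (\<lambda>z. ray (fst z) (snd z))"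
  unfolding ray_def by (intro continuous_intros)

lemma comp_ray_cont:
  assumes "continuous_on (ball p r) h"
  shows "continuous_on (ball p r \<times> {0..1}) (\<lambda>z. h (ray (fst z) (snd z)))"
  by (rule continuous_on_compose2[OF assms ray_cont]) (auto simp: ray_in_ball simp del: mem_ball)

lemma comp_ray_cont':
  assumes "continuous_on (ball p r) h" "y \<in> ball p r"
  shows "continuous_on {0..1} (\<lambda>t. h (ray y t))"
proof (rule continuous_on_compose2[OF assms(1)])
  show "continuous_on {0..1} (ray y)" unfolding ray_def by (intro continuous_intros)
qed (use ray_in_ball assms(2) in auto)

lemma picard_integral_deriv:
  assumes s: "\<And>y. y \<in> ball p r \<Longrightarrow> (s has_derivative blinfun_apply (D y)) (at y)"
    and D: "continuous_on (ball p r) D"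
  shows "y \<in> ball p r \<Longrightarrow> ((\<lambda>y. integral {0..1} (\<lambda>t. G (ray y t) (y - p) (s (ray y t)))) has_derivative
      integral {0..1} (integrand_deriv s D y)) (at y)"
    and "continuous_on (ball p r) (\<lambda>y. integral {0..1} (integrand_deriv s D y))"
proof -
  have s_cont: "continuous_on (ball p r) s"
    by (rule has_derivative_continuous_on) (use s in \<open>auto intro: has_derivative_at_withinI\<close>)
  have cont: "continuous_on (ball p r \<times> cbox 0 1) (\<lambda>(y, t). integrand_deriv s D y t)"
    unfolding integrand_deriv_def case_prod_beta box_real
    by (intro continuous_on_onb_blinfun continuous_intros comp_ray_cont[OF G_cont]
        comp_ray_cont[OF G'_cont] comp_ray_cont[OF s_cont] comp_ray_cont[OF D])
  show "continuous_on (ball p r) (\<lambda>y. integral {0..1} (integrand_deriv s D y))"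
    using integral_continuous_on_param[OF cont] by simp
  assume y: "y \<in> ball p r"
  have "((\<lambda>y. integral (cbox 0 1) (\<lambda>t. G (ray y t) (y - p) (s (ray y t)))) has_derivative
      integral (cbox 0 1) (integrand_deriv s D y)) (at y within ball p r)"
  proof (rule leibniz_rule[OF _ _ cont y convex_ball])
    fix y t assume y: "y \<in> ball p r" and t: "t \<in> cbox (0::real) 1"
    then have rb: "ray y t \<in> ball p r" using ray_in_ball by simp
    have ray: "((\<lambda>y. ray y t) has_derivative (\<lambda>v. t *\<^sub>R v)) (at y)"
      unfolding ray_def by (auto intro!: derivative_eq_intros)
    have "((\<lambda>y. G (ray y t) (y - p) (s (ray y t))) has_derivative
        (\<lambda>v. G (ray y t) (y - p) (D (ray y t) (t *\<^sub>R v))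
          + (G (ray y t) v + G' (ray y t) (t *\<^sub>R v) (y - p)) (s (ray y t)))) (at y)"
    proof (rule bounded_bilinear.FDERIV[OF bounded_bilinear_blinfun_apply])
      show "((\<lambda>y. G (ray y t) (y - p)) has_derivative
          (\<lambda>v. G (ray y t) v + G' (ray y t) (t *\<^sub>R v) (y - p))) (at y)"
        by (rule bounded_bilinear.FDERIV[OF bounded_bilinear_blinfun_apply
              has_derivative_compose[OF ray G[OF rb]]])
          (auto intro!: derivative_eq_intros)
      show "((\<lambda>y. s (ray y t)) has_derivative (\<lambda>v. D (ray y t) (t *\<^sub>R v))) (at y)"
        by (rule has_derivative_compose[OF ray s[OF rb]])
    qed
    also have "(\<lambda>v. G (ray y t) (y - p) (D (ray y t) (t *\<^sub>R v))
          + (G (ray y t) v + G' (ray y t) (t *\<^sub>R v) (y - p)) (s (ray y t))) = integrand_deriv s D y t"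
      by (rule ext) (simp add: integrand_deriv_apply blinfun.bilinear_simps algebra_simps)
    finally show "((\<lambda>y. G (ray y t) (y - p) (s (ray y t))) has_derivative integrand_deriv s D y t)
        (at y within ball p r)"
      by (rule has_derivative_at_withinI)
  next
    fix y assume y: "y \<in> ball p r"
    show "(\<lambda>t. G (ray y t) (y - p) (s (ray y t))) integrable_on cbox 0 1"
      unfolding box_real
      by (intro integrable_continuous_real continuous_intros comp_ray_cont'[OF G_cont y]
          comp_ray_cont'[OF s_cont y])
  qed
  then show "((\<lambda>y. integral {0..1} (\<lambda>t. G (ray y t) (y - p) (s (ray y t)))) has_derivative
      integral {0..1} (integrand_deriv s D y)) (at y)"
    using y by (simp add: at_within_open[OF y open_ball])
qed

lemma picard_has_derivative:
  "(\<forall>y\<in>ball p r. (picard n has_derivative picard_deriv n y) (at y)) \<and> continuous_on (ball p r) (picard_deriv n)"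
proof (induction n)
  case 0
  have "picard 0 = (\<lambda>y. w)" "picard_deriv 0 = (\<lambda>y. 0)" by auto
  then show ?case by (auto simp: zero_blinfun.rep_eq)
next
  case (Suc n)
  have "(picard (Suc n) has_derivative picard_deriv (Suc n) y) (at y)" if y: "y \<in> ball p r" for y
    unfolding picard.simps[abs_def] picard_deriv.simps
    by (rule has_derivative_eq_rhs[OF has_derivative_diff[OF has_derivative_const
            picard_integral_deriv(1)[OF _ _ y]]])
      (use Suc in \<open>auto simp: fun_eq_iff uminus_blinfun.rep_eq\<close>)
  moreover have "continuous_on (ball p r) (picard_deriv (Suc n))"
    unfolding picard_deriv.simps[abs_def]
    by (intro continuous_on_minus picard_integral_deriv(2)) (use Suc in auto)
  ultimately show ?case by blast
qed

lemmas picard_deriv = picard_has_derivative[THEN conjunct1, rule_format]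
lemmas picard_deriv_cont = picard_has_derivative[THEN conjunct2]

lemma picard_cont: "continuous_on (ball p r) (picard n)"
  by (rule has_derivative_continuous_on) (use picard_deriv in \<open>auto intro: has_derivative_at_withinI\<close>)

text \<open>The error of two consecutive iterates in the system. It turns out to tend to \<open>0\<close> uniformly, and this
  yields at the same time the uniform convergence of the derivatives of the iterates and the
  equation for their limit.\<close>

definition defect :: "nat \<Rightarrow> 'e \<Rightarrow> 'e \<Rightarrow> 'f" where
  "defect n y v = picard_deriv (Suc n) y v + G y v (picard n y)"

text \<open>The derivative of the next iterate is computed under the integral sign, and \<open>G y v (s y)\<close> is written
  as the integral over \<open>[0, 1]\<close> of the derivative of \<open>t \<mapsto> t G v s\<close> along the ray. The terms without the
  factor \<open>t\<close> cancel.\<close>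

lemma defect_eq:
  assumes y: "y \<in> ball p r"
  shows "((\<lambda>t. t *\<^sub>R (G' (ray y t) v (y - p) (picard n (ray y t)) - G' (ray y t) (y - p) v (picard n (ray y t))
      + G (ray y t) (y - p) (picard_deriv n (ray y t) v) - G (ray y t) v (picard_deriv n (ray y t) (y - p))))
    has_integral (- defect n y v)) {0..1}"
proof -
  let ?s = "picard n" and ?D = "picard_deriv n"
  have "((\<lambda>t. integrand_deriv ?s ?D y t v) has_integral (- (picard_deriv (Suc n) y v))) {0..1}"
  proof -
    have "continuous_on {0..1} (integrand_deriv ?s ?D y)"
      unfolding integrand_deriv_def
      by (intro continuous_on_onb_blinfun continuous_intros comp_ray_cont'[OF G_cont y]
          comp_ray_cont'[OF G'_cont y] comp_ray_cont'[OF picard_cont y]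
          comp_ray_cont'[OF picard_deriv_cont y])
    then have "(integrand_deriv ?s ?D y has_integral (- picard_deriv (Suc n) y)) {0..1}"
      using integrable_integral[OF integrable_continuous_real] by simp
    from has_integral_linear[OF this
        bounded_bilinear.bounded_linear_left[OF bounded_bilinear_blinfun_apply, of v]]
    show ?thesis by (simp add: o_def uminus_blinfun.rep_eq)
  qed
  moreover have "((\<lambda>t. G (ray y t) v (?s (ray y t)) + t *\<^sub>R (G' (ray y t) (y - p) v (?s (ray y t))
      + G (ray y t) v (?D (ray y t) (y - p)))) has_integral (1 *\<^sub>R G (ray y 1) v (?s (ray y 1))
      - 0 *\<^sub>R G (ray y 0) v (?s (ray y 0)))) {0..1}"
  proof (rule fundamental_theorem_of_calculus)
    fix t :: real assume t: "t \<in> {0..1}"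
    then have rb: "ray y t \<in> ball p r" using ray_in_ball y by simp
    have ray: "((\<lambda>t. ray y t) has_derivative (\<lambda>h. h *\<^sub>R (y - p))) (at t)"
      unfolding ray_def by (auto intro!: derivative_eq_intros)
    have "((\<lambda>t. G (ray y t) v (?s (ray y t))) has_derivative
        (\<lambda>h. G (ray y t) v (?D (ray y t) (h *\<^sub>R (y - p)))
          + (G' (ray y t) (h *\<^sub>R (y - p)) v) (?s (ray y t)))) (at t)"
      by (rule bounded_bilinear.FDERIV[OF bounded_bilinear_blinfun_apply _
            has_derivative_compose[OF ray picard_deriv[OF rb]]])
        (rule bounded_linear.has_derivative[OF bounded_bilinear.bounded_linear_left[OF
            bounded_bilinear_blinfun_apply] has_derivative_compose[OF ray G[OF rb]]])
    then have "((\<lambda>t. t *\<^sub>R G (ray y t) v (?s (ray y t))) has_derivative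
        (\<lambda>h. t *\<^sub>R (G (ray y t) v (?D (ray y t) (h *\<^sub>R (y - p)))
          + (G' (ray y t) (h *\<^sub>R (y - p)) v) (?s (ray y t))) + h *\<^sub>R G (ray y t) v (?s (ray y t)))) (at t)"
      by (intro has_derivative_scaleR has_derivative_ident)
    then show "((\<lambda>t. t *\<^sub>R G (ray y t) v (?s (ray y t))) has_vector_derivative
        G (ray y t) v (?s (ray y t)) + t *\<^sub>R (G' (ray y t) (y - p) v (?s (ray y t))
      + G (ray y t) v (?D (ray y t) (y - p)))) (at t within {0..1})"
      unfolding has_vector_derivative_def
      by (rule has_derivative_eq_rhs[OF has_derivative_at_withinI])
        (rule ext, simp only: blinfun.scaleR_left blinfun.scaleR_right scaleR_add_right
          scaleR_scaleR mult.commute add.commute add.left_commute)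
  qed simp
  ultimately have "((\<lambda>t. integrand_deriv ?s ?D y t v - (G (ray y t) v (?s (ray y t))
      + t *\<^sub>R (G' (ray y t) (y - p) v (?s (ray y t)) + G (ray y t) v (?D (ray y t) (y - p)))))
      has_integral (- (picard_deriv (Suc n) y v) - (1 *\<^sub>R G (ray y 1) v (?s (ray y 1))
      - 0 *\<^sub>R G (ray y 0) v (?s (ray y 0))))) {0..1}"
    by (rule has_integral_diff)
  then show ?thesis
    by (rule has_integral_eq_rhs[OF has_integral_eq[rotated]])
      (simp_all add: integrand_deriv_apply defect_def ray_def algebra_simps)
qed

text \<open>In the direction of the ray the integrand of \<open>defect_eq\<close> is antisymmetric and vanishes.\<close>

lemma defect_radial:
  assumes "y \<in> ball p r"
  shows "defect n y (y - p) = 0"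
  using has_integral_unique[OF defect_eq[OF assms, of "y - p" n] , of 0] by simp

lemma defect_linear: "defect n y (c *\<^sub>R v) = c *\<^sub>R defect n y v"
  by (simp add: defect_def blinfun.bilinear_simps algebra_simps)

text \<open>Replacing the derivatives of the iterates by the previous defect leaves the curvature applied to the
  previous iterate, which is \<open>0\<close>, and terms that are linear in the last increment and in the
  previous defect. The derivative in the direction of the ray carries the factor \<open>t\<close>, as required
  for applying \<open>defect_radial\<close> at the point of the ray with parameter \<open>t\<close>.\<close>

lemma defect_Suc_eq:
  assumes y: "y \<in> ball p r"
  shows "((\<lambda>t. t *\<^sub>R (G' (ray y t) v (y - p) (picard (Suc n) (ray y t) - picard n (ray y t))
        - G' (ray y t) (y - p) v (picard (Suc n) (ray y t) - picard n (ray y t))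
      + G (ray y t) (y - p) (defect n (ray y t) v))) has_integral (- defect (Suc n) y v)) {0..1}"
proof (rule has_integral_eq[OF _ defect_eq[OF y]])
  fix t :: real assume t: "t \<in> {0..1}"
  define z u where zu: "z = ray y t" "u = y - p"
  have z: "z \<in> ball p r" using ray_in_ball y t by (simp add: zu)
  have "z - p = t *\<^sub>R u" by (simp add: zu ray_def)
  then have "t *\<^sub>R defect n z u = 0" using defect_radial[OF z, of n] by (simp add: defect_linear)
  then have radial: "t *\<^sub>R picard_deriv (Suc n) z u = - t *\<^sub>R G z u (picard n z)"
    by (simp add: defect_def algebra_simps eq_neg_iff_add_eq_0 del: picard_deriv.simps)
  have "t *\<^sub>R G z v (picard_deriv (Suc n) z u) = G z v (t *\<^sub>R picard_deriv (Suc n) z u)"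
    by (simp only: blinfun.scaleR_right)
  also have "\<dots> = - t *\<^sub>R G z v (G z u (picard n z))"
    unfolding radial by (simp add: blinfun.bilinear_simps)
  finally have 1: "t *\<^sub>R G z v (picard_deriv (Suc n) z u) = - t *\<^sub>R G z v (G z u (picard n z))" .
  have 2: "picard_deriv (Suc n) z v = defect n z v - G z v (picard n z)"
    by (simp add: defect_def del: picard_deriv.simps)
  have 3: "G' z v u (picard n z) = G' z u v (picard n z) - G z v (G z u (picard n z))
      + G z u (G z v (picard n z))"
    using flat[OF z, of v u "picard n z"] by (simp add: algebra_simps)
  have "t *\<^sub>R (G' z v u (picard (Suc n) z) - G' z u v (picard (Suc n) z)
      + G z u (picard_deriv (Suc n) z v) - G z v (picard_deriv (Suc n) z u))
    = t *\<^sub>R (G' z v u (picard (Suc n) z) - G' z u v (picard (Suc n) z)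
      + G z u (defect n z v - G z v (picard n z))) + t *\<^sub>R G z v (G z u (picard n z))"
    unfolding 2 scaleR_diff_right[of t _ "G z v (picard_deriv (Suc n) z u)"] 1 by simp
  also have "\<dots> = t *\<^sub>R (G' z v u (picard (Suc n) z - picard n z)
        - G' z u v (picard (Suc n) z - picard n z) + G z u (defect n z v))"
    by (simp add: blinfun.diff_right 3 algebra_simps del: picard.simps)
  finally show "t *\<^sub>R (G' (ray y t) v (y - p) (picard (Suc n) (ray y t))
        - G' (ray y t) (y - p) v (picard (Suc n) (ray y t))
      + G (ray y t) (y - p) (picard_deriv (Suc n) (ray y t) v) - G (ray y t) v (picard_deriv (Suc n) (ray y t) (y - p)))
    = t *\<^sub>R (G' (ray y t) v (y - p) (picard (Suc n) (ray y t) - picard n (ray y t))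
        - G' (ray y t) (y - p) v (picard (Suc n) (ray y t) - picard n (ray y t))
        + G (ray y t) (y - p) (defect n (ray y t) v))"
    unfolding zu .
qed

lemma norm_radius: "y \<in> ball p r \<Longrightarrow> norm (y - p) \<le> r"
  by (simp add: dist_norm norm_minus_commute)

lemma norm_G: "y \<in> ball p r \<Longrightarrow> norm (G y u a) \<le> C * norm u * norm a"
  using norm_blinfun[of "G y u" a] norm_blinfun[of "G y" u] G_bound[of y]
  by (smt (verit) mult_right_mono norm_ge_zero)

lemma norm_G': "y \<in> ball p r \<Longrightarrow> norm (G' y u v a) \<le> C * norm u * norm v * norm a"
  using norm_blinfun[of "G' y u v" a] norm_blinfun[of "G' y u" v] norm_blinfun[of "G' y" u] G'_bound[of y]
  by (smt (verit) mult_right_mono norm_ge_zero)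

lemma norm_G_quarter:
  assumes "y \<in> ball p r" "norm u \<le> r"
  shows "norm (G y u a) \<le> norm a / 4"
proof -
  have "norm (G y u a) \<le> C * norm u * norm a" by (rule norm_G[OF assms(1)])
  also have "\<dots> \<le> C * r * norm a" using assms C by (intro mult_right_mono mult_left_mono) auto
  also have "\<dots> \<le> 1/4 * norm a" using C by (intro mult_right_mono) auto
  finally show ?thesis by simp
qed

lemma norm_G'_quarter:
  assumes "y \<in> ball p r" "norm u \<le> r"
  shows "norm (G' y u v a) \<le> norm v * norm a / 4" "norm (G' y v u a) \<le> norm v * norm a / 4"
proof -
  have *: "C * norm u * (norm v * norm a) \<le> 1/4 * (norm v * norm a)"
  proof (rule mult_right_mono)
    have "C * norm u \<le> C * r" using assms C by (intro mult_left_mono) auto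
    then show "C * norm u \<le> 1/4" using C(2) by linarith
  qed simp
  show "norm (G' y u v a) \<le> norm v * norm a / 4"
    using norm_G'[OF assms(1), of u v a] * by (simp add: algebra_simps)
  show "norm (G' y v u a) \<le> norm v * norm a / 4"
    using norm_G'[OF assms(1), of v u a] * by (simp add: algebra_simps)
qed

lemma picard_integrable:
  "y \<in> ball p r \<Longrightarrow> (\<lambda>t. G (ray y t) (y - p) (picard n (ray y t))) integrable_on {0..1}"
  by (intro integrable_continuous_real continuous_intros comp_ray_cont'[OF G_cont]
      comp_ray_cont'[OF picard_cont])

lemma picard_diff:
  "y \<in> ball p r \<Longrightarrow> norm (picard (Suc n) y - picard n y) \<le> norm w * (1/2) ^ Suc n"
proof (induction n arbitrary: y)
  case 0
  have "norm (picard (Suc 0) y - picard 0 y) = norm (integral {0..1} (\<lambda>t. G (ray y t) (y - p) (picard 0 (ray y t))))"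
    by simp
  also have "\<dots> \<le> norm w / 4 * (1 - 0)"
  proof (rule integral_bound)
    show "continuous_on {0..1} (\<lambda>t. G (ray y t) (y - p) (picard 0 (ray y t)))"
      by (intro continuous_intros comp_ray_cont'[OF G_cont 0] comp_ray_cont'[OF picard_cont 0])
    show "norm (G (ray y t) (y - p) (picard 0 (ray y t))) \<le> norm w / 4" if "t \<in> {0..1}" for t
      using norm_G_quarter[OF ray_in_ball[OF 0 that] norm_radius[OF 0], of w] by simp
  qed simp
  also have "\<dots> \<le> norm w * (1/2) ^ Suc 0" by simp
  finally show ?case .
next
  case (Suc n)
  have "picard (Suc (Suc n)) y - picard (Suc n) y =
      - (integral {0..1} (\<lambda>t. G (ray y t) (y - p) (picard (Suc n) (ray y t)))
      - integral {0..1} (\<lambda>t. G (ray y t) (y - p) (picard n (ray y t))))"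
    by (simp only: picard.simps) simp
  also have "\<dots> = - integral {0..1} (\<lambda>t. G (ray y t) (y - p) (picard (Suc n) (ray y t))
      - G (ray y t) (y - p) (picard n (ray y t)))"
    by (subst integral_diff) (auto intro: picard_integrable Suc.prems simp del: picard.simps mem_ball)
  also have "\<dots> = - integral {0..1} (\<lambda>t. G (ray y t) (y - p) (picard (Suc n) (ray y t) - picard n (ray y t)))"
    by (simp add: blinfun.diff_right del: picard.simps)
  also have "norm \<dots> \<le> norm w * (1/2) ^ Suc (Suc n) * (1 - 0)"
    unfolding norm_minus_cancel
  proof (rule integral_bound)
    show "continuous_on {0..1} (\<lambda>t. G (ray y t) (y - p) (picard (Suc n) (ray y t) - picard n (ray y t)))"
      by (intro continuous_intros comp_ray_cont'[OF G_cont Suc.prems]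
          comp_ray_cont'[OF picard_cont Suc.prems])
    fix t :: real assume "t \<in> {0..1}"
    then have z: "ray y t \<in> ball p r" using ray_in_ball Suc.prems by blast
    have "norm (G (ray y t) (y - p) (picard (Suc n) (ray y t) - picard n (ray y t)))
        \<le> norm (picard (Suc n) (ray y t) - picard n (ray y t)) / 4"
      by (rule norm_G_quarter[OF z norm_radius[OF Suc.prems]])
    also have "\<dots> \<le> (norm w * (1/2) ^ Suc n) / 4" using Suc.IH[OF z] by linarith
    also have "\<dots> \<le> norm w * (1/2) ^ Suc (Suc n)" by simp
    finally show "norm (G (ray y t) (y - p) (picard (Suc n) (ray y t) - picard n (ray y t)))
      \<le> norm w * (1/2) ^ Suc (Suc n)" .
  qed simp
  finally show ?case by simp
qed

text \<open>With \<open>k = norm w (1/2)\<^sup>n\<^sup>+\<^sup>1 norm v\<close>, the increment contributes at most \<open>k / 2\<close> and the previous defect at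
  most \<open>k\<close>, whose sum stays below the claimed \<open>2 k\<close>.\<close>

lemma defect_bound:
  "y \<in> ball p r \<Longrightarrow> norm (defect n y v) \<le> 2 * norm w * (1/2) ^ n * norm v"
proof (induction n arbitrary: y)
  case 0
  have "norm (- defect 0 y v) \<le> (norm v * norm w / 2) * measure lborel {0..1::real}"
  proof (rule has_integral_bound_real[where S="{}", OF _ _ defect_eq[OF 0]])
    fix t :: real assume "t \<in> {0..1} - {}"
    then have t: "t \<in> {0..1}" by simp
    then have z: "ray y t \<in> ball p r" using ray_in_ball 0 by blast
    have "norm (G' (ray y t) v (y - p) w - G' (ray y t) (y - p) v w) \<le> norm v * norm w / 4 + norm v * norm w / 4"
      by (rule order.trans[OF norm_triangle_ineq4])
        (intro add_mono norm_G'_quarter z norm_radius 0)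
    then have "\<bar>t\<bar> * norm (G' (ray y t) v (y - p) w - G' (ray y t) (y - p) v w) \<le> 1 * (norm v * norm w / 2)"
      using t by (intro mult_mono) auto
    then show "norm (t *\<^sub>R (G' (ray y t) v (y - p) (picard 0 (ray y t)) - G' (ray y t) (y - p) v (picard 0 (ray y t))
      + G (ray y t) (y - p) (picard_deriv 0 (ray y t) v) - G (ray y t) v (picard_deriv 0 (ray y t) (y - p))))
      \<le> norm v * norm w / 2" by (simp add: blinfun.zero_right)
  qed simp_all
  also have "\<dots> \<le> 2 * norm w * norm v" by (simp add: mult.commute)
  finally show ?case by simp
next
  case (Suc n)
  define k where "k = norm w * (1/2) ^ Suc n * norm v"
  have k: "k \<ge> 0" by (simp add: k_def)
  have "norm (- defect (Suc n) y v) \<le> (k / 2 + k) * measure lborel {0..1::real}"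
  proof (rule has_integral_bound_real[where S="{}", OF _ _ defect_Suc_eq[OF Suc.prems]])
    fix t :: real assume "t \<in> {0..1} - {}"
    then have t: "t \<in> {0..1}" by simp
    then have z: "ray y t \<in> ball p r" using ray_in_ball Suc.prems by blast
    note u = norm_radius[OF Suc.prems]
    let ?d = "picard (Suc n) (ray y t) - picard n (ray y t)"
    have d: "norm v * norm ?d / 4 \<le> k / 4"
      using mult_left_mono[OF picard_diff[OF z, of n], of "norm v"]
      by (simp add: k_def mult.commute mult.left_commute del: picard.simps)
    have 1: "norm (G' (ray y t) v (y - p) ?d - G' (ray y t) (y - p) v ?d) \<le> k / 4 + k / 4"
      by (rule order.trans[OF norm_triangle_ineq4])
        (intro add_mono order.trans[OF _ d] norm_G'_quarter z u)
    have "norm (G (ray y t) (y - p) (defect n (ray y t) v)) \<le> norm (defect n (ray y t) v) / 4"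
      by (rule norm_G_quarter[OF z u])
    also have "\<dots> \<le> k" using Suc.IH[OF z] by (simp add: k_def)
    finally have 2: "norm (G (ray y t) (y - p) (defect n (ray y t) v)) \<le> k" .
    have "\<bar>t\<bar> * norm (G' (ray y t) v (y - p) ?d - G' (ray y t) (y - p) v ?d
        + G (ray y t) (y - p) (defect n (ray y t) v)) \<le> 1 * (k / 2 + k)"
      using t k 1 2 by (intro mult_mono order.trans[OF norm_triangle_ineq]) auto
    then show "norm (t *\<^sub>R (G' (ray y t) v (y - p) ?d - G' (ray y t) (y - p) v ?d
        + G (ray y t) (y - p) (defect n (ray y t) v))) \<le> k / 2 + k"
      by (simp del: picard.simps)
  qed (use k in simp_all)
  also have "\<dots> \<le> 2 * k" using k by simp
  finally show ?case by (simp add: k_def)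
qed

lemma picard_tail:
  assumes y: "y \<in> ball p r" and "n \<le> m"
  shows "norm (picard m y - picard n y) \<le> norm w * ((1/2) ^ n - (1/2) ^ m)"
  using assms(2)
proof (induction m rule: dec_induct)
  case (step m)
  have "norm (picard (Suc m) y - picard n y)
      \<le> norm (picard (Suc m) y - picard m y) + norm (picard m y - picard n y)"
    using norm_triangle_ineq[of "picard (Suc m) y - picard m y" "picard m y - picard n y"] by simp
  also have "\<dots> \<le> norm w * (1/2) ^ Suc m + norm w * ((1/2) ^ n - (1/2) ^ m)"
    by (rule add_mono[OF picard_diff[OF y] step.IH])
  also have "\<dots> = norm w * ((1/2) ^ n - (1/2) ^ Suc m)" by (simp add: algebra_simps)
  finally show ?case .
qed simp

lemma eventually_small: "e > 0 \<Longrightarrow> \<forall>\<^sub>F n in sequentially. c * (1/2::real) ^ n < e"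
proof -
  assume e: "e > 0"
  have "(\<lambda>n. c * (1/2::real) ^ n) \<longlonglongrightarrow> c * 0"
    by (intro tendsto_mult tendsto_const LIMSEQ_realpow_zero) auto
  then show ?thesis using order_tendstoD(2)[of _ "c * 0" sequentially e] e by simp
qed

lemma picard_convergent:
  assumes y: "y \<in> ball p r"
  shows "convergent (\<lambda>n. picard n y)"
proof (rule Cauchy_convergent, rule metric_CauchyI)
  fix e :: real assume "e > 0"
  then obtain M where M: "\<And>n. n \<ge> M \<Longrightarrow> norm w * (1/2) ^ n < e"
    using eventually_small[of e "norm w"] by (auto simp: eventually_sequentially)
  have *: "dist (picard m y) (picard n y) < e" if "M \<le> n" "n \<le> m" for m n
  proof -
    have "dist (picard m y) (picard n y) \<le> norm w * ((1/2) ^ n - (1/2) ^ m)"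
      using picard_tail[OF y that(2)] by (simp add: dist_norm)
    also have "\<dots> \<le> norm w * (1/2) ^ n" by (intro mult_left_mono) auto
    also have "\<dots> < e" using M that by simp
    finally show ?thesis .
  qed
  show "\<exists>M. \<forall>m\<ge>M. \<forall>n\<ge>M. dist (picard m y) (picard n y) < e"
    using * by (metis dist_commute linear)
qed

definition solution :: "'e \<Rightarrow> 'f" where "solution y = lim (\<lambda>n. picard n y)"

lemma picard_tendsto: "y \<in> ball p r \<Longrightarrow> (\<lambda>n. picard n y) \<longlonglongrightarrow> solution y"
  unfolding solution_def using picard_convergent convergent_LIMSEQ_iff by blast

lemma solution_diff:
  assumes y: "y \<in> ball p r"
  shows "norm (solution y - picard n y) \<le> norm w * (1/2) ^ n"
proof (rule tendsto_upperbound)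
  show "(\<lambda>m. norm (picard m y - picard n y)) \<longlonglongrightarrow> norm (solution y - picard n y)"
    by (intro tendsto_intros picard_tendsto y)
  show "\<forall>\<^sub>F m in sequentially. norm (picard m y - picard n y) \<le> norm w * (1/2) ^ n"
  proof (rule eventually_sequentiallyI)
    fix m assume "n \<le> m"
    from picard_tail[OF y this] show "norm (picard m y - picard n y) \<le> norm w * (1/2) ^ n"
      by (rule order.trans) (intro mult_left_mono, auto)
  qed
qed simp

lemma solution_base: "solution p = w"
proof -
  have "picard n p = w" for n by (cases n) (simp_all add: blinfun.zero_right blinfun.zero_left)
  then show ?thesis by (simp add: solution_def)
qed

lemma solution_has_derivative:
  assumes "y \<in> ball p r"
  shows "(solution has_derivative (\<lambda>v. - G y v (solution y))) (at y)"
proof -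
  have "\<exists>g. \<forall>y\<in>ball p r. (\<lambda>n. picard (Suc n) y) \<longlonglongrightarrow> g y \<and>
      (g has_derivative (\<lambda>v. - G y v (solution y))) (at y within ball p r)"
  proof (rule has_derivative_sequence[where f'="\<lambda>n y. blinfun_apply (picard_deriv (Suc n) y)"
        and f="\<lambda>n. picard (Suc n)" and g'="\<lambda>y v. - G y v (solution y)" and ?x0.0=p and l="solution p"])
    show "(picard (Suc n) has_derivative picard_deriv (Suc n) y) (at y within ball p r)"
      if "y \<in> ball p r" for n y
      using that by (rule has_derivative_at_withinI[OF picard_deriv])
    fix e :: real assume "e > 0"
    then have "\<forall>\<^sub>F n in sequentially. ((2 + C) * norm w) * (1/2) ^ n < e" by (rule eventually_small)
    then show "\<forall>\<^sub>F n in sequentially. \<forall>y\<in>ball p r. \<forall>v.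
        norm (picard_deriv (Suc n) y v - - G y v (solution y)) \<le> e * norm v"
    proof (rule eventually_mono, intro ballI allI)
      fix n y v assume n: "((2 + C) * norm w) * (1/2) ^ n < e" and y: "y \<in> ball p r"
      have "picard_deriv (Suc n) y v - - G y v (solution y)
          = defect n y v + G y v (solution y - picard n y)"
        by (simp add: defect_def blinfun.diff_right del: picard_deriv.simps)
      also have "norm \<dots> \<le> 2 * norm w * (1/2) ^ n * norm v + C * norm v * (norm w * (1/2) ^ n)"
        by (intro order.trans[OF norm_triangle_ineq] add_mono defect_bound y
            order.trans[OF norm_G[OF y]] mult_left_mono solution_diff) (use C in auto)
      also have "\<dots> = (((2 + C) * norm w) * (1/2) ^ n) * norm v" by (simp add: algebra_simps)
      also have "\<dots> \<le> e * norm v" using n by (intro mult_right_mono) auto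
      finally show "norm (picard_deriv (Suc n) y v - - G y v (solution y)) \<le> e * norm v" .
    qed
  next
    show "p \<in> ball p r" using r by simp
    then show "(\<lambda>n. picard (Suc n) p) \<longlonglongrightarrow> solution p"
      by (rule LIMSEQ_Suc[OF picard_tendsto])
  qed simp
  then obtain g where g: "\<And>y. y \<in> ball p r \<Longrightarrow> (\<lambda>n. picard (Suc n) y) \<longlonglongrightarrow> g y"
    "\<And>y. y \<in> ball p r \<Longrightarrow> (g has_derivative (\<lambda>v. - G y v (solution y))) (at y within ball p r)"
    by blast
  have eq: "g y = solution y" if "y \<in> ball p r" for y
    using LIMSEQ_unique[OF g(1)[OF that] LIMSEQ_Suc[OF picard_tendsto[OF that]]] .
  have "(g has_derivative (\<lambda>v. - G y v (solution y))) (at y)"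
    using g(2)[OF assms] by (simp only: at_within_open[OF assms open_ball])
  then show ?thesis
    by (rule has_derivative_transform_within_open[OF _ open_ball assms]) (rule eq)
qed

end

text \<open>A solution inherits one more derivative from the right-hand side of its equation, so it is
  smooth.\<close>

lemma linear_system_solution_smooth:
  assumes S: "open S" and G: "smooth_on S G"
    and s: "\<And>y. y \<in> S \<Longrightarrow> (s has_derivative (\<lambda>v. - blinfun_apply (blinfun_apply (G y) v) (s y))) (at y)"
  shows "smooth_on S s"
proof -
  have "Ck_on k S s" for k
  proof (induction k)
    case 0
    show ?case using s
      by (auto intro!: continuous_at_imp_continuous_on has_derivative_continuous)
  next
    case (Suc k)
    show ?case
    proof (rule Ck_on_SucI[OF S s])
      fix v
      have Gk: "Ck_on k S G" using G by (simp add: smooth_on_def)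
      have "Ck_on k S (\<lambda>y. G y v (s y))"
        by (intro Ck_on_bilinear[OF bounded_bilinear_blinfun_apply S] Gk Suc.IH Ck_on_const S)
      then show "Ck_on k S (\<lambda>y. - G y v (s y))"
        by (rule Ck_on_bounded_linear[OF bounded_linear_minus[OF bounded_linear_ident] S])
    qed
  qed
  then show ?thesis by (simp add: smooth_on_def)
qed

text \<open>Continuity at \<open>p\<close> bounds \<open>G\<close> and its derivative near \<open>p\<close> by a constant \<open>C\<close> that exceeds the sum of
  their norms at \<open>p\<close> by \<open>1\<close>, and the radius is then chosen in terms of \<open>C\<close>.\<close>

lemma flat_linear_system_solvable:
  fixes G :: "'e::fin_dim_inner \<Rightarrow> 'e \<Rightarrow>\<^sub>L 'f::banach \<Rightarrow>\<^sub>L 'f"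
  assumes S: "open S" "p \<in> S" and G: "smooth_on S G"
    and flat: "\<And>y u v a. y \<in> S \<Longrightarrow>
      fderiv G y u v a - fderiv G y v u a + G y u (G y v a) - G y v (G y u a) = 0"
  shows "\<exists>r>0. \<exists>s. ball p r \<subseteq> S \<and> smooth_on (ball p r) s \<and> s p = w \<and>
    (\<forall>y\<in>ball p r. (s has_derivative (\<lambda>v. - G y v (s y))) (at y))"
proof -
  define C where "C = norm (G p) + norm (fderiv G p) + 1"
  have C: "C > 0" unfolding C_def by (simp add: add_nonneg_pos)
  note cG = smooth_on_imp_continuous_on[OF S(1) G]
    and cG' = smooth_on_imp_continuous_on[OF S(1) smooth_on_fderiv[OF S(1) G]]
  have "isCont G p" "isCont (fderiv G) p"
    using cG cG' S by (auto simp: continuous_on_eq_continuous_at)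
  then have "\<forall>\<^sub>F y in at p. dist (G y) (G p) < 1" "\<forall>\<^sub>F y in at p. dist (fderiv G y) (fderiv G p) < 1"
    by (auto simp: isCont_def tendsto_iff)
  moreover have "\<forall>\<^sub>F y in at p. y \<in> S" using S by (auto simp: eventually_at_topological)
  ultimately have "\<forall>\<^sub>F y in at p. y \<in> S \<and> norm (G y) \<le> C \<and> norm (fderiv G y) \<le> C"
  proof eventually_elim
    case (elim y)
    have "norm (G y) \<le> norm (G p) + dist (G y) (G p)"
      "norm (fderiv G y) \<le> norm (fderiv G p) + dist (fderiv G y) (fderiv G p)"
      using norm_triangle_sub[of "G y" "G p"] norm_triangle_sub[of "fderiv G y" "fderiv G p"]
      by (simp_all add: dist_norm)
    then show ?case using elim unfolding C_def
      using norm_ge_zero[of "G p"] norm_ge_zero[of "fderiv G p"] by linarith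
  qed
  then obtain d where d: "d > 0" "\<And>y. y \<noteq> p \<Longrightarrow> dist y p < d \<Longrightarrow>
      y \<in> S \<and> norm (G y) \<le> C \<and> norm (fderiv G y) \<le> C"
    unfolding eventually_at by auto
  have pC: "norm (G p) \<le> C" "norm (fderiv G p) \<le> C" by (simp_all add: C_def)
  define r where "r = min d (1 / (4 * C))"
  have r: "r > 0" "C * r \<le> 1/4" "r \<le> d"
  proof -
    show "r > 0" "r \<le> d" using d C by (auto simp: r_def)
    have "C * r \<le> C * (1 / (4 * C))" using C by (intro mult_left_mono) (auto simp: r_def)
    then show "C * r \<le> 1/4" using C by simp
  qed
  have near: "y \<in> S \<and> norm (G y) \<le> C \<and> norm (fderiv G y) \<le> C" if "y \<in> ball p r" for y
    using d(2)[of y] that r(3) S(2) pC by (cases "y = p") (auto simp: dist_commute)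
  interpret flat_system G "fderiv G" p r C w
  proof
    show "continuous_on (ball p r) (fderiv G)"
      by (rule continuous_on_subset[OF cG']) (use near in auto)
  qed (use r C near flat has_derivative_fderiv[OF G] in auto)
  have sub: "ball p r \<subseteq> S" using near by auto
  have "smooth_on (ball p r) solution"
    by (rule linear_system_solution_smooth[OF open_ball smooth_on_subset[OF assms(3) sub]])
      (rule solution_has_derivative)
  then show ?thesis using r(1) sub solution_base solution_has_derivative by blast
qed

text \<open>If \<open>G\<close> preserves a subspace and is flat on it, then \<open>G\<close> composed with a projection \<open>P\<close> onto the
  subspace is flat everywhere, because \<open>P G P = G P\<close>. The solution of the modified system stays in
  the subspace, since the derivative of \<open>s - P s\<close> vanishes, and so it solves the original system.\<close>

lemma flat_linear_system_solvable_in_subspace: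
  fixes G :: "'e::fin_dim_inner \<Rightarrow> 'e \<Rightarrow>\<^sub>L 'f::fin_dim_inner \<Rightarrow>\<^sub>L 'f"
  assumes S: "open S" "p \<in> S" and G: "smooth_on S G" and F: "subspace F" and w: "w \<in> F"
    and GF: "\<And>y v a. y \<in> S \<Longrightarrow> a \<in> F \<Longrightarrow> G y v a \<in> F"
    and flat: "\<And>y u v a. y \<in> S \<Longrightarrow> a \<in> F \<Longrightarrow>
      fderiv G y u v a - fderiv G y v u a + G y u (G y v a) - G y v (G y u a) = 0"
  shows "\<exists>r>0. \<exists>s. ball p r \<subseteq> S \<and> smooth_on (ball p r) s \<and> s p = w \<and>
    (\<forall>y\<in>ball p r. s y \<in> F \<and> (s has_derivative (\<lambda>v. - G y v (s y))) (at y))"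
proof -
  obtain P where P: "bounded_linear P" "range P \<subseteq> F" "\<And>a. a \<in> F \<Longrightarrow> P a = a"
    using ex_projection[OF F] by blast
  have PF: "P a \<in> F" for a using P(2) by auto
  define PB where "PB = Blinfun P"
  have PB: "blinfun_apply PB = P" unfolding PB_def by (rule bounded_linear_Blinfun_apply[OF P(1)])
  \<comment> \<open>Composition with \<open>P\<close> as an operator on operators, so that \<open>G P\<close> depends linearly on \<open>G\<close>.\<close>
  define Q where "Q = Blinfun (\<lambda>T :: 'f \<Rightarrow>\<^sub>L 'f. T o\<^sub>L PB)"
  have Q: "blinfun_apply Q T = T o\<^sub>L PB" for T
    unfolding Q_def
    by (rule fun_cong[OF bounded_linear_Blinfun_apply[OF
            bounded_bilinear.bounded_linear_left[OF bounded_bilinear_blinfun_compose]]])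
  have blQ: "bounded_linear (\<lambda>T. Q o\<^sub>L T)"
    by (rule bounded_bilinear.bounded_linear_right[OF bounded_bilinear_blinfun_compose])
  define H where "H y = Q o\<^sub>L G y" for y
  have H_apply: "H y v a = G y v (P a)" for y v a by (simp add: H_def Q PB)
  have H: "smooth_on S H"
    unfolding H_def[abs_def] by (rule smooth_on_bounded_linear[OF blQ S(1) G])
  have H': "fderiv H y u v a = fderiv G y u v (P a)" if y: "y \<in> S" for y u v a
  proof -
    have "(H has_derivative (\<lambda>u. Q o\<^sub>L fderiv G y u)) (at y)"
      unfolding H_def[abs_def]
      by (rule bounded_linear.has_derivative[OF blQ has_derivative_fderiv[OF G y]])
    from has_derivative_unique[OF has_derivative_fderiv[OF H y] this]
    have "fderiv H y u = Q o\<^sub>L fderiv G y u" by (simp add: fun_eq_iff)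
    then show ?thesis by (simp add: Q PB)
  qed
  have "fderiv H y u v a - fderiv H y v u a + H y u (H y v a) - H y v (H y u a) = 0"
    if y: "y \<in> S" for y u v a
    using flat[OF y PF] P(3)[OF GF[OF y PF]] by (simp add: H'[OF y] H_apply)
  then obtain r s where r: "r > 0" "ball p r \<subseteq> S" and s: "smooth_on (ball p r) s" "s p = w"
    "\<And>y. y \<in> ball p r \<Longrightarrow> (s has_derivative (\<lambda>v. - H y v (s y))) (at y)"
    using flat_linear_system_solvable[OF S H, of w] by blast
  have "\<exists>a. \<forall>y\<in>ball p r. s y - P (s y) = a"
  proof (rule has_derivative_zero_constant[OF convex_ball])
    fix y assume y: "y \<in> ball p r"
    have "G y v (P (s y)) \<in> F" for v by (rule GF[OF _ PF]) (use r(2) y in blast)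
    then have z: "- H y v (s y) - P (- H y v (s y)) = 0" for v
      using P(3) by (simp add: H_apply linear_neg[OF bounded_linear.linear[OF P(1)]])
    have "((\<lambda>y. s y - P (s y)) has_derivative (\<lambda>v. - H y v (s y) - P (- H y v (s y)))) (at y)"
      by (intro has_derivative_diff s(3)[OF y] bounded_linear.has_derivative[OF P(1)])
    then show "((\<lambda>y. s y - P (s y)) has_derivative (\<lambda>v. 0)) (at y within ball p r)"
      unfolding z by (rule has_derivative_at_withinI)
  qed
  then obtain a where a: "\<And>y. y \<in> ball p r \<Longrightarrow> s y - P (s y) = a" by blast
  have "a = 0" using a[of p] r(1) s(2) P(3)[OF w] by simp
  then have sP: "P (s y) = s y" if "y \<in> ball p r" for y using a[OF that] by simp
  have "s y \<in> F \<and> (s has_derivative (\<lambda>v. - G y v (s y))) (at y)" if y: "y \<in> ball p r" for y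
    using PF[of "s y"] s(3)[OF y] sP[OF y] by (simp add: H_apply)
  then show ?thesis using r s(1,2) by blast
qed

section \<open>Charts, tangent vectors and vector fields\<close>

context smooth_manifold
begin

lemma chart_inj: "c \<in> atlas \<Longrightarrow> inj_on (snd c) (fst c)"
proof -
  assume "c \<in> atlas"
  then have "homeomorphism (fst c) (snd c ` fst c) (snd c) (inv_into (fst c) (snd c))"
    using atlas_homeo[of "fst c" "snd c"] by simp
  then show ?thesis by (auto intro: inj_on_inverseI simp: homeomorphism_def)
qed

lemma chart_inverse: "c \<in> atlas \<Longrightarrow> x \<in> fst c \<Longrightarrow> inv_into (fst c) (snd c) (snd c x) = x"
  by (rule inv_into_f_f[OF chart_inj])

lemma in_chart_apply: "c \<in> atlas \<Longrightarrow> x \<in> fst c \<Longrightarrow> in_chart c f (snd c x) = f x"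
  by (simp add: in_chart_def chart_inverse)

lemma chart_dom_open: "c \<in> atlas \<Longrightarrow> open (fst c)"
  using atlas_open[of "fst c" "snd c"] by simp

lemma chart_image_open:
  assumes c: "c \<in> atlas" and U: "open U"
  shows "open (snd c ` (U \<inter> fst c))"
proof -
  have h: "homeomorphism (fst c) (snd c ` fst c) (snd c) (inv_into (fst c) (snd c))"
    and o: "open (snd c ` fst c)"
    using atlas_homeo[of "fst c" "snd c"] atlas_open[of "fst c" "snd c"] c by simp_all
  have "openin (top_of_set (fst c)) (U \<inter> fst c)"
    using openin_open_Int[OF U, of "fst c"] by (simp add: Int_commute)
  from homeomorphism_imp_open_map[OF h this] show ?thesis
    using o openin_open_eq by blast
qed

lemma chart_preimage_open:
  assumes c: "c \<in> atlas" and T: "open T"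
  shows "open {x \<in> fst c. snd c x \<in> T}"
proof -
  have "continuous_on (fst c) (snd c)"
    using atlas_homeo[of "fst c" "snd c"] c by (simp add: homeomorphism_cont1)
  then have "open (snd c -` T \<inter> fst c)"
    using continuous_on_open_vimage[OF chart_dom_open[OF c]] T by blast
  then show ?thesis by (simp add: vimage_def Int_def conj_commute)
qed

lemma ex_chart: "\<exists>c. c \<in> charts_at x"
proof -
  have "x \<in> (\<Union>c\<in>atlas. fst c)" using atlas_cover by simp
  then show ?thesis by (auto simp: charts_at_def)
qed

lemma charts_atD: "c \<in> charts_at x \<Longrightarrow> c \<in> atlas" "c \<in> charts_at x \<Longrightarrow> x \<in> fst c"
  by (auto simp: charts_at_def)

lemma transition_smooth:
  assumes "c \<in> atlas" "d \<in> atlas"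
  shows "smooth_on (snd c ` (fst c \<inter> fst d)) (in_chart c (snd d))"
  using atlas_compat[of "fst c" "snd c" "fst d" "snd d"] assms by (simp add: in_chart_def)

lemma smooth_map_onD:
  "smooth_map_on U f \<Longrightarrow> c \<in> atlas \<Longrightarrow> smooth_on (snd c ` (U \<inter> fst c)) (in_chart c f)"
  by (simp add: smooth_map_on_def)

lemma in_chart_change:
  assumes "c \<in> atlas" "d \<in> atlas" "p \<in> snd c ` (fst c \<inter> fst d)"
  shows "in_chart c f p = in_chart d f (in_chart c (snd d) p)"
  using assms by (auto simp: in_chart_apply in_chart_def chart_inverse)

lemma smooth_map_on_chartI:
  assumes c: "c \<in> atlas" and U: "open U" "U \<subseteq> fst c" and f: "smooth_on (snd c ` U) (in_chart c f)"
  shows "smooth_map_on U f"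
  unfolding smooth_map_on_def
proof
  fix d assume d: "d \<in> atlas"
  have o: "open (snd d ` (U \<inter> fst d))" by (rule chart_image_open[OF d U(1)])
  show "smooth_on (snd d ` (U \<inter> fst d)) (in_chart d f)"
  proof (rule smooth_on_cong[OF o])
    show "smooth_on (snd d ` (U \<inter> fst d)) (\<lambda>p. in_chart c f (in_chart d (snd c) p))"
    proof (rule smooth_on_compose[OF o _ _ f])
      show "open (snd c ` U)" using chart_image_open[OF c U(1)] U(2) by (simp add: Int_absorb2)
      show "in_chart d (snd c) ` snd d ` (U \<inter> fst d) \<subseteq> snd c ` U"
        using d by (auto simp: in_chart_apply)
      show "smooth_on (snd d ` (U \<inter> fst d)) (in_chart d (snd c))"
        by (rule smooth_on_subset[OF transition_smooth[OF d c]]) (use U in auto)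
    qed
    fix p assume "p \<in> snd d ` (U \<inter> fst d)"
    then show "in_chart c f (in_chart d (snd c) p) = in_chart d f p"
      by (intro in_chart_change[OF d c, symmetric]) (use U in auto)
  qed
qed

lemma smooth_map_on_subset:
  assumes "smooth_map_on U f" "V \<subseteq> U"
  shows "smooth_map_on V f"
  unfolding smooth_map_on_def
proof
  fix c assume "c \<in> atlas"
  from smooth_map_onD[OF assms(1) this]
  show "smooth_on (snd c ` (V \<inter> fst c)) (in_chart c f)"
    by (rule smooth_on_subset) (use assms(2) in auto)
qed

lemma smooth_map_on_local:
  assumes "\<And>x. x \<in> U \<Longrightarrow> \<exists>V. open V \<and> x \<in> V \<and> smooth_map_on V f"
  shows "smooth_map_on U f"
  unfolding smooth_map_on_def
proof
  fix c assume c: "c \<in> atlas"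
  show "smooth_on (snd c ` (U \<inter> fst c)) (in_chart c f)"
  proof (rule smooth_on_local)
    fix p assume "p \<in> snd c ` (U \<inter> fst c)"
    then obtain x where x: "x \<in> U" "x \<in> fst c" "p = snd c x" by auto
    obtain V where V: "open V" "x \<in> V" "smooth_map_on V f" using assms[OF x(1)] by blast
    show "\<exists>T. open T \<and> p \<in> T \<and> smooth_on T (in_chart c f)"
      using chart_image_open[OF c V(1)] smooth_map_onD[OF V(3) c] x V(2) by blast
  qed
qed

lemma smooth_map_on_cong:
  assumes U: "open U" and eq: "\<And>x. x \<in> U \<Longrightarrow> f x = g x" and f: "smooth_map_on U f"
  shows "smooth_map_on U g"
  unfolding smooth_map_on_def
proof
  fix c assume c: "c \<in> atlas"
  show "smooth_on (snd c ` (U \<inter> fst c)) (in_chart c g)"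
    by (rule smooth_on_cong[OF chart_image_open[OF c U] _ smooth_map_onD[OF f c]])
      (use c eq in \<open>auto simp: in_chart_apply\<close>)
qed

lemma smooth_map_on_const: "open U \<Longrightarrow> smooth_map_on U (\<lambda>x. a)"
  unfolding smooth_map_on_def in_chart_def o_def
  by (rule ballI, rule smooth_on_const, rule chart_image_open) auto

lemma smooth_map_on_bounded_linear:
  "bounded_linear L \<Longrightarrow> open U \<Longrightarrow> smooth_map_on U f \<Longrightarrow> smooth_map_on U (\<lambda>x. L (f x))"
  unfolding smooth_map_on_def in_chart_def o_def
  by (rule ballI, rule smooth_on_bounded_linear) (auto intro: chart_image_open)

lemma smooth_map_on_bilinear:
  "bounded_bilinear B \<Longrightarrow> open U \<Longrightarrow> smooth_map_on U f \<Longrightarrow> smooth_map_on U g \<Longrightarrow>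
    smooth_map_on U (\<lambda>x. B (f x) (g x))"
  unfolding smooth_map_on_def in_chart_def o_def
  by (rule ballI, rule smooth_on_bilinear) (auto intro: chart_image_open)

lemma smooth_map_on_add:
  "open U \<Longrightarrow> smooth_map_on U f \<Longrightarrow> smooth_map_on U g \<Longrightarrow> smooth_map_on U (\<lambda>x. f x + g x)"
  unfolding smooth_map_on_def in_chart_def o_def
  by (rule ballI, rule smooth_on_add) (auto intro: chart_image_open)

lemma smooth_map_on_sum:
  "open U \<Longrightarrow> (\<And>i. i \<in> I \<Longrightarrow> smooth_map_on U (f i)) \<Longrightarrow> smooth_map_on U (\<lambda>x. \<Sum>i\<in>I. f i x)"
  unfolding smooth_map_on_def in_chart_def o_def
  by (rule ballI, rule smooth_on_sum) (auto intro: chart_image_open)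

lemma smooth_map_on_coordinates:
  assumes c: "c \<in> atlas" and T: "open T" and g: "smooth_on T g"
  shows "smooth_map_on {x \<in> fst c. snd c x \<in> T} (\<lambda>x. g (snd c x))"
proof (rule smooth_map_on_chartI[OF c chart_preimage_open[OF c T]])
  have o: "open (snd c ` {x \<in> fst c. snd c x \<in> T})"
    using chart_image_open[OF c chart_preimage_open[OF c T]] by (simp add: Int_absorb2 subset_iff)
  show "smooth_on (snd c ` {x \<in> fst c. snd c x \<in> T}) (in_chart c (\<lambda>x. g (snd c x)))"
    by (rule smooth_on_cong[OF o _ smooth_on_subset[OF g]]) (use c in \<open>auto simp: in_chart_apply\<close>)
qed auto

lemma in_chart_has_derivative:
  assumes "smooth_map_on U f" "x \<in> U" "c \<in> charts_at x"
  shows "(in_chart c f has_derivative chart_deriv c f x) (at (snd c x))"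
  unfolding chart_deriv_def
  by (rule smooth_on_has_derivative[OF smooth_map_onD[OF assms(1)]])
    (use assms in \<open>auto simp: charts_at_def\<close>)

lemma chart_smooth:
  assumes "c \<in> atlas"
  shows "smooth_map_on (fst c) (snd c)"
proof -
  have "smooth_map_on {x \<in> fst c. snd c x \<in> UNIV} (\<lambda>x. snd c x)"
    by (rule smooth_map_on_coordinates[OF assms open_UNIV smooth_on_id[OF open_UNIV]])
  then show ?thesis by simp
qed

lemma chart_deriv_change:
  assumes U: "open U" "x \<in> U" and f: "smooth_map_on U f"
    and c: "c \<in> charts_at x" and d: "d \<in> charts_at x"
  shows "chart_deriv c f x v = chart_deriv d f x (chart_deriv c (snd d) x v)"
proof -
  note ca = charts_atD[OF c] and da = charts_atD[OF d]
  let ?V = "snd c ` ((U \<inter> fst d) \<inter> fst c)"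
  have V: "open ?V" "snd c x \<in> ?V"
    using chart_image_open[OF ca(1), of "U \<inter> fst d"] chart_dom_open[OF da(1)] U ca da by auto
  have 1: "(in_chart c (snd d) has_derivative chart_deriv c (snd d) x) (at (snd c x))"
    by (rule in_chart_has_derivative[OF chart_smooth[OF da(1)] da(2) c])
  have 2: "(in_chart d f has_derivative chart_deriv d f x) (at (in_chart c (snd d) (snd c x)))"
    using in_chart_has_derivative[OF f U(2) d] ca da by (simp add: in_chart_apply)
  have "((\<lambda>p. in_chart d f (in_chart c (snd d) p)) has_derivative
      (\<lambda>v. chart_deriv d f x (chart_deriv c (snd d) x v))) (at (snd c x))"
    by (rule has_derivative_compose[OF 1 2])
  then have "(in_chart c f has_derivative
      (\<lambda>v. chart_deriv d f x (chart_deriv c (snd d) x v))) (at (snd c x))"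
    by (rule has_derivative_transform_within_open[OF _ V])
      (rule in_chart_change[OF ca(1) da(1), symmetric], auto)
  from has_derivative_unique[OF this in_chart_has_derivative[OF f U(2) c]]
  show ?thesis by (simp add: fun_eq_iff)
qed

lemma chart_deriv_self:
  assumes c: "c \<in> charts_at x"
  shows "chart_deriv c (snd c) x v = v"
proof -
  note ca = charts_atD[OF c]
  have "open (snd c ` (UNIV \<inter> fst c))" "snd c x \<in> snd c ` (UNIV \<inter> fst c)"
    using chart_image_open[OF ca(1) open_UNIV] ca by auto
  then have "(in_chart c (snd c) has_derivative (\<lambda>v. v)) (at (snd c x))"
    by (rule has_derivative_transform_within_open[OF has_derivative_ident])
      (use ca in \<open>auto simp: in_chart_apply\<close>)
  from has_derivative_unique[OF this in_chart_has_derivative[OF chart_smooth[OF ca(1)] ca(2) c]]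
  show ?thesis by (simp add: fun_eq_iff)
qed

lemma chart_deriv_linear:
  "smooth_map_on U f \<Longrightarrow> x \<in> U \<Longrightarrow> c \<in> charts_at x \<Longrightarrow> linear (chart_deriv c f x)"
  by (rule has_derivative_linear[OF in_chart_has_derivative])

lemma tangent_spaceI:
  assumes "\<And>c d. c \<in> charts_at x \<Longrightarrow> d \<in> charts_at x \<Longrightarrow> v d = chart_deriv c (snd d) x (v c)"
    and "\<And>c. c \<notin> charts_at x \<Longrightarrow> v c = 0"
  shows "v \<in> tangent_space x"
  unfolding tangent_space_def by (intro CollectI conjI ballI allI impI assms)

lemma tangent_change:
  assumes "v \<in> tangent_space x" "c \<in> charts_at x" "d \<in> charts_at x"
  shows "v d = chart_deriv c (snd d) x (v c)"
  by (rule bspec[OF bspec[OF CollectD[OF assms(1)[unfolded tangent_space_def], THEN conjunct1]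
        assms(2)] assms(3)])

lemma tangent_outside: "v \<in> tangent_space x \<Longrightarrow> c \<notin> charts_at x \<Longrightarrow> v c = 0"
  unfolding tangent_space_def by (drule CollectD) (drule conjunct2, erule allE, erule mp, assumption)

lemma differential_eq:
  assumes U: "open U" "x \<in> U" "smooth_map_on U f" and v: "v \<in> tangent_space x" and c: "c \<in> charts_at x"
  shows "differential f x v = chart_deriv c f x (v c)"
proof -
  define d where "d = (SOME d. d \<in> charts_at x)"
  have d: "d \<in> charts_at x" unfolding d_def using c by (rule someI)
  have "differential f x v = chart_deriv d f x (v d)"
    by (simp add: differential_def d_def Let_def)
  also have "v d = chart_deriv c (snd d) x (v c)" by (rule tangent_change[OF v c d])
  also have "chart_deriv d f x (chart_deriv c (snd d) x (v c)) = chart_deriv c f x (v c)"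
    by (rule chart_deriv_change[OF U c d, symmetric])
  finally show ?thesis .
qed

text \<open>The tangent vector at \<open>x\<close> whose component in the chart \<open>c\<close> is \<open>v\<close>.\<close>

definition coord_tangent :: "('m, 'e) chart \<Rightarrow> 'm \<Rightarrow> 'e \<Rightarrow> ('m, 'e) tangent" where
  "coord_tangent c x v d = (if d \<in> charts_at x then chart_deriv c (snd d) x v else 0)"

lemma coord_tangent_self: "c \<in> charts_at x \<Longrightarrow> coord_tangent c x v c = v"
  by (simp add: coord_tangent_def chart_deriv_self)

lemma coord_tangent_in:
  assumes c: "c \<in> charts_at x"
  shows "coord_tangent c x v \<in> tangent_space x"
proof (rule tangent_spaceI)
  fix c' d assume c': "c' \<in> charts_at x" and d: "d \<in> charts_at x"
  have "chart_deriv c (snd d) x v = chart_deriv c' (snd d) x (chart_deriv c (snd c') x v)"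
    by (rule chart_deriv_change[OF chart_dom_open _ chart_smooth c c', of d])
      (use charts_atD d in blast)+
  moreover have "coord_tangent c x v d = chart_deriv c (snd d) x v"
    "coord_tangent c x v c' = chart_deriv c (snd c') x v"
    using c' d by (simp_all add: coord_tangent_def)
  ultimately show "coord_tangent c x v d = chart_deriv c' (snd d) x (coord_tangent c x v c')"
    by metis
qed (simp add: coord_tangent_def)

lemma tangent_eqI:
  assumes "u \<in> tangent_space x" "v \<in> tangent_space x" "c \<in> charts_at x" "u c = v c"
  shows "u = v"
proof
  fix d show "u d = v d"
  proof (cases "d \<in> charts_at x")
    case True
    then show ?thesis
      using tangent_change[OF assms(1,3)] tangent_change[OF assms(2,3)] assms(4) by simp
  next
    case False
    then show ?thesis
      using tangent_outside[OF assms(1), of d] tangent_outside[OF assms(2), of d] by simp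
  qed
qed

lemma coord_tangent_eq: "v \<in> tangent_space x \<Longrightarrow> c \<in> charts_at x \<Longrightarrow> coord_tangent c x (v c) = v"
  by (rule tangent_eqI) (auto simp: coord_tangent_in coord_tangent_self)

lemma transition_deriv_linear:
  "c \<in> charts_at x \<Longrightarrow> d \<in> charts_at x \<Longrightarrow> linear (chart_deriv c (snd d) x)"
  by (rule chart_deriv_linear[OF chart_smooth]) (auto dest: charts_atD)

lemma coord_tangent_add:
  "c \<in> charts_at x \<Longrightarrow> coord_tangent c x (u + v) = (\<lambda>d. coord_tangent c x u d + coord_tangent c x v d)"
  by (rule ext) (simp add: coord_tangent_def linear_add[OF transition_deriv_linear])

lemma coord_tangent_scale:
  "c \<in> charts_at x \<Longrightarrow> coord_tangent c x (r *\<^sub>R v) = (\<lambda>d. r *\<^sub>R coord_tangent c x v d)"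
  by (rule ext) (simp add: coord_tangent_def linear_cmul[OF transition_deriv_linear])

lemma coord_vector_field:
  assumes c: "c \<in> atlas"
  shows "smooth_vector_field (fst c) (\<lambda>y. coord_tangent c y v)"
  unfolding smooth_vector_field_def
proof (intro conjI ballI)
  show "open (fst c)" by (rule chart_dom_open[OF c])
  show "coord_tangent c y v \<in> tangent_space y" if "y \<in> fst c" for y
    using c that by (intro coord_tangent_in) (simp add: charts_at_def)
  fix d assume d: "d \<in> atlas"
  show "smooth_map_on (fst c \<inter> fst d) (\<lambda>y. coord_tangent c y v d)"
  proof (rule smooth_map_on_chartI[OF c])
    show o: "open (fst c \<inter> fst d)" using c d by (auto intro: chart_dom_open)
    have o': "open (snd c ` (fst c \<inter> fst d))"
      using chart_image_open[OF c o] by (simp add: Int_ac)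
    show "smooth_on (snd c ` (fst c \<inter> fst d)) (in_chart c (\<lambda>y. coord_tangent c y v d))"
    proof (rule smooth_on_cong[OF o'])
      show "smooth_on (snd c ` (fst c \<inter> fst d)) (\<lambda>p. frechet_derivative (in_chart c (snd d)) (at p) v)"
        by (rule smooth_on_frechet_derivative[OF transition_smooth[OF c d]])
      fix p assume "p \<in> snd c ` (fst c \<inter> fst d)"
      then obtain y where y: "y \<in> fst c" "y \<in> fst d" "p = snd c y" by auto
      then show "frechet_derivative (in_chart c (snd d)) (at p) v = in_chart c (\<lambda>y. coord_tangent c y v d) p"
        using c d by (simp add: in_chart_apply coord_tangent_def charts_at_def chart_deriv_def)
    qed
  qed simp
qed

lemma smooth_vector_field_subset:
  "smooth_vector_field U A \<Longrightarrow> V \<subseteq> U \<Longrightarrow> open V \<Longrightarrow> smooth_vector_field V A"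
  unfolding smooth_vector_field_def
  by (auto intro: smooth_map_on_subset[where U="U \<inter> _"])

text \<open>The components of a Lie bracket transform like a tangent vector: in the transformed
  expression the second derivatives of the coordinate change cancel by their symmetry.\<close>

lemma lie_bracket_tangent:
  assumes A: "smooth_vector_field U A" and B: "smooth_vector_field U B" and x: "x \<in> U"
  shows "lie_bracket A B x \<in> tangent_space x"
proof -
  have U: "open U" using A by (simp add: smooth_vector_field_def)
  have "lie_bracket A B x d = chart_deriv c (snd d) x (lie_bracket A B x c)"
    if c: "c \<in> charts_at x" and d: "d \<in> charts_at x" for c d
  proof -
    note ca = charts_atD[OF c] and da = charts_atD[OF d]
    let ?V = "snd c ` ((U \<inter> fst d) \<inter> fst c)" and ?p = "snd c x" and ?T = "in_chart c (snd d)"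
    have V: "open ?V" "?p \<in> ?V"
      using chart_image_open[OF ca(1), of "U \<inter> fst d"] chart_dom_open[OF da(1)] U x ca da by auto
    have T: "smooth_on ?V ?T"
      by (rule smooth_on_subset[OF transition_smooth[OF ca(1) da(1)]]) auto
    \<comment> \<open>The component of a vector field in \<open>d\<close> is \<open>DT\<close> applied to its component in \<open>c\<close>, where \<open>T\<close> is
      the coordinate change.\<close>
    have comp: "chart_deriv d (\<lambda>y. E y d) x (E' x d) = fderiv (fderiv ?T) ?p (E' x c) (E x c)
        + chart_deriv c (snd d) x (chart_deriv c (\<lambda>y. E y c) x (E' x c))"
      if E: "smooth_vector_field U E" and E': "E' x \<in> tangent_space x" for E E' :: "'m \<Rightarrow> ('m, 'e) tangent"
    proof -
      have Esm: "smooth_map_on (U \<inter> fst d) (\<lambda>y. E y d)" "smooth_map_on (U \<inter> fst c) (\<lambda>y. E y c)"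
        using E ca da by (simp_all add: smooth_vector_field_def)
      have "chart_deriv c (\<lambda>y. E y d) x (E' x c) =
          chart_deriv d (\<lambda>y. E y d) x (chart_deriv c (snd d) x (E' x c))"
        by (rule chart_deriv_change[OF _ _ Esm(1) c d]) (use U x da(2) open_Int[OF U chart_dom_open[OF da(1)]] in auto)
      also have "chart_deriv c (snd d) x (E' x c) = E' x d"
        by (rule tangent_change[OF E' c d, symmetric])
      finally have 1: "chart_deriv d (\<lambda>y. E y d) x (E' x d) = chart_deriv c (\<lambda>y. E y d) x (E' x c)" ..
      have 2: "(in_chart c (\<lambda>y. E y c) has_derivative chart_deriv c (\<lambda>y. E y c) x) (at ?p)"
        by (rule in_chart_has_derivative[OF Esm(2) _ c]) (use x ca in auto)
      have 3: "((\<lambda>p. fderiv ?T p (in_chart c (\<lambda>y. E y c) p)) has_derivative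
          (\<lambda>v. fderiv ?T ?p (chart_deriv c (\<lambda>y. E y c) x v) + fderiv (fderiv ?T) ?p v (in_chart c (\<lambda>y. E y c) ?p))) (at ?p)"
        by (rule bounded_bilinear.FDERIV[OF bounded_bilinear_blinfun_apply
              has_derivative_fderiv[OF smooth_on_fderiv[OF V(1) T] V(2)] 2])
      have 4: "(in_chart c (\<lambda>y. E y d) has_derivative
          (\<lambda>v. fderiv ?T ?p (chart_deriv c (\<lambda>y. E y c) x v) + fderiv (fderiv ?T) ?p v (in_chart c (\<lambda>y. E y c) ?p))) (at ?p)"
      proof (rule has_derivative_transform_within_open[OF 3 V])
        fix p assume "p \<in> ?V"
        then obtain y where y: "y \<in> U" "y \<in> fst d" "y \<in> fst c" "p = snd c y" by auto
        have ch: "c \<in> charts_at y" "d \<in> charts_at y" using y ca da by (auto simp: charts_at_def)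
        have "E y \<in> tangent_space y" using E y by (simp add: smooth_vector_field_def)
        then have "E y d = chart_deriv c (snd d) y (E y c)" using ch by (intro tangent_change)
        also have "\<dots> = fderiv ?T p (E y c)"
          using fderiv_apply[OF T \<open>p \<in> ?V\<close>] y by (simp add: chart_deriv_def)
        finally show "fderiv ?T p (in_chart c (\<lambda>y. E y c) p) = in_chart c (\<lambda>y. E y d) p"
          using y ca by (simp add: in_chart_apply)
      qed
      from has_derivative_unique[OF 4 in_chart_has_derivative[OF Esm(1) _ c]]
      have "chart_deriv c (\<lambda>y. E y d) x (E' x c) = fderiv ?T ?p (chart_deriv c (\<lambda>y. E y c) x (E' x c))
          + fderiv (fderiv ?T) ?p (E' x c) (in_chart c (\<lambda>y. E y c) ?p)"
        using x da by (simp add: fun_eq_iff)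
      also have "in_chart c (\<lambda>y. E y c) ?p = E x c" using ca by (simp add: in_chart_apply)
      finally show ?thesis using 1 fderiv_apply[OF T V(2)] by (simp add: chart_deriv_def)
    qed
    have AB: "A x \<in> tangent_space x" "B x \<in> tangent_space x"
      using A B x by (auto simp: smooth_vector_field_def)
    show ?thesis
      using c d comp[OF B, of A, OF AB(1)] comp[OF A, of B, OF AB(2)]
        fderiv_fderiv_symmetric[OF V(1) T V(2), of "A x c" "B x c"]
      by (simp add: lie_bracket_def linear_diff[OF transition_deriv_linear[OF c d]])
  qed
  moreover have "lie_bracket A B x d = 0" if "d \<notin> charts_at x" for d
    using that by (simp add: lie_bracket_def)
  ultimately show ?thesis by (rule tangent_spaceI)
qed

end

section \<open>Local trivializations and smooth sections\<close>

context vector_bundle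
begin

text \<open>The element of the fibre over \<open>y\<close> with fibre coordinate \<open>a\<close>. For fixed \<open>a\<close> this is a section that is
  constant in the trivialization.\<close>

definition lift :: "('w \<Rightarrow> 'f) \<Rightarrow> 'm \<Rightarrow> 'f \<Rightarrow> 'w" where
  "lift \<psi> y a = inv_into (fibre W y) \<psi> a"

lemma local_trivialization_trivs: "t \<in> trivs W \<Longrightarrow> local_trivialization (fst t) (snd t)"
  unfolding local_trivialization_def
  using triv_open[of "fst t" "snd t"] triv_iso[of "fst t" "snd t"] triv_compat by simp

lemma ex_local_trivialization: "\<exists>N \<psi>. x \<in> N \<and> local_trivialization N \<psi>"
proof -
  have "x \<in> (\<Union>t\<in>trivs W. fst t)" using triv_cover by simp
  then show ?thesis using local_trivialization_trivs by blast
qed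

lemma local_trivialization_open: "local_trivialization N \<psi> \<Longrightarrow> open N"
  by (simp add: local_trivialization_def)

lemma triv_bij: "local_trivialization N \<psi> \<Longrightarrow> y \<in> N \<Longrightarrow> bij_betw \<psi> (fibre W y) UNIV"
  by (simp add: local_trivialization_def fibrewise_iso_def)

lemma triv_zero: "local_trivialization N \<psi> \<Longrightarrow> y \<in> N \<Longrightarrow> \<psi> (fzero W y) = 0"
  by (simp add: local_trivialization_def fibrewise_iso_def)

lemma triv_add: "local_trivialization N \<psi> \<Longrightarrow> y \<in> N \<Longrightarrow>
    v \<in> fibre W y \<Longrightarrow> w \<in> fibre W y \<Longrightarrow> \<psi> (fadd W v w) = \<psi> v + \<psi> w"
  by (simp add: local_trivialization_def fibrewise_iso_def)

lemma triv_scale: "local_trivialization N \<psi> \<Longrightarrow> y \<in> N \<Longrightarrow>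
    w \<in> fibre W y \<Longrightarrow> \<psi> (fscale W r w) = r *\<^sub>R \<psi> w"
  by (simp add: local_trivialization_def fibrewise_iso_def)

lemma triv_inj: "local_trivialization N \<psi> \<Longrightarrow> y \<in> N \<Longrightarrow>
    v \<in> fibre W y \<Longrightarrow> w \<in> fibre W y \<Longrightarrow> \<psi> v = \<psi> w \<Longrightarrow> v = w"
  using triv_bij unfolding bij_betw_def inj_on_def by blast

lemma lift_fibre: "local_trivialization N \<psi> \<Longrightarrow> y \<in> N \<Longrightarrow> lift \<psi> y a \<in> fibre W y"
  unfolding lift_def
  by (rule inv_into_into) (simp add: bij_betw_imp_surj_on[OF triv_bij])

lemma triv_lift: "local_trivialization N \<psi> \<Longrightarrow> y \<in> N \<Longrightarrow> \<psi> (lift \<psi> y a) = a"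
  unfolding lift_def
  by (rule f_inv_into_f) (simp add: bij_betw_imp_surj_on[OF triv_bij])

lemma lift_triv: "local_trivialization N \<psi> \<Longrightarrow> y \<in> N \<Longrightarrow> w \<in> fibre W y \<Longrightarrow> lift \<psi> y (\<psi> w) = w"
  unfolding lift_def
  by (rule inv_into_f_f) (simp_all add: bij_betw_imp_inj_on[OF triv_bij])

text \<open>The transition map is linear on fibres and smooth on the constant sections of the first
  trivialization. Expanding in a basis gives smoothness for all sections, which need not be constant
  in the first trivialization.\<close>

lemma triv_change_smooth:
  assumes "local_trivialization N \<psi>" "local_trivialization M \<theta>"
    and tr: "smooth_transition atlas W (N, \<psi>) (M, \<theta>)"
    and V: "open V" "V \<subseteq> N" "V \<subseteq> M" and X: "\<And>y. y \<in> V \<Longrightarrow> X y \<in> fibre W y"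
    and sm: "smooth_map_on V (\<lambda>y. \<psi> (X y))"
  shows "smooth_map_on V (\<lambda>y. \<theta> (X y))"
proof -
  have lin: "linear (\<lambda>a. \<theta> (lift \<psi> y a))" if y: "y \<in> V" for y
  proof
    have yN: "y \<in> N" "y \<in> M" using y V by auto
    note l = lift_fibre[OF assms(1) yN(1)]
    fix a b r
    have "lift \<psi> y (a + b) = fadd W (lift \<psi> y a) (lift \<psi> y b)"
      by (rule triv_inj[OF assms(1) yN(1) l fadd_fibre[OF l l]])
        (simp add: triv_add[OF assms(1) yN(1) l l] triv_lift[OF assms(1) yN(1)])
    then show "\<theta> (lift \<psi> y (a + b)) = \<theta> (lift \<psi> y a) + \<theta> (lift \<psi> y b)"
      by (simp add: triv_add[OF assms(2) yN(2) l l])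
    have "lift \<psi> y (r *\<^sub>R a) = fscale W r (lift \<psi> y a)"
      by (rule triv_inj[OF assms(1) yN(1) l fscale_fibre[OF l]])
        (simp add: triv_scale[OF assms(1) yN(1) l] triv_lift[OF assms(1) yN(1)])
    then show "\<theta> (lift \<psi> y (r *\<^sub>R a)) = r *\<^sub>R \<theta> (lift \<psi> y a)"
      by (simp add: triv_scale[OF assms(2) yN(2) l])
  qed
  have "smooth_map_on V (\<lambda>y. \<Sum>b\<in>onb. (\<psi> (X y) \<bullet> b) *\<^sub>R \<theta> (lift \<psi> y b))"
  proof (rule smooth_map_on_sum[OF V(1)], rule smooth_map_on_bilinear[OF bounded_bilinear_scaleR V(1)])
    fix b :: 'f
    show "smooth_map_on V (\<lambda>y. \<psi> (X y) \<bullet> b)"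
      by (rule smooth_map_on_bounded_linear[OF bounded_linear_inner_left V(1) sm])
    have "smooth_map_on (N \<inter> M) (\<lambda>y. \<theta> (lift \<psi> y b))"
      using tr by (simp add: smooth_transition_def lift_def)
    then show "smooth_map_on V (\<lambda>y. \<theta> (lift \<psi> y b))"
      by (rule smooth_map_on_subset) (use V in auto)
  qed
  then show ?thesis
  proof (rule smooth_map_on_cong[OF V(1), rotated])
    fix y assume y: "y \<in> V"
    then have "y \<in> N" using V by auto
    have "(\<Sum>b\<in>onb. (\<psi> (X y) \<bullet> b) *\<^sub>R \<theta> (lift \<psi> y b)) = \<theta> (lift \<psi> y (\<psi> (X y)))"
      by (rule linear_onb[OF lin[OF y], symmetric])
    then show "(\<Sum>b\<in>onb. (\<psi> (X y) \<bullet> b) *\<^sub>R \<theta> (lift \<psi> y b)) = \<theta> (X y)"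
      by (simp add: lift_triv[OF assms(1) \<open>y \<in> N\<close> X[OF y]])
  qed
qed

lemma smooth_sectionD:
  assumes "smooth_section U X"
  shows "open U" "y \<in> U \<Longrightarrow> X y \<in> fibre W y"
    "t \<in> trivs W \<Longrightarrow> smooth_map_on (U \<inter> fst t) (\<lambda>y. snd t (X y))"
  using assms unfolding smooth_section_def by (auto simp: o_def split_beta)

lemma smooth_section_trivial:
  assumes X: "smooth_section U X" and N: "local_trivialization N \<psi>"
  shows "smooth_map_on (U \<inter> N) (\<lambda>y. \<psi> (X y))"
proof (rule smooth_map_on_local)
  fix x assume x: "x \<in> U \<inter> N"
  have "x \<in> (\<Union>t\<in>trivs W. fst t)" using triv_cover by simp
  then obtain t where t: "t \<in> trivs W" "x \<in> fst t" by blast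
  note lt = local_trivialization_trivs[OF t(1)]
  let ?V = "U \<inter> N \<inter> fst t"
  have o: "open ?V"
    using smooth_sectionD(1)[OF X] local_trivialization_open[OF N] local_trivialization_open[OF lt]
    by auto
  have "smooth_transition atlas W (fst t, snd t) (N, \<psi>)"
    using N t unfolding local_trivialization_def by simp
  from triv_change_smooth[OF lt N this o]
  have "smooth_map_on ?V (\<lambda>y. \<psi> (X y))"
    using smooth_map_on_subset[OF smooth_sectionD(3)[OF X t(1)], of ?V] smooth_sectionD(2)[OF X]
    by auto
  then show "\<exists>V. open V \<and> x \<in> V \<and> smooth_map_on V (\<lambda>y. \<psi> (X y))"
    using o x t(2) by blast
qed

lemma smooth_sectionI:
  assumes N: "local_trivialization N \<psi>" and U: "open U" "U \<subseteq> N"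
    and X: "\<And>y. y \<in> U \<Longrightarrow> X y \<in> fibre W y" and sm: "smooth_map_on U (\<lambda>y. \<psi> (X y))"
  shows "smooth_section U X"
  unfolding smooth_section_def
proof (intro conjI ballI)
  fix t assume t: "t \<in> trivs W"
  note lt = local_trivialization_trivs[OF t]
  have o: "open (U \<inter> fst t)" using U(1) local_trivialization_open[OF lt] by auto
  have "smooth_transition atlas W (N, \<psi>) (fst t, snd t)"
    using N t unfolding local_trivialization_def by simp
  from triv_change_smooth[OF N lt this o]
  have "smooth_map_on (U \<inter> fst t) (\<lambda>y. snd t (X y))"
    using U X smooth_map_on_subset[OF sm, of "U \<inter> fst t"] by auto
  then show "case t of (N, \<psi>) \<Rightarrow> smooth_map_on (U \<inter> N) (\<psi> \<circ> X)"
    by (simp add: split_beta o_def)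
qed (use U X in auto)

lemma smooth_section_trivsI:
  assumes "open U" "\<And>y. y \<in> U \<Longrightarrow> X y \<in> fibre W y"
    "\<And>t. t \<in> trivs W \<Longrightarrow> smooth_map_on (U \<inter> fst t) (\<lambda>y. snd t (X y))"
  shows "smooth_section U X"
  using assms unfolding smooth_section_def by (auto simp: o_def split_beta)

lemma smooth_section_subset:
  assumes "smooth_section U X" "open V" "V \<subseteq> U"
  shows "smooth_section V X"
  using assms(2)
proof (rule smooth_section_trivsI)
  show "X y \<in> fibre W y" if "y \<in> V" for y using smooth_sectionD(2)[OF assms(1)] assms(3) that by auto
  show "smooth_map_on (V \<inter> fst t) (\<lambda>y. snd t (X y))" if "t \<in> trivs W" for t
    by (rule smooth_map_on_subset[OF smooth_sectionD(3)[OF assms(1) that]]) (use assms(3) in auto)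
qed

lemma smooth_section_cong:
  assumes X: "smooth_section U X" and eq: "\<And>y. y \<in> U \<Longrightarrow> X y = Y y"
  shows "smooth_section U Y"
  using smooth_sectionD(1)[OF X]
proof (rule smooth_section_trivsI)
  show "Y y \<in> fibre W y" if "y \<in> U" for y using smooth_sectionD(2)[OF X that] eq[OF that] by simp
  show "smooth_map_on (U \<inter> fst t) (\<lambda>y. snd t (Y y))" if t: "t \<in> trivs W" for t
    by (rule smooth_map_on_cong[OF _ _ smooth_sectionD(3)[OF X t]])
      (use smooth_sectionD(1)[OF X] local_trivialization_open[OF local_trivialization_trivs[OF t]] eq
        in auto)
qed

lemma smooth_section_lift:
  assumes N: "local_trivialization N \<psi>" and U: "open U" "U \<subseteq> N" and f: "smooth_map_on U f"
  shows "smooth_section U (\<lambda>y. lift \<psi> y (f y))"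
proof (rule smooth_sectionI[OF N U])
  show "lift \<psi> y (f y) \<in> fibre W y" if "y \<in> U" for y using lift_fibre[OF N] U that by blast
  show "smooth_map_on U (\<lambda>y. \<psi> (lift \<psi> y (f y)))"
    by (rule smooth_map_on_cong[OF U(1) _ f]) (use triv_lift[OF N] U in auto)
qed

lemma smooth_section_fadd:
  assumes X: "smooth_section U X" and Y: "smooth_section U Y"
  shows "smooth_section U (\<lambda>y. fadd W (X y) (Y y))"
  using smooth_sectionD(1)[OF X]
proof (rule smooth_section_trivsI)
  note XY = smooth_sectionD(2)[OF X] smooth_sectionD(2)[OF Y]
  show "fadd W (X y) (Y y) \<in> fibre W y" if "y \<in> U" for y by (intro fadd_fibre XY that)
  fix t assume t: "t \<in> trivs W"
  note lt = local_trivialization_trivs[OF t]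
  have o: "open (U \<inter> fst t)" using smooth_sectionD(1)[OF X] local_trivialization_open[OF lt] by auto
  show "smooth_map_on (U \<inter> fst t) (\<lambda>y. snd t (fadd W (X y) (Y y)))"
    by (rule smooth_map_on_cong[OF o _ smooth_map_on_add[OF o smooth_sectionD(3)[OF X t]
            smooth_sectionD(3)[OF Y t]]])
      (use XY triv_add[OF lt] in auto)
qed

lemma smooth_section_fscale:
  assumes f: "smooth_map_on U f" and X: "smooth_section U X"
  shows "smooth_section U (\<lambda>y. fscale W (f y) (X y))"
  using smooth_sectionD(1)[OF X]
proof (rule smooth_section_trivsI)
  note Xf = smooth_sectionD(2)[OF X]
  show "fscale W (f y) (X y) \<in> fibre W y" if "y \<in> U" for y by (intro fscale_fibre Xf that)
  fix t assume t: "t \<in> trivs W"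
  note lt = local_trivialization_trivs[OF t]
  have o: "open (U \<inter> fst t)" using smooth_sectionD(1)[OF X] local_trivialization_open[OF lt] by auto
  show "smooth_map_on (U \<inter> fst t) (\<lambda>y. snd t (fscale W (f y) (X y)))"
    by (rule smooth_map_on_cong[OF o _ smooth_map_on_bilinear[OF bounded_bilinear_scaleR o
            smooth_map_on_subset[OF f] smooth_sectionD(3)[OF X t]]])
      (use Xf triv_scale[OF lt] in auto)
qed

lemma smooth_section_fzero:
  assumes "open U"
  shows "smooth_section U (fzero W)"
  using assms
proof (rule smooth_section_trivsI)
  show "fzero W y \<in> fibre W y" for y by (rule fzero_fibre)
  fix t assume t: "t \<in> trivs W"
  note lt = local_trivialization_trivs[OF t]
  have o: "open (U \<inter> fst t)" using assms local_trivialization_open[OF lt] by auto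
  show "smooth_map_on (U \<inter> fst t) (\<lambda>y. snd t (fzero W y))"
    by (rule smooth_map_on_cong[OF o _ smooth_map_on_const[OF o, of 0]])
      (use triv_zero[OF lt] in auto)
qed


section \<open>Fibrewise linear subsets\<close>

definition fibrewise_subspace :: "'w set \<Rightarrow> bool" where
  "fibrewise_subspace S \<longleftrightarrow> (\<forall>x. fzero W x \<in> S \<and>
     (\<forall>v\<in>S \<inter> fibre W x. \<forall>w\<in>S \<inter> fibre W x. fadd W v w \<in> S) \<and>
     (\<forall>w\<in>S \<inter> fibre W x. \<forall>r. fscale W r w \<in> S))"

lemma fibrewise_subspaceI:
  assumes "\<And>x. fzero W x \<in> S"
    and "\<And>x v w. v \<in> S \<Longrightarrow> w \<in> S \<Longrightarrow> v \<in> fibre W x \<Longrightarrow> w \<in> fibre W x \<Longrightarrow> fadd W v w \<in> S"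
    and "\<And>x w r. w \<in> S \<Longrightarrow> w \<in> fibre W x \<Longrightarrow> fscale W r w \<in> S"
  shows "fibrewise_subspace S"
  using assms unfolding fibrewise_subspace_def by auto

lemma fibrewise_subspaceD:
  assumes "fibrewise_subspace S"
  shows "fzero W x \<in> S"
    and "v \<in> S \<Longrightarrow> w \<in> S \<Longrightarrow> v \<in> fibre W x \<Longrightarrow> w \<in> fibre W x \<Longrightarrow> fadd W v w \<in> S"
    and "w \<in> S \<Longrightarrow> w \<in> fibre W x \<Longrightarrow> fscale W r w \<in> S"
  using assms unfolding fibrewise_subspace_def by auto

lemma subspace_image:
  assumes S: "fibrewise_subspace S" and N: "local_trivialization N \<psi>" "x \<in> N"
  shows "subspace (\<psi> ` (S \<inter> fibre W x))"
proof (rule subspaceI)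
  show "0 \<in> \<psi> ` (S \<inter> fibre W x)"
    using fibrewise_subspaceD(1)[OF S, of x] fzero_fibre triv_zero[OF N]
    by (intro image_eqI[of _ _ "fzero W x"]) auto
  fix a b assume "a \<in> \<psi> ` (S \<inter> fibre W x)" "b \<in> \<psi> ` (S \<inter> fibre W x)"
  then obtain v w where vw: "v \<in> S" "v \<in> fibre W x" "a = \<psi> v" "w \<in> S" "w \<in> fibre W x" "b = \<psi> w"
    by auto
  then show "a + b \<in> \<psi> ` (S \<inter> fibre W x)"
    using fibrewise_subspaceD(2)[OF S vw(1,4,2,5)] fadd_fibre triv_add[OF N vw(2,5)]
    by (intro image_eqI[of _ _ "fadd W v w"]) auto
next
  fix r a assume "a \<in> \<psi> ` (S \<inter> fibre W x)"
  then obtain v where v: "v \<in> S" "v \<in> fibre W x" "a = \<psi> v" by auto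
  then show "r *\<^sub>R a \<in> \<psi> ` (S \<inter> fibre W x)"
    using fibrewise_subspaceD(3)[OF S v(1,2), of r] fscale_fibre triv_scale[OF N v(2)]
    by (intro image_eqI[of _ _ "fscale W r v"]) auto
qed

lemma triv_mem_image_iff:
  assumes N: "local_trivialization N \<psi>" "x \<in> N" and w: "w \<in> fibre W x"
  shows "\<psi> w \<in> \<psi> ` (S \<inter> fibre W x) \<longleftrightarrow> w \<in> S"
  using triv_inj[OF N w] w by blast

lemma fadd_fzero:
  assumes "w \<in> fibre W x"
  shows "fadd W w (fzero W x) = w" "fadd W (fzero W x) w = w"
proof -
  obtain N \<psi> where N: "x \<in> N" "local_trivialization N \<psi>" using ex_local_trivialization by blast
  note z = fzero_fibre[of x]
  show "fadd W w (fzero W x) = w" "fadd W (fzero W x) w = w"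
    by (rule triv_inj[OF N(2,1) fadd_fibre];
        simp add: assms z triv_add[OF N(2,1)] triv_zero[OF N(2,1)])+
qed

text \<open>By this equivalence the vanishing of a value of the second fundamental form becomes a statement about
  membership.\<close>

lemma fibre_class_eq_zero_iff:
  assumes S: "fibrewise_subspace S" and w: "w \<in> fibre W x"
  shows "fibre_class S w = fibre_class S (fzero W x) \<longleftrightarrow> w \<in> S"
proof -
  have pr: "proj W w = x" "proj W (fzero W x) = x" using w fzero_fibre by (auto simp: fibre_def)
  have zero: "fibre_class S (fzero W x) = S \<inter> fibre W x"
    unfolding fibre_class_def pr using fadd_fzero(2) by force
  show ?thesis
  proof
    assume "fibre_class S w = fibre_class S (fzero W x)"
    moreover have "w \<in> fibre_class S w"
      unfolding fibre_class_def pr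
      using fadd_fzero(1)[OF w] fibrewise_subspaceD(1)[OF S] fzero_fibre by force
    ultimately show "w \<in> S" using zero by auto
  next
    assume wS: "w \<in> S"
    obtain N \<psi> where N: "x \<in> N" "local_trivialization N \<psi>" using ex_local_trivialization by blast
    note add = triv_add[OF N(2,1)] and sc = triv_scale[OF N(2,1)]
    have "fibre_class S w = S \<inter> fibre W x"
    proof
      show "fibre_class S w \<subseteq> S \<inter> fibre W x"
        unfolding fibre_class_def pr using fibrewise_subspaceD(2)[OF S wS _ w] fadd_fibre[OF w] by auto
      show "S \<inter> fibre W x \<subseteq> fibre_class S w"
      proof
        fix v assume v: "v \<in> S \<inter> fibre W x"
        define u where "u = fadd W (fscale W (-1) w) v"
        have u: "u \<in> S" "u \<in> fibre W x"
          unfolding u_def using v w wS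
          by (auto intro!: fibrewise_subspaceD(2)[OF S, where x=x] fibrewise_subspaceD(3)[OF S, where x=x]
              fadd_fibre fscale_fibre)
        have "v = fadd W w u"
          by (rule triv_inj[OF N(2,1) _ fadd_fibre[OF w u(2)]])
            (use v w u(2) in \<open>simp_all add: add sc u_def fscale_fibre\<close>)
        then show "v \<in> fibre_class S w" unfolding fibre_class_def pr using u by auto
      qed
    qed
    then show "fibre_class S w = fibre_class S (fzero W x)" using zero by simp
  qed
qed

lemma section_throughD:
  assumes "section_through S w U X"
  shows "smooth_section U X" "y \<in> U \<Longrightarrow> X y \<in> S" "proj W w \<in> U" "X (proj W w) = w"
  using assms unfolding section_through_def by auto

lemma section_part_subset: "\<S> V \<subseteq> V"
  by (auto simp: section_part_def)

lemma section_values_in_section_part: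
  assumes X: "smooth_section U X" and V: "\<And>y. y \<in> U \<Longrightarrow> X y \<in> V" and y: "y \<in> U"
  shows "X y \<in> \<S> V" "section_through V (X y) U X"
proof -
  have "proj W (X y) = y" using smooth_sectionD(2)[OF X y] by (simp add: fibre_def)
  then show "section_through V (X y) U X" using assms by (auto simp: section_through_def)
  then show "X y \<in> \<S> V" using V[OF y] by (auto simp: section_part_def)
qed

text \<open>A section of \<open>V\<close> witnesses for each of its values that this value belongs to \<open>\<S> V\<close>, hence it is a
  section of \<open>\<S> V\<close>.\<close>

lemma section_part_section:
  assumes "w \<in> \<S> V"
  shows "\<exists>U X. section_through (\<S> V) w U X"
proof -
  obtain U X where X: "section_through V w U X" using assms by (auto simp: section_part_def)
  have "X y \<in> \<S> V" if "y \<in> U" for y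
    by (rule section_values_in_section_part(1)[OF section_throughD(1,2)[OF X] that])
  then have "section_through (\<S> V) w U X" using X by (auto simp: section_through_def)
  then show ?thesis by blast
qed

lemma section_through_fadd:
  assumes S: "fibrewise_subspace S" and X: "section_through S v U X" and Y: "section_through S w V Y"
    and v: "v \<in> fibre W x" and w: "w \<in> fibre W x"
  shows "section_through S (fadd W v w) (U \<inter> V) (\<lambda>y. fadd W (X y) (Y y))"
proof -
  note XD = section_throughD[OF X] and YD = section_throughD[OF Y]
  have o: "open (U \<inter> V)" using smooth_sectionD(1)[OF XD(1)] smooth_sectionD(1)[OF YD(1)] by auto
  have pr: "proj W (fadd W v w) = x" "proj W v = x" "proj W w = x"
    using fadd_fibre[OF v w] v w by (auto simp: fibre_def)
  show ?thesis
    unfolding section_through_def pr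
  proof (intro conjI)
    show "smooth_section (U \<inter> V) (\<lambda>y. fadd W (X y) (Y y))"
      by (intro smooth_section_fadd smooth_section_subset[OF XD(1) o] smooth_section_subset[OF YD(1) o])
        auto
    show "(\<lambda>y. fadd W (X y) (Y y)) ` (U \<inter> V) \<subseteq> S"
      by (auto intro!: fibrewise_subspaceD(2)[OF S XD(2) YD(2)] smooth_sectionD(2)[OF XD(1)]
          smooth_sectionD(2)[OF YD(1)])
    show "x \<in> U \<inter> V" "fadd W (X x) (Y x) = fadd W v w" using XD(3,4) YD(3,4) pr by auto
  qed
qed

lemma section_through_fscale:
  assumes S: "fibrewise_subspace S" and X: "section_through S w U X" and w: "w \<in> fibre W x"
  shows "section_through S (fscale W r w) U (\<lambda>y. fscale W r (X y))"
proof -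
  note XD = section_throughD[OF X]
  have pr: "proj W (fscale W r w) = x" "proj W w = x"
    using fscale_fibre[OF w] w by (auto simp: fibre_def)
  show ?thesis
    unfolding section_through_def pr
  proof (intro conjI)
    show "smooth_section U (\<lambda>y. fscale W r (X y))"
      by (intro smooth_section_fscale[OF smooth_map_on_const XD(1)] smooth_sectionD(1)[OF XD(1)])
    show "(\<lambda>y. fscale W r (X y)) ` U \<subseteq> S"
      using fibrewise_subspaceD(3)[OF S XD(2)] smooth_sectionD(2)[OF XD(1)] by auto
    show "x \<in> U" "fscale W r (X x) = fscale W r w" using XD(3,4) pr by auto
  qed
qed

lemma section_through_fzero:
  assumes "fibrewise_subspace S"
  shows "section_through S (fzero W x) UNIV (fzero W)"
  using fzero_fibre[of x] fibrewise_subspaceD(1)[OF assms] smooth_section_fzero[OF open_UNIV]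
  by (auto simp: section_through_def fibre_def)

lemma fibrewise_subspace_section_part:
  assumes V: "fibrewise_subspace V"
  shows "fibrewise_subspace (\<S> V)"
proof (rule fibrewise_subspaceI)
  show "fzero W x \<in> \<S> V" for x
    using section_through_fzero[OF V, of x] fibrewise_subspaceD(1)[OF V]
    by (auto simp: section_part_def)
next
  fix x v w assume vw: "v \<in> \<S> V" "w \<in> \<S> V" "v \<in> fibre W x" "w \<in> fibre W x"
  then obtain U X U' Y where "section_through V v U X" "section_through V w U' Y"
    by (auto simp: section_part_def)
  from section_through_fadd[OF V this vw(3,4)] show "fadd W v w \<in> \<S> V"
    using fibrewise_subspaceD(2)[OF V _ _ vw(3,4)] vw(1,2) unfolding section_part_def by blast
next
  fix x w r assume w: "w \<in> \<S> V" "w \<in> fibre W x"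
  then obtain U X where "section_through V w U X" by (auto simp: section_part_def)
  from section_through_fscale[OF V this w(2)] show "fscale W r w \<in> \<S> V"
    using fibrewise_subspaceD(3)[OF V _ w(2)] w(1) unfolding section_part_def by blast
qed

end

section \<open>Connections and curvature in coordinates\<close>

context linear_connection
begin

lemma nabla_cong:
  assumes X: "smooth_section U X" and V: "open V" "V \<subseteq> U" "x \<in> V"
    and eq: "\<And>y. y \<in> V \<Longrightarrow> X y = Y y" and v: "v \<in> tangent_space x"
  shows "nabla X x v = nabla Y x v"
proof -
  have XV: "smooth_section V X" by (rule smooth_section_subset[OF X V(1,2)])
  show ?thesis by (rule nabla_local[OF XV smooth_section_cong[OF XV eq] eq V(3) v])
qed

text \<open>Additivity gives \<open>\<nabla>0 = \<nabla>0 + \<nabla>0\<close>.\<close>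

lemma nabla_fzero:
  assumes v: "v \<in> tangent_space x"
  shows "nabla (fzero W) x v = fzero W x"
proof -
  note z = smooth_section_fzero[OF open_UNIV]
  obtain N \<psi> where N: "x \<in> N" "local_trivialization N \<psi>" using ex_local_trivialization by blast
  have nz: "nabla (fzero W) x v \<in> fibre W x" by (rule nabla_fibre[OF z UNIV_I v])
  have "nabla (fzero W) x v = nabla (\<lambda>y. fadd W (fzero W y) (fzero W y)) x v"
    by (rule nabla_cong[OF z open_UNIV _ _ _ v]) (simp_all add: fadd_fzero[OF fzero_fibre])
  also have "\<dots> = fadd W (nabla (fzero W) x v) (nabla (fzero W) x v)"
    by (rule nabla_add[OF z z UNIV_I v])
  finally have "\<psi> (nabla (fzero W) x v) = \<psi> (fadd W (nabla (fzero W) x v) (nabla (fzero W) x v))"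
    by (rule arg_cong)
  then have "\<psi> (nabla (fzero W) x v) = 0"
    by (simp add: triv_add[OF N(2,1) nz nz])
  then show ?thesis
    by (intro triv_inj[OF N(2,1) nz fzero_fibre])
      (simp add: triv_zero[OF N(2,1)])
qed

text \<open>The connection form in the frame given by a local trivialization.\<close>

definition christoffel :: "('m, 'e) chart \<Rightarrow> ('w \<Rightarrow> 'f) \<Rightarrow> 'e \<Rightarrow> 'e \<Rightarrow>\<^sub>L 'f \<Rightarrow>\<^sub>L 'f" where
  "christoffel c \<psi> p = onb_blinfun (\<lambda>v. onb_blinfun (\<lambda>a.
     in_chart c (\<lambda>x. \<psi> (nabla (\<lambda>y. lift \<psi> y a) x (coord_tangent c x v))) p))"

context
  fixes c :: "('m, 'e) chart" and N :: "'m set" and \<psi> :: "'w \<Rightarrow> 'f"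
  assumes c: "c \<in> atlas" and N: "local_trivialization N \<psi>"
begin

lemma frame_section: "smooth_section N (\<lambda>y. lift \<psi> y a)"
  by (rule smooth_section_lift[OF N local_trivialization_open[OF N] order_refl
        smooth_map_on_const[OF local_trivialization_open[OF N]]])

lemma frame_nabla_add:
  assumes x: "x \<in> N" and v: "v \<in> tangent_space x"
  shows "\<psi> (nabla (\<lambda>y. lift \<psi> y (a + b)) x v) =
    \<psi> (nabla (\<lambda>y. lift \<psi> y a) x v) + \<psi> (nabla (\<lambda>y. lift \<psi> y b) x v)"
proof -
  have "nabla (\<lambda>y. lift \<psi> y (a + b)) x v = nabla (\<lambda>y. fadd W (lift \<psi> y a) (lift \<psi> y b)) x v"
  proof (rule nabla_cong[OF frame_section local_trivialization_open[OF N] order_refl x _ v])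
    fix y assume y: "y \<in> N"
    note l = lift_fibre[OF N y]
    show "lift \<psi> y (a + b) = fadd W (lift \<psi> y a) (lift \<psi> y b)"
      by (rule triv_inj[OF N y l fadd_fibre[OF l l]])
        (simp add: triv_add[OF N y l l] triv_lift[OF N y])
  qed
  also have "\<dots> = fadd W (nabla (\<lambda>y. lift \<psi> y a) x v) (nabla (\<lambda>y. lift \<psi> y b) x v)"
    by (rule nabla_add[OF frame_section frame_section x v])
  finally show ?thesis
    using triv_add[OF N x nabla_fibre[OF frame_section x v] nabla_fibre[OF frame_section x v]]
    by simp
qed

lemma frame_nabla_scale:
  assumes x: "x \<in> N" and v: "v \<in> tangent_space x"
  shows "\<psi> (nabla (\<lambda>y. lift \<psi> y (r *\<^sub>R a)) x v) = r *\<^sub>R \<psi> (nabla (\<lambda>y. lift \<psi> y a) x v)"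
proof -
  note oN = local_trivialization_open[OF N]
  note nf = nabla_fibre[OF frame_section x v] note lf = lift_fibre[OF N x]
  have "nabla (\<lambda>y. lift \<psi> y (r *\<^sub>R a)) x v = nabla (\<lambda>y. fscale W r (lift \<psi> y a)) x v"
  proof (rule nabla_cong[OF frame_section oN order_refl x _ v])
    fix y assume y: "y \<in> N"
    note l = lift_fibre[OF N y]
    show "lift \<psi> y (r *\<^sub>R a) = fscale W r (lift \<psi> y a)"
      by (rule triv_inj[OF N y l fscale_fibre[OF l]])
        (simp add: triv_scale[OF N y l] triv_lift[OF N y])
  qed
  also have "\<dots> = fadd W (fscale W r (nabla (\<lambda>y. lift \<psi> y a) x v))
      (fscale W (differential (\<lambda>y. r) x v) (lift \<psi> x a))"
    by (rule nabla_Leibniz[OF smooth_map_on_const[OF oN] frame_section x v])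
  also have "differential (\<lambda>y. r) x v = 0"
    by (simp add: differential_def chart_deriv_def in_chart_def o_def Let_def frechet_derivative_const)
  finally show ?thesis
    by (simp add: triv_add[OF N x fscale_fibre[OF nf] fscale_fibre[OF lf]]
        triv_scale[OF N x nf] triv_scale[OF N x lf])
qed

lemma christoffel_apply:
  assumes x: "x \<in> N" "x \<in> fst c" and v: "v \<in> tangent_space x"
  shows "christoffel c \<psi> (snd c x) (v c) a = \<psi> (nabla (\<lambda>y. lift \<psi> y a) x v)"
proof -
  have cx: "c \<in> charts_at x" using c x by (simp add: charts_at_def)
  let ?n = "\<lambda>v a. \<psi> (nabla (\<lambda>y. lift \<psi> y a) x (coord_tangent c x v))"
  note t = coord_tangent_in[OF cx]
  note nf = nabla_fibre[OF frame_section x(1) t]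
  have lin: "linear (?n v)" for v
    by (rule linearI) (simp_all add: frame_nabla_add[OF x(1) t] frame_nabla_scale[OF x(1) t])
  have 1: "?n (u + v) a = ?n u a + ?n v a" for u v a
    by (simp add: coord_tangent_add[OF cx] nabla_tangent_add[OF frame_section x(1) t t]
        triv_add[OF N x(1) nf nf])
  have 2: "?n (r *\<^sub>R v) a = r *\<^sub>R ?n v a" for r v a
    by (simp add: coord_tangent_scale[OF cx] nabla_tangent_scale[OF frame_section x(1) t]
        triv_scale[OF N x(1) nf])
  have lin2: "linear (\<lambda>v. onb_blinfun (?n v))"
    by (rule linearI; rule blinfun_eqI)
      (simp_all only: onb_blinfun_apply[OF lin] blinfun.add_left blinfun.scaleR_left, simp_all only: 1 2)
  show ?thesis
    using onb_blinfun_apply[OF lin2, of "v c"] onb_blinfun_apply[OF lin, of "v c" a]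
    by (simp add: christoffel_def in_chart_apply[OF c x(2)] coord_tangent_eq[OF v cx])
qed

text \<open>The components of the connection form are derivatives of the frame along coordinate vector fields,
  and these are smooth sections.\<close>

lemma christoffel_smooth: "smooth_on (snd c ` (N \<inter> fst c)) (christoffel c \<psi>)"
proof -
  have oN: "open (N \<inter> fst c)" using local_trivialization_open[OF N] chart_dom_open[OF c] by auto
  have o: "open (snd c ` (N \<inter> fst c))" by (rule chart_image_open[OF c local_trivialization_open[OF N]])
  have "smooth_on (snd c ` (N \<inter> fst c))
      (in_chart c (\<lambda>x. \<psi> (nabla (\<lambda>y. lift \<psi> y a) x (coord_tangent c x v))))" for v a
  proof -
    have "smooth_section (N \<inter> fst c) (\<lambda>x. nabla (\<lambda>y. lift \<psi> y a) x (coord_tangent c x v))"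
      by (rule nabla_smooth[OF smooth_section_subset[OF frame_section oN]
            smooth_vector_field_subset[OF coord_vector_field[OF c] _ oN]]) auto
    from smooth_map_onD[OF smooth_section_trivial[OF this N] c] show ?thesis
      by (simp add: Int_ac)
  qed
  then show ?thesis
    unfolding christoffel_def[abs_def] by (intro smooth_on_onb_blinfun[OF o])
qed

text \<open>The section is expanded in the frame one basis vector at a time, so that only the sum and
  product rules are used.\<close>

lemma nabla_partial_sum:
  assumes U: "open U" "U \<subseteq> N" and f: "smooth_map_on U f" and x: "x \<in> U" and v: "v \<in> tangent_space x"
    and B: "finite B"
  shows "\<psi> (nabla (\<lambda>y. lift \<psi> y (\<Sum>b\<in>B. (f y \<bullet> b) *\<^sub>R b)) x v) =
    (\<Sum>b\<in>B. differential (\<lambda>y. f y \<bullet> b) x v *\<^sub>R b + (f x \<bullet> b) *\<^sub>R \<psi> (nabla (\<lambda>y. lift \<psi> y b) x v))"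
  using B
proof induction
  case empty
  have xN: "x \<in> N" using x U by auto
  have "nabla (\<lambda>y. lift \<psi> y 0) x v = nabla (fzero W) x v"
  proof (rule nabla_cong[OF frame_section local_trivialization_open[OF N] order_refl xN _ v])
    show "lift \<psi> y 0 = fzero W y" if "y \<in> N" for y
      using lift_triv[OF N that fzero_fibre] triv_zero[OF N that] by simp
  qed
  then show ?case by (simp add: nabla_fzero[OF v] triv_zero[OF N xN])
next
  case (insert b B)
  have xN: "x \<in> N" using x U by auto
  define S where "S y = (\<Sum>b\<in>B. (f y \<bullet> b) *\<^sub>R b)" for y
  have fb: "smooth_map_on U (\<lambda>y. f y \<bullet> b)" for b
    by (rule smooth_map_on_bounded_linear[OF bounded_linear_inner_left U(1) f])
  have S: "smooth_map_on U S"
    unfolding S_def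
    by (rule smooth_map_on_sum[OF U(1)], rule smooth_map_on_bilinear[OF bounded_bilinear_scaleR U(1) fb])
      (rule smooth_map_on_const[OF U(1)])
  note Sl = smooth_section_lift[OF N U S]
  note fr = smooth_section_subset[OF frame_section U(1,2)]
  note fs = smooth_section_fscale[OF fb fr]
  note nf = nabla_fibre[OF fr x v] and nS = nabla_fibre[OF Sl x v] and nfs = nabla_fibre[OF fs x v]
    and lf = lift_fibre[OF N xN]
  have "nabla (\<lambda>y. lift \<psi> y (\<Sum>b\<in>insert b B. (f y \<bullet> b) *\<^sub>R b)) x v =
      nabla (\<lambda>y. fadd W (fscale W (f y \<bullet> b) (lift \<psi> y b)) (lift \<psi> y (S y))) x v"
  proof (rule nabla_cong[OF smooth_section_fadd[OF fs Sl] U(1) order_refl x _ v, symmetric])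
    fix y assume "y \<in> U"
    then have y: "y \<in> N" using U by auto
    note l = lift_fibre[OF N y]
    show "fadd W (fscale W (f y \<bullet> b) (lift \<psi> y b)) (lift \<psi> y (S y)) =
        lift \<psi> y (\<Sum>b\<in>insert b B. (f y \<bullet> b) *\<^sub>R b)"
      by (rule triv_inj[OF N y fadd_fibre[OF fscale_fibre[OF l] l] l])
        (use insert in \<open>simp add: triv_add[OF N y fscale_fibre[OF l] l]
          triv_scale[OF N y l] triv_lift[OF N y] S_def\<close>)
  qed
  also have "\<dots> = fadd W (nabla (\<lambda>y. fscale W (f y \<bullet> b) (lift \<psi> y b)) x v) (nabla (\<lambda>y. lift \<psi> y (S y)) x v)"
    by (rule nabla_add[OF fs Sl x v])
  also have "nabla (\<lambda>y. fscale W (f y \<bullet> b) (lift \<psi> y b)) x v =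
      fadd W (fscale W (f x \<bullet> b) (nabla (\<lambda>y. lift \<psi> y b) x v))
        (fscale W (differential (\<lambda>y. f y \<bullet> b) x v) (lift \<psi> x b))"
    by (rule nabla_Leibniz[OF fb fr x v])
  finally have "\<psi> (nabla (\<lambda>y. lift \<psi> y (\<Sum>b\<in>insert b B. (f y \<bullet> b) *\<^sub>R b)) x v) =
      (f x \<bullet> b) *\<^sub>R \<psi> (nabla (\<lambda>y. lift \<psi> y b) x v) + differential (\<lambda>y. f y \<bullet> b) x v *\<^sub>R b
      + \<psi> (nabla (\<lambda>y. lift \<psi> y (S y)) x v)"
    by (simp add: triv_add[OF N xN fadd_fibre[OF fscale_fibre[OF nf] fscale_fibre[OF lf]] nS]
        triv_add[OF N xN fscale_fibre[OF nf] fscale_fibre[OF lf]]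
        triv_scale[OF N xN nf] triv_scale[OF N xN lf]
        triv_lift[OF N xN])
  then show ?case using insert by (simp add: S_def)
qed

lemma nabla_coordinates:
  assumes X: "smooth_section U X" and x: "x \<in> U" "x \<in> N" "x \<in> fst c" and v: "v \<in> tangent_space x"
  shows "\<psi> (nabla X x v) = chart_deriv c (\<lambda>y. \<psi> (X y)) x (v c)
    + christoffel c \<psi> (snd c x) (v c) (\<psi> (X x))"
proof -
  have cx: "c \<in> charts_at x" using c x by (simp add: charts_at_def)
  let ?V = "U \<inter> N" let ?f = "\<lambda>y. \<psi> (X y)"
  have V: "open ?V" "?V \<subseteq> N" "x \<in> ?V"
    using smooth_sectionD(1)[OF X] local_trivialization_open[OF N] x by auto
  have f: "smooth_map_on ?V ?f" by (rule smooth_section_trivial[OF X N])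
  have fb: "smooth_map_on ?V (\<lambda>y. ?f y \<bullet> b)" for b
    by (rule smooth_map_on_bounded_linear[OF bounded_linear_inner_left V(1) f])
  have df: "differential (\<lambda>y. ?f y \<bullet> b) x v = chart_deriv c ?f x (v c) \<bullet> b" for b
  proof -
    have "differential (\<lambda>y. ?f y \<bullet> b) x v = chart_deriv c (\<lambda>y. ?f y \<bullet> b) x (v c)"
      by (rule differential_eq[OF V(1,3) fb v cx])
    also have "(in_chart c (\<lambda>y. ?f y \<bullet> b) has_derivative (\<lambda>h. chart_deriv c ?f x h \<bullet> b)) (at (snd c x))"
      using bounded_linear.has_derivative[OF bounded_linear_inner_left
          in_chart_has_derivative[OF f V(3) cx], of b] by (simp add: in_chart_def o_def)
    from has_derivative_unique[OF in_chart_has_derivative[OF fb V(3) cx] this]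
    have "chart_deriv c (\<lambda>y. ?f y \<bullet> b) x (v c) = chart_deriv c ?f x (v c) \<bullet> b"
      by (simp add: fun_eq_iff)
    finally show ?thesis .
  qed
  have "nabla X x v = nabla (\<lambda>y. lift \<psi> y (\<Sum>b\<in>onb. (?f y \<bullet> b) *\<^sub>R b)) x v"
    by (rule nabla_cong[OF X V(1) _ V(3) _ v])
      (auto simp: onb(3) lift_triv[OF N _ smooth_sectionD(2)[OF X]])
  then have "\<psi> (nabla X x v) = (\<Sum>b\<in>onb. differential (\<lambda>y. ?f y \<bullet> b) x v *\<^sub>R b
      + (?f x \<bullet> b) *\<^sub>R \<psi> (nabla (\<lambda>y. lift \<psi> y b) x v))"
    using nabla_partial_sum[OF V(1,2) f V(3) v onb(1)] by simp
  also have "\<dots> = (\<Sum>b\<in>onb. (chart_deriv c ?f x (v c) \<bullet> b) *\<^sub>R b)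
      + (\<Sum>b\<in>onb. (?f x \<bullet> b) *\<^sub>R christoffel c \<psi> (snd c x) (v c) b)"
    by (simp add: df christoffel_apply[OF x(2,3) v] sum.distrib)
  also have "(\<Sum>b\<in>onb. (?f x \<bullet> b) *\<^sub>R christoffel c \<psi> (snd c x) (v c) b)
      = christoffel c \<psi> (snd c x) (v c) (?f x)"
    by (rule linear_onb[OF bounded_linear.linear[OF blinfun.bounded_linear_right], symmetric])
  finally show ?thesis by (simp add: onb(3))
qed

text \<open>The curvature \<open>d\<Gamma> + \<Gamma> \<and> \<Gamma>\<close> of the connection form \<open>\<Gamma>\<close>.\<close>

definition curvature_form :: "'e \<Rightarrow> 'e \<Rightarrow> 'e \<Rightarrow> 'f \<Rightarrow> 'f" where
  "curvature_form p u v a = fderiv (christoffel c \<psi>) p u v a - fderiv (christoffel c \<psi>) p v u a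
     + christoffel c \<psi> p u (christoffel c \<psi> p v a) - christoffel c \<psi> p v (christoffel c \<psi> p u a)"

text \<open>Tensoriality of the curvature. In the difference of the two iterated derivatives, the second
  derivatives of the section cancel by their symmetry, the terms with first derivatives of the section
  cancel in pairs, and the terms with derivatives of the vector fields are those of the derivative
  along the Lie bracket.\<close>

lemma curvature_fields_coordinates:
  assumes A: "smooth_vector_field U A" "x \<in> U" and B: "smooth_vector_field V B" "x \<in> V"
    and X: "smooth_section Q X" "x \<in> Q" and x: "x \<in> N" "x \<in> fst c"
  shows "curvature_fields A B X x \<in> fibre W x"
    and "\<psi> (curvature_fields A B X x) = curvature_form (snd c x) (A x c) (B x c) (\<psi> (X x))"
proof -
  have cx: "c \<in> charts_at x" using c x by (simp add: charts_at_def)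
  let ?S = "U \<inter> V \<inter> Q \<inter> N \<inter> fst c" let ?\<Omega> = "snd c ` (U \<inter> V \<inter> Q \<inter> N \<inter> fst c)" let ?p = "snd c x"
  have S: "open ?S" "x \<in> ?S"
    using A B X x smooth_sectionD(1)[OF X(1)] local_trivialization_open[OF N] chart_dom_open[OF c]
    by (auto simp: smooth_vector_field_def)
  have \<Omega>: "open ?\<Omega>" "?p \<in> ?\<Omega>"
    using chart_image_open[OF c S(1)] S(2) by (simp_all add: Int_assoc)
  note A' = smooth_vector_field_subset[OF A(1) _ S(1)] and B' = smooth_vector_field_subset[OF B(1) _ S(1)]
    and X' = smooth_section_subset[OF X(1) S(1)]
  have AS: "smooth_vector_field ?S A" and BS: "smooth_vector_field ?S B" and XS: "smooth_section ?S X"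
    by (rule A' B' X'; auto)+
  let ?\<xi> = "in_chart c (\<lambda>y. \<psi> (X y))" let ?G = "christoffel c \<psi>"
  have \<xi>: "smooth_on ?\<Omega> ?\<xi>"
    using smooth_map_onD[OF smooth_section_trivial[OF XS N] c] by (simp add: Int_ac)
  have G: "smooth_on ?\<Omega> ?G"
    by (rule smooth_on_subset[OF christoffel_smooth]) auto
  have ABx: "A x \<in> tangent_space x" "B x \<in> tangent_space x"
    using A B by (auto simp: smooth_vector_field_def)
  note D\<xi> = has_derivative_fderiv[OF \<xi> \<Omega>(2)] and DG = has_derivative_fderiv[OF G \<Omega>(2)]
    and DD\<xi> = has_derivative_fderiv[OF smooth_on_fderiv[OF \<Omega>(1) \<xi>] \<Omega>(2)]
  have first: "\<psi> (nabla X y (E y)) = fderiv ?\<xi> (snd c y) (E y c) + ?G (snd c y) (E y c) (\<psi> (X y))"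
    if y: "y \<in> ?S" and E: "E y \<in> tangent_space y" for y E
  proof -
    have "snd c y \<in> ?\<Omega>" using y by auto
    then show ?thesis
      using nabla_coordinates[OF XS y _ _ E] y fderiv_apply[OF \<xi>]
      by (simp add: chart_deriv_def)
  qed
  have second: "\<psi> (nabla (\<lambda>y. nabla X y (E y)) x (F x)) =
      fderiv ?\<xi> ?p (chart_deriv c (\<lambda>y. E y c) x (F x c)) + fderiv (fderiv ?\<xi>) ?p (F x c) (E x c)
      + (?G ?p (E x c) (fderiv ?\<xi> ?p (F x c)) + (?G ?p (chart_deriv c (\<lambda>y. E y c) x (F x c))
        + fderiv ?G ?p (F x c) (E x c)) (\<psi> (X x)))
      + ?G ?p (F x c) (fderiv ?\<xi> ?p (E x c) + ?G ?p (E x c) (\<psi> (X x)))"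
    if E: "smooth_vector_field ?S E" and F: "smooth_vector_field ?S F" for E F
  proof -
    have Ex: "E x \<in> tangent_space x" "F x \<in> tangent_space x"
      using E F S(2) by (auto simp: smooth_vector_field_def)
    have Y: "smooth_section ?S (\<lambda>y. nabla X y (E y))" by (rule nabla_smooth[OF XS E])
    have Esm: "smooth_map_on ?S (\<lambda>y. E y c)"
      using E c by (auto simp: smooth_vector_field_def Int_assoc)
    have DE: "(in_chart c (\<lambda>y. E y c) has_derivative chart_deriv c (\<lambda>y. E y c) x) (at ?p)"
      by (rule in_chart_has_derivative[OF Esm S(2) cx])
    let ?\<beta> = "in_chart c (\<lambda>y. E y c)"
    have D: "((\<lambda>p. fderiv ?\<xi> p (?\<beta> p) + ?G p (?\<beta> p) (?\<xi> p)) has_derivative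
        (\<lambda>h. (fderiv ?\<xi> ?p (chart_deriv c (\<lambda>y. E y c) x h) + fderiv (fderiv ?\<xi>) ?p h (?\<beta> ?p))
          + (?G ?p (?\<beta> ?p) (fderiv ?\<xi> ?p h) + (?G ?p (chart_deriv c (\<lambda>y. E y c) x h)
            + fderiv ?G ?p h (?\<beta> ?p)) (?\<xi> ?p)))) (at ?p)"
      by (intro has_derivative_add bounded_bilinear.FDERIV[OF bounded_bilinear_blinfun_apply]
          DD\<xi> DE D\<xi> DG)
    have "(in_chart c (\<lambda>y. \<psi> (nabla X y (E y))) has_derivative
        (\<lambda>h. (fderiv ?\<xi> ?p (chart_deriv c (\<lambda>y. E y c) x h) + fderiv (fderiv ?\<xi>) ?p h (?\<beta> ?p))
          + (?G ?p (?\<beta> ?p) (fderiv ?\<xi> ?p h) + (?G ?p (chart_deriv c (\<lambda>y. E y c) x h)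
            + fderiv ?G ?p h (?\<beta> ?p)) (?\<xi> ?p)))) (at ?p)"
    proof (rule has_derivative_transform_within_open[OF D \<Omega>])
      fix p assume "p \<in> ?\<Omega>"
      then obtain y where y: "y \<in> ?S" "p = snd c y" by auto
      then have "E y \<in> tangent_space y" using E by (simp add: smooth_vector_field_def)
      from first[OF y(1), of E, OF this]
      show "fderiv ?\<xi> p (?\<beta> p) + ?G p (?\<beta> p) (?\<xi> p) = in_chart c (\<lambda>y. \<psi> (nabla X y (E y))) p"
        using y c by (simp add: in_chart_apply)
    qed
    from frechet_derivative_at[OF this]
    have "chart_deriv c (\<lambda>y. \<psi> (nabla X y (E y))) x (F x c) =
        (fderiv ?\<xi> ?p (chart_deriv c (\<lambda>y. E y c) x (F x c)) + fderiv (fderiv ?\<xi>) ?p (F x c) (?\<beta> ?p))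
          + (?G ?p (?\<beta> ?p) (fderiv ?\<xi> ?p (F x c)) + (?G ?p (chart_deriv c (\<lambda>y. E y c) x (F x c))
            + fderiv ?G ?p (F x c) (?\<beta> ?p)) (?\<xi> ?p))"
      unfolding chart_deriv_def[of c "\<lambda>y. \<psi> (nabla X y (E y))"] by (rule fun_cong[OF sym])
    then show ?thesis
      using nabla_coordinates[OF Y S(2) x Ex(2)] first[OF S(2), of E, OF Ex(1)]
        in_chart_apply[OF c x(2), of "\<lambda>y. E y c"] in_chart_apply[OF c x(2), of "\<lambda>y. \<psi> (X y)"]
      by simp
  qed
  have L: "lie_bracket A B x \<in> tangent_space x" by (rule lie_bracket_tangent[OF AS BS S(2)])
  have Lc: "lie_bracket A B x c = chart_deriv c (\<lambda>y. B y c) x (A x c) - chart_deriv c (\<lambda>y. A y c) x (B x c)"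
    using cx by (simp add: lie_bracket_def)
  have f1: "nabla (\<lambda>y. nabla X y (B y)) x (A x) \<in> fibre W x"
    by (rule nabla_fibre[OF nabla_smooth[OF XS BS] S(2) ABx(1)])
  have f2: "nabla (\<lambda>y. nabla X y (A y)) x (B x) \<in> fibre W x"
    by (rule nabla_fibre[OF nabla_smooth[OF XS AS] S(2) ABx(2)])
  have f3: "nabla X x (lie_bracket A B x) \<in> fibre W x"
    by (rule nabla_fibre[OF XS S(2) L])
  note s2 = fscale_fibre[OF f2] and s3 = fscale_fibre[OF f3]
  show "curvature_fields A B X x \<in> fibre W x"
    unfolding curvature_fields_def by (intro fadd_fibre f1 s2 s3)
  have "\<psi> (curvature_fields A B X x) = \<psi> (nabla (\<lambda>y. nabla X y (B y)) x (A x))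
      - \<psi> (nabla (\<lambda>y. nabla X y (A y)) x (B x)) - \<psi> (nabla X x (lie_bracket A B x))"
    unfolding curvature_fields_def
    by (simp add: triv_add[OF N x(1) f1 fadd_fibre[OF s2 s3]]
        triv_add[OF N x(1) s2 s3] triv_scale[OF N x(1) f2]
        triv_scale[OF N x(1) f3])
  also have "\<dots> = curvature_form ?p (A x c) (B x c) (\<psi> (X x))"
    unfolding second[OF BS AS] second[OF AS BS] first[OF S(2), of "lie_bracket A B", OF L] Lc
      curvature_form_def
    using fderiv_fderiv_symmetric[OF \<Omega>(1) \<xi> \<Omega>(2), of "A x c" "B x c"]
    by (simp add: blinfun.bilinear_simps)
  finally show "\<psi> (curvature_fields A B X x) = curvature_form ?p (A x c) (B x c) (\<psi> (X x))" .
qed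

lemma curvature_fields_unique:
  assumes A: "smooth_vector_field U A" "x \<in> U" and B: "smooth_vector_field V B" "x \<in> V"
    and X: "smooth_section Q X" "x \<in> Q" and x: "x \<in> N" "x \<in> fst c"
    and A': "smooth_vector_field U' A'" "x \<in> U'" and B': "smooth_vector_field V' B'" "x \<in> V'"
    and X': "smooth_section Q' X'" "x \<in> Q'" and eq: "A x = A' x" "B x = B' x" "X x = X' x"
  shows "curvature_fields A B X x = curvature_fields A' B' X' x"
  by (rule triv_inj[OF N x(1) curvature_fields_coordinates(1)[OF A B X x]
        curvature_fields_coordinates(1)[OF A' B' X' x]])
    (simp add: curvature_fields_coordinates(2)[OF A B X x]
      curvature_fields_coordinates(2)[OF A' B' X' x] eq)

text \<open>Coordinate vector fields and constant sections of the trivialization are admissible extensions, and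
  by tensoriality all extensions give the same value; so the definite description denotes it.\<close>

lemma curvature_coordinates:
  assumes x: "x \<in> N" "x \<in> fst c" and u: "u \<in> tangent_space x" and v: "v \<in> tangent_space x"
    and w: "w \<in> fibre W x"
  shows "curvature u v w \<in> fibre W x"
    and "\<psi> (curvature u v w) = curvature_form (snd c x) (u c) (v c) (\<psi> w)"
proof -
  have cx: "c \<in> charts_at x" using c x by (simp add: charts_at_def)
  have pr: "proj W w = x" using w by (simp add: fibre_def)
  let ?A = "\<lambda>y. coord_tangent c y (u c)" and ?B = "\<lambda>y. coord_tangent c y (v c)"
    and ?X = "\<lambda>y. lift \<psi> y (\<psi> w)" and ?D = "fst c \<inter> N"
  have D: "open ?D" "x \<in> ?D"
    using local_trivialization_open[OF N] chart_dom_open[OF c] x by auto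
  have A: "smooth_vector_field ?D ?A" and B: "smooth_vector_field ?D ?B"
    by (rule smooth_vector_field_subset[OF coord_vector_field[OF c] _ D(1)]; simp)+
  have X: "smooth_section ?D ?X"
    by (rule smooth_section_subset[OF frame_section D(1)]) simp
  have eq: "?A x = u" "?B x = v" "?X x = w"
    by (simp_all add: coord_tangent_eq[OF u cx] coord_tangent_eq[OF v cx] lift_triv[OF N x(1) w])
  have "section_through UNIV w ?D ?X"
    using X D(2) eq(3) pr by (simp add: section_through_def)
  note thr = this
  have "curvature u v w = curvature_fields ?A ?B ?X x"
    unfolding curvature_def
  proof (rule the_equality)
    show "\<exists>U A B X. smooth_vector_field U A \<and> A (proj W w) = u \<and>
     smooth_vector_field U B \<and> B (proj W w) = v \<and> section_through UNIV w U X \<and>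
     curvature_fields ?A ?B ?X x = curvature_fields A B X (proj W w)"
      using A B eq(1,2) thr pr by blast
  next
    fix r assume "\<exists>U A B X. smooth_vector_field U A \<and> A (proj W w) = u \<and>
     smooth_vector_field U B \<and> B (proj W w) = v \<and> section_through UNIV w U X \<and>
     r = curvature_fields A B X (proj W w)"
    then obtain U A' B' X' where *: "smooth_vector_field U A'" "A' x = u" "smooth_vector_field U B'"
        "B' x = v" "section_through UNIV w U X'" and r: "r = curvature_fields A' B' X' x"
      unfolding pr by blast
    note X' = section_throughD[OF *(5), unfolded pr]
    show "r = curvature_fields ?A ?B ?X x"
      unfolding r
      by (rule curvature_fields_unique[OF *(1) X'(3) *(3) X'(3) X'(1,3) x A D(2) B D(2) X D(2)])
        (use * X'(4) eq in simp_all)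
  qed
  then show "curvature u v w \<in> fibre W x"
    and "\<psi> (curvature u v w) = curvature_form (snd c x) (u c) (v c) (\<psi> w)"
    using curvature_fields_coordinates[OF A D(2) B D(2) X D(2) x] eq by simp_all
qed

lemma curvature_kernel_iff:
  assumes x: "x \<in> N" "x \<in> fst c" and w: "w \<in> fibre W x"
  shows "w \<in> curvature_kernel \<longleftrightarrow> (\<forall>u v. curvature_form (snd c x) u v (\<psi> w) = 0)"
proof -
  have cx: "c \<in> charts_at x" using c x by (simp add: charts_at_def)
  have pr: "proj W w = x" using w by (simp add: fibre_def)
  have 1: "curvature u v w = fzero W x \<longleftrightarrow> curvature_form (snd c x) (u c) (v c) (\<psi> w) = 0"
    if "u \<in> tangent_space x" "v \<in> tangent_space x" for u v
    using curvature_coordinates[OF x that w] triv_zero[OF N x(1)]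
      triv_inj[OF N x(1) _ fzero_fibre] by metis
  show ?thesis
  proof
    assume "w \<in> curvature_kernel"
    then have "curvature (coord_tangent c x u) (coord_tangent c x v) w = fzero W x" for u v
      using coord_tangent_in[OF cx] by (simp add: curvature_kernel_def pr)
    then show "\<forall>u v. curvature_form (snd c x) u v (\<psi> w) = 0"
      using 1[OF coord_tangent_in[OF cx] coord_tangent_in[OF cx]] by (simp add: coord_tangent_self[OF cx])
  next
    assume "\<forall>u v. curvature_form (snd c x) u v (\<psi> w) = 0"
    then show "w \<in> curvature_kernel" using 1 by (simp add: curvature_kernel_def pr)
  qed
qed

lemma curvature_form_continuous:
  "continuous_on (snd c ` (N \<inter> fst c)) (\<lambda>p. curvature_form p u v a)"
proof -
  have o: "open (snd c ` (N \<inter> fst c))" by (rule chart_image_open[OF c local_trivialization_open[OF N]])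
  show ?thesis unfolding curvature_form_def
    by (intro continuous_intros smooth_on_imp_continuous_on[OF o] christoffel_smooth smooth_on_fderiv[OF o])
qed

lemma curvature_form_linear: "linear (curvature_form p u v)"
  by (rule linearI) (simp_all add: curvature_form_def blinfun.bilinear_simps algebra_simps)

end

lemma fibrewise_subspace_curvature_kernel: "fibrewise_subspace curvature_kernel"
proof (rule fibrewise_subspaceI)
  fix x v w and r :: real
  obtain N \<psi> where N: "x \<in> N" "local_trivialization N \<psi>" using ex_local_trivialization by blast
  obtain c where "c \<in> charts_at x" using ex_chart by blast
  then have c: "c \<in> atlas" "x \<in> fst c" by (rule charts_atD)+
  note iff = curvature_kernel_iff[OF c(1) N(2,1) c(2)]
    and lin = curvature_form_linear[OF c(1) N(2)]
  show "fzero W x \<in> curvature_kernel"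
    by (simp add: iff[OF fzero_fibre] triv_zero[OF N(2,1)] linear_0[OF lin])
  assume w: "w \<in> curvature_kernel" "w \<in> fibre W x"
  then show "fscale W r w \<in> curvature_kernel"
    by (simp add: iff[OF fscale_fibre] iff triv_scale[OF N(2,1)] linear_cmul[OF lin])
  assume v: "v \<in> curvature_kernel" "v \<in> fibre W x"
  then show "fadd W v w \<in> curvature_kernel"
    using w by (simp add: iff[OF fadd_fibre] iff triv_add[OF N(2,1)] linear_add[OF lin])
qed

end

section \<open>Ranks of families of subspaces\<close>

lemma difference_quotient_tendsto:
  fixes f :: "'a::real_normed_vector \<Rightarrow> 'b::real_normed_vector"
  assumes "(f has_derivative D) (at p)"
  shows "((\<lambda>t. (f (p + t *\<^sub>R v) - f p) /\<^sub>R t) \<longlongrightarrow> D v) (at 0)"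
proof -
  have "((\<lambda>t. f (p + t *\<^sub>R v)) has_derivative (\<lambda>t. D (t *\<^sub>R v))) (at 0)"
    by (rule has_derivative_compose[of "\<lambda>t. p + t *\<^sub>R v" "\<lambda>t. t *\<^sub>R v"])
      (use assms in \<open>auto intro!: derivative_eq_intros\<close>)
  then have lim: "(\<lambda>t. norm (f (p + t *\<^sub>R v) - f p - D (t *\<^sub>R v)) / norm t) \<midarrow>0\<rightarrow> 0"
    unfolding has_derivative_at by simp
  have eq: "norm (f (p + t *\<^sub>R v) - f p - D (t *\<^sub>R v)) / norm t
      = norm ((f (p + t *\<^sub>R v) - f p) /\<^sub>R t - D v)" if "t \<noteq> 0" for t
  proof -
    have "(f (p + t *\<^sub>R v) - f p) /\<^sub>R t - D v = (f (p + t *\<^sub>R v) - f p - D (t *\<^sub>R v)) /\<^sub>R t"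
      using that by (simp add: linear_cmul[OF has_derivative_linear[OF assms]] algebra_simps)
    then show ?thesis by (simp add: divide_inverse mult.commute)
  qed
  have "(\<lambda>t. norm ((f (p + t *\<^sub>R v) - f p) /\<^sub>R t - D v)) \<midarrow>0\<rightarrow> 0"
    by (rule Lim_transform_eventually[OF lim]) (use eq in \<open>auto simp: eventually_at_filter\<close>)
  then show ?thesis by (rule LIM_zero_cancel[OF tendsto_norm_zero_cancel])
qed

text \<open>A basis of one subspace, moved continuously within the family \<open>E\<close>, remains independent. Rank is thus
  lower semicontinuous, and limits of vectors from subspaces of constant rank do not enlarge the
  limit subspace.\<close>

lemma independent_near_card_le_dim:
  fixes B :: "'f::fin_dim_inner set"
  assumes B: "independent B" and g: "\<And>b. b \<in> B \<Longrightarrow> (g b \<longlongrightarrow> b) F"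
    and E: "\<And>b. b \<in> B \<Longrightarrow> \<forall>\<^sub>F y in F. g b y \<in> E y"
  shows "\<forall>\<^sub>F y in F. card B \<le> dim (E y)"
proof -
  have fin: "finite B" by (rule fd_finiteI_independent[OF B])
  obtain e where e: "e > 0" "\<And>h. (\<forall>b\<in>B. dist (h b) b < e) \<Longrightarrow> inj_on h B \<and> independent (h ` B)"
    using independent_open[OF B] by blast
  have "\<forall>\<^sub>F y in F. \<forall>b\<in>B. dist (g b y) b < e \<and> g b y \<in> E y"
    using fin g E e(1) by (auto simp: eventually_ball_finite_distrib tendsto_iff intro!: eventually_conj)
  then show ?thesis
  proof eventually_elim
    case (elim y)
    have "inj_on (\<lambda>b. g b y) B \<and> independent ((\<lambda>b. g b y) ` B)"
      by (rule e(2)) (use elim in blast)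
    then have "card B = card ((\<lambda>b. g b y) ` B)" "independent ((\<lambda>b. g b y) ` B)"
      by (simp_all add: card_image)
    moreover have "(\<lambda>b. g b y) ` B \<subseteq> E y" using elim by blast
    ultimately show ?case using fd_independent_card_le_dim by metis
  qed
qed

lemma (in smooth_manifold) smooth_map_on_tendsto:
  assumes U: "open U" "x \<in> U" and f: "smooth_map_on U f"
  shows "(f \<longlongrightarrow> f x) (nhds x)"
proof -
  obtain c where cx: "c \<in> charts_at x" using ex_chart by blast
  note c = charts_atD[OF cx]
  have o: "open (U \<inter> fst c)" using U chart_dom_open[OF c(1)] by auto
  have "continuous_on (fst c) (snd c)"
    using atlas_homeo[of "fst c" "snd c"] c by (simp add: homeomorphism_cont1)
  then have "continuous_on (U \<inter> fst c) (snd c)" by (rule continuous_on_subset) simp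
  moreover have "continuous_on (snd c ` (U \<inter> fst c)) (in_chart c f)"
    by (rule smooth_on_imp_continuous_on[OF chart_image_open[OF c(1) U(1)] smooth_map_onD[OF f c(1)]])
  ultimately have "continuous_on (U \<inter> fst c) (\<lambda>y. in_chart c f (snd c y))"
    by (intro continuous_on_compose2[where f="snd c" and g="in_chart c f"]) auto
  then have "continuous_on (U \<inter> fst c) f"
    by (rule continuous_on_eq) (simp add: in_chart_apply[OF c(1)])
  then have "f \<midarrow>x\<rightarrow> f x" using o U c by (simp add: continuous_on_eq_continuous_at isCont_def)
  then show ?thesis by (simp add: tendsto_at_iff_tendsto_nhds)
qed

context linear_connection
begin

lemma fibre_vector_extends:
  assumes N: "local_trivialization N \<psi>" "x \<in> N"
    and S: "\<And>w. w \<in> S \<Longrightarrow> \<exists>V X. section_through S w V X"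
    and b: "b \<in> \<psi> ` (S \<inter> fibre W x)"
  shows "\<exists>g. (g \<longlongrightarrow> b) (nhds x) \<and> (\<forall>\<^sub>F y in nhds x. g y \<in> \<psi> ` (S \<inter> fibre W y))"
proof -
  obtain w where w: "w \<in> S" "w \<in> fibre W x" "b = \<psi> w" using b by auto
  obtain V X where X: "section_through S w V X" using S[OF w(1)] by blast
  note X = section_throughD[OF X]
  have pr: "proj W w = x" using w by (simp add: fibre_def)
  have V: "open (V \<inter> N)" "x \<in> V \<inter> N"
    using smooth_sectionD(1)[OF X(1)] local_trivialization_open[OF N(1)] X(3) N(2) pr by auto
  have "((\<lambda>y. \<psi> (X y)) \<longlongrightarrow> \<psi> (X x)) (nhds x)"
    by (rule smooth_map_on_tendsto[OF V smooth_section_trivial[OF X(1) N(1)]])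
  moreover have "\<forall>\<^sub>F y in nhds x. \<psi> (X y) \<in> \<psi> ` (S \<inter> fibre W y)"
    using V X(2) smooth_sectionD(2)[OF X(1)] by (auto simp: eventually_nhds)
  ultimately show ?thesis using X(4) w(3) pr by auto
qed

lemma rank_lower_semicontinuous:
  assumes N: "local_trivialization N \<psi>" "x \<in> N"
    and S: "\<And>w. w \<in> S \<Longrightarrow> \<exists>V X. section_through S w V X"
  shows "\<forall>\<^sub>F y in nhds x. dim (\<psi> ` (S \<inter> fibre W x)) \<le> dim (\<psi> ` (S \<inter> fibre W y))"
proof -
  obtain B where B: "B \<subseteq> \<psi> ` (S \<inter> fibre W x)" "independent B" "card B = dim (\<psi> ` (S \<inter> fibre W x))"
    using basis_exists by metis
  have "\<exists>g. \<forall>b\<in>B. (g b \<longlongrightarrow> b) (nhds x) \<and> (\<forall>\<^sub>F y in nhds x. g b y \<in> \<psi> ` (S \<inter> fibre W y))"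
    by (rule bchoice) (use fibre_vector_extends[OF N S] B(1) in blast)
  then obtain g where "\<And>b. b \<in> B \<Longrightarrow> (g b \<longlongrightarrow> b) (nhds x)"
    "\<And>b. b \<in> B \<Longrightarrow> \<forall>\<^sub>F y in nhds x. g b y \<in> \<psi> ` (S \<inter> fibre W y)" by blast
  from independent_near_card_le_dim[OF B(2) this] show ?thesis by (simp add: B(3))
qed

text \<open>It suffices to compare \<open>Y\<close> with the section \<open>X\<close> that has the same value at \<open>x\<close> and a derivative in \<open>S\<close>.
  Since \<open>Y - X\<close> vanishes at \<open>x\<close>, its covariant derivative at \<open>x\<close> is the ordinary derivative \<open>u\<close> of its
  local representation \<open>\<zeta>\<close>, a limit of multiples of values of \<open>\<zeta>\<close>. If \<open>u\<close> were not in the fibre of \<open>S\<close>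
  over \<open>x\<close>, then a basis of this fibre together with \<open>u\<close> would move to too many independent vectors in
  neighbouring fibres.\<close>

lemma nabla_closed_if_constant_rank:
  assumes S: "fibrewise_subspace S" and N: "local_trivialization N \<psi>" and U: "open U" "U \<subseteq> N"
    and rank: "\<And>y. y \<in> U \<Longrightarrow> dim (\<psi> ` (S \<inter> fibre W y)) = m"
    and thr: "\<And>w. w \<in> S \<Longrightarrow> \<exists>V X. section_through S w V X"
    and closed: "\<And>w. w \<in> S \<Longrightarrow> proj W w \<in> U \<Longrightarrow>
      \<exists>V X. section_through S w V X \<and> (\<forall>v\<in>tangent_space (proj W w). nabla X (proj W w) v \<in> S)"
    and Y: "smooth_section V Y" "\<And>y. y \<in> V \<Longrightarrow> Y y \<in> S"
    and x: "x \<in> V" "x \<in> U" and v: "v \<in> tangent_space x"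
  shows "nabla Y x v \<in> S"
proof -
  have xN: "x \<in> N" using x U by auto
  obtain c where cx: "c \<in> charts_at x" using ex_chart by blast
  note c = charts_atD[OF cx]
  have Yx: "Y x \<in> fibre W x" by (rule smooth_sectionD(2)[OF Y(1) x(1)])
  have pr: "proj W (Y x) = x" using Yx by (simp add: fibre_def)
  obtain V' X where "section_through S (Y x) V' X" and nX: "nabla X x v \<in> S"
    using closed[OF Y(2)[OF x(1)]] x(2) v unfolding pr by blast
  note X = section_throughD[OF this(1), unfolded pr]
  have nXf: "nabla X x v \<in> fibre W x" and nYf: "nabla Y x v \<in> fibre W x"
    by (rule nabla_fibre[OF X(1,3) v], rule nabla_fibre[OF Y(1) x(1) v])
  define E where "E y = \<psi> ` (S \<inter> fibre W y)" for y
  have subE: "subspace (E y)" if "y \<in> N" for y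
    unfolding E_def by (rule subspace_image[OF S N that])
  let ?p = "snd c x"
  define \<zeta> where "\<zeta> q = in_chart c (\<lambda>y. \<psi> (Y y)) q - in_chart c (\<lambda>y. \<psi> (X y)) q" for q
  define u where "u = chart_deriv c (\<lambda>y. \<psi> (Y y)) x (v c) - chart_deriv c (\<lambda>y. \<psi> (X y)) x (v c)"
  have "(\<zeta> has_derivative (\<lambda>h. chart_deriv c (\<lambda>y. \<psi> (Y y)) x h - chart_deriv c (\<lambda>y. \<psi> (X y)) x h)) (at ?p)"
    unfolding \<zeta>_def[abs_def]
    by (intro has_derivative_diff in_chart_has_derivative[OF smooth_section_trivial[OF Y(1) N] _ cx]
        in_chart_has_derivative[OF smooth_section_trivial[OF X(1) N] _ cx]) (use x X xN in auto)
  from difference_quotient_tendsto[OF this, of "v c"]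
  have quot: "((\<lambda>t. \<zeta> (?p + t *\<^sub>R v c) /\<^sub>R t) \<longlongrightarrow> u) (at 0)"
    using X(4) c by (simp add: u_def \<zeta>_def in_chart_apply)
  have u: "\<psi> (nabla Y x v) = \<psi> (nabla X x v) + u"
    using nabla_coordinates[OF c(1) N Y(1) x(1) xN c(2) v] nabla_coordinates[OF c(1) N X(1,3) xN c(2) v] X(4)
    by (simp add: u_def)
  \<comment> \<open>The coordinate line through \<open>x\<close> in the direction \<open>v\<close>.\<close>
  let ?\<gamma> = "\<lambda>t. inv_into (fst c) (snd c) (?p + t *\<^sub>R v c)"
  define D where "D = U \<inter> V \<inter> V' \<inter> fst c"
  have D: "open D" "x \<in> D"
    using U smooth_sectionD(1)[OF Y(1)] smooth_sectionD(1)[OF X(1)] chart_dom_open[OF c(1)] x X(3) c(2)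
    by (auto simp: D_def)
  have \<gamma>D: "\<forall>\<^sub>F t in at 0. ?p + t *\<^sub>R v c \<in> snd c ` A" if A: "open A" "x \<in> A" "A \<subseteq> fst c" for A
  proof -
    have "((\<lambda>t. ?p + t *\<^sub>R v c) \<longlongrightarrow> ?p + 0 *\<^sub>R v c) (at 0)" by (intro tendsto_intros)
    then have lim: "((\<lambda>t. ?p + t *\<^sub>R v c) \<longlongrightarrow> ?p) (at 0)" by simp
    have "open (snd c ` A)" using chart_image_open[OF c(1) A(1)] A(3) by (simp add: Int_absorb2)
    moreover have "?p \<in> snd c ` A" using A(2) by blast
    ultimately show ?thesis by (rule topological_tendstoD[OF lim])
  qed
  have \<gamma>: "(?\<gamma> \<longlongrightarrow> x) (at 0)"
  proof (rule topological_tendstoI)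
    fix A assume A: "open A" "x \<in> A"
    have "\<forall>\<^sub>F t in at 0. ?p + t *\<^sub>R v c \<in> snd c ` (A \<inter> fst c)"
      using A c by (intro \<gamma>D open_Int chart_dom_open) auto
    then show "\<forall>\<^sub>F t in at 0. ?\<gamma> t \<in> A"
      by (rule eventually_mono) (use chart_inverse[OF c(1)] in auto)
  qed
  have \<gamma>_in_D: "\<forall>\<^sub>F t in at 0. ?\<gamma> t \<in> D" by (rule topological_tendstoD[OF \<gamma> D])
  have \<zeta>E: "\<forall>\<^sub>F t in at 0. \<zeta> (?p + t *\<^sub>R v c) /\<^sub>R t \<in> E (?\<gamma> t)"
  proof (rule eventually_mono[OF \<gamma>D[OF D]])
    fix t assume "?p + t *\<^sub>R v c \<in> snd c ` D"
    then obtain y where y: "y \<in> D" "?p + t *\<^sub>R v c = snd c y" by auto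
    have yc: "y \<in> fst c" and yN: "y \<in> N" using y U by (auto simp: D_def)
    have "\<psi> (Y y) \<in> E y" "\<psi> (X y) \<in> E y"
      using y Y(2) X(2) smooth_sectionD(2)[OF Y(1)] smooth_sectionD(2)[OF X(1)]
      by (auto simp: E_def D_def)
    then have "(\<psi> (Y y) - \<psi> (X y)) /\<^sub>R t \<in> E y"
      by (intro subspace_scale subspace_diff subE yN)
    then show "\<zeta> (?p + t *\<^sub>R v c) /\<^sub>R t \<in> E (?\<gamma> t)"
      by (simp add: y(2) \<zeta>_def in_chart_apply[OF c(1) yc] chart_inverse[OF c(1) yc])
  qed (auto simp: D_def)
  have "u \<in> E x"
  proof (rule ccontr)
    assume nu: "u \<notin> E x"
    obtain B where B: "B \<subseteq> E x" "independent B" "E x \<subseteq> span B" "card B = dim (E x)"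
      using basis_exists by metis
    have "span B \<subseteq> E x" by (rule span_minimal[OF B(1) subE[OF xN]])
    then have ind: "independent (insert u B)" using B(2) nu by (intro independent_insertI) auto
    have uB: "u \<notin> B" using nu B(1) by auto
    have "\<exists>g. \<forall>b\<in>B. (g b \<longlongrightarrow> b) (nhds x) \<and> (\<forall>\<^sub>F y in nhds x. g b y \<in> \<psi> ` (S \<inter> fibre W y))"
      by (rule bchoice) (use fibre_vector_extends[OF N xN thr] B(1) in \<open>auto simp: E_def\<close>)
    then obtain g where g: "\<And>b. b \<in> B \<Longrightarrow> (g b \<longlongrightarrow> b) (nhds x)"
      "\<And>b. b \<in> B \<Longrightarrow> \<forall>\<^sub>F y in nhds x. g b y \<in> E y" unfolding E_def by blast
    define h where "h b t = (if b = u then \<zeta> (?p + t *\<^sub>R v c) /\<^sub>R t else g b (?\<gamma> t))" for b t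
    have "\<forall>\<^sub>F t in at 0. card (insert u B) \<le> dim (E (?\<gamma> t))"
    proof (rule independent_near_card_le_dim[OF ind])
      fix b assume b: "b \<in> insert u B"
      show "(h b \<longlongrightarrow> b) (at 0)"
        using quot filterlim_compose[OF g(1) \<gamma>] b uB unfolding h_def[abs_def] by (cases "b = u") auto
      show "\<forall>\<^sub>F t in at 0. h b t \<in> E (?\<gamma> t)"
        using \<zeta>E eventually_compose_filterlim[OF g(2) \<gamma>] b uB unfolding h_def[abs_def] by (cases "b = u") auto
    qed
    with \<gamma>_in_D have "\<forall>\<^sub>F t in at (0::real). False"
    proof eventually_elim
      case (elim t)
      have "?\<gamma> t \<in> U" using elim(1) by (simp add: D_def)
      then have "dim (E (?\<gamma> t)) = m" "card B = m" using rank x(2) B(4) by (simp_all add: E_def)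
      moreover have "card (insert u B) = Suc (card B)"
        using uB fd_finiteI_independent[OF B(2)] by simp
      ultimately show ?case using elim(2) by simp
    qed
    then show False by simp
  qed
  moreover have "\<psi> (nabla X x v) \<in> E x" using nX nXf by (simp add: E_def)
  ultimately have "\<psi> (nabla Y x v) \<in> E x" unfolding u by (intro subspace_add subE xN)
  then show ?thesis using triv_mem_image_iff[OF N xN nYf] by (simp add: E_def)
qed


section \<open>The derived flag\<close>

lemma second_fundamental_kernel_iff:
  assumes S: "fibrewise_subspace S" and w: "w \<in> fibre W x"
  shows "w \<in> second_fundamental_kernel S \<longleftrightarrow>
    w \<in> S \<and> (\<exists>U X. section_through S w U X \<and> (\<forall>v\<in>tangent_space x. nabla X x v \<in> S))"
proof -
  have pr: "proj W w = x" using w by (simp add: fibre_def)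
  have "fibre_class S (nabla X x v) = fibre_class S (fzero W x) \<longleftrightarrow> nabla X x v \<in> S"
    if "section_through S w U X" "v \<in> tangent_space x" for U X v
    using section_throughD[OF that(1)] that(2) pr
    by (intro fibre_class_eq_zero_iff[OF S] nabla_fibre) auto
  note class_iff = this
  show ?thesis
  proof
    assume "w \<in> second_fundamental_kernel S"
    then obtain U X where "w \<in> S" "section_through S w U X"
      "\<forall>v\<in>tangent_space x. fibre_class S (nabla X x v) = fibre_class S (fzero W x)"
      unfolding second_fundamental_kernel_def second_fundamental_form_def by (auto simp: pr)
    then show "w \<in> S \<and> (\<exists>U X. section_through S w U X \<and> (\<forall>v\<in>tangent_space x. nabla X x v \<in> S))"
      using class_iff by blast
  next
    assume "w \<in> S \<and> (\<exists>U X. section_through S w U X \<and> (\<forall>v\<in>tangent_space x. nabla X x v \<in> S))"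
    then obtain U X where wS: "w \<in> S" and X: "section_through S w U X"
      and n: "\<forall>v\<in>tangent_space x. nabla X x v \<in> S" by blast
    have "(\<lambda>v. fibre_class S (nabla X x v)) \<in> second_fundamental_form S w"
      unfolding second_fundamental_form_def pr using X by blast
    moreover have "\<forall>v\<in>tangent_space x. fibre_class S (nabla X x v) = fibre_class S (fzero W x)"
      using class_iff[OF X] n by blast
    ultimately have "\<exists>\<alpha>\<in>second_fundamental_form S w.
        \<forall>v\<in>tangent_space x. \<alpha> v = fibre_class S (fzero W x)"
      by (intro bexI[where x="\<lambda>v. fibre_class S (nabla X x v)"])
    then show "w \<in> second_fundamental_kernel S"
      by (simp add: second_fundamental_kernel_def wS pr)
  qed
qed

lemma fibrewise_subspace_second_fundamental_kernel:
  assumes S: "fibrewise_subspace S"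
  shows "fibrewise_subspace (second_fundamental_kernel S)"
proof (rule fibrewise_subspaceI)
  fix x v w and r :: real
  note iff = second_fundamental_kernel_iff[OF S]
  show "fzero W x \<in> second_fundamental_kernel S"
    unfolding iff[OF fzero_fibre]
  proof (intro conjI exI ballI)
    show "section_through S (fzero W x) UNIV (fzero W)" by (rule section_through_fzero[OF S])
  qed (simp_all add: nabla_fzero fibrewise_subspaceD(1)[OF S])
  assume w: "w \<in> second_fundamental_kernel S" "w \<in> fibre W x"
  have prw: "proj W w = x" using w by (simp add: fibre_def)
  obtain U X where wS: "w \<in> S" and X: "section_through S w U X"
    "\<And>t. t \<in> tangent_space x \<Longrightarrow> nabla X x t \<in> S" using w by (auto simp: iff)
  note XD = section_throughD[OF X(1), unfolded prw]
  have U: "open U" by (rule smooth_sectionD(1)[OF XD(1)])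
  show "fscale W r w \<in> second_fundamental_kernel S"
    unfolding iff[OF fscale_fibre[OF w(2)]]
  proof (intro conjI exI ballI)
    show "fscale W r w \<in> S" by (rule fibrewise_subspaceD(3)[OF S wS w(2)])
    show "section_through S (fscale W r w) U (\<lambda>y. fscale W r (X y))"
      by (rule section_through_fscale[OF S X(1) w(2)])
    fix t assume t: "t \<in> tangent_space x"
    have nf: "nabla X x t \<in> fibre W x" by (rule nabla_fibre[OF XD(1,3) t])
    have "nabla (\<lambda>y. fscale W r (X y)) x t =
        fadd W (fscale W r (nabla X x t)) (fscale W (differential (\<lambda>y. r) x t) (X x))"
      by (rule nabla_Leibniz[OF smooth_map_on_const[OF U] XD(1,3) t])
    also have "\<dots> \<in> S"
      using fibrewise_subspaceD(3)[OF S X(2)[OF t] nf] fibrewise_subspaceD(3)[OF S wS w(2)] XD(4)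
        fscale_fibre[OF nf] fscale_fibre[OF w(2)]
      by (intro fibrewise_subspaceD(2)[OF S, where x=x]) auto
    finally show "nabla (\<lambda>y. fscale W r (X y)) x t \<in> S" .
  qed
  assume v: "v \<in> second_fundamental_kernel S" "v \<in> fibre W x"
  have prv: "proj W v = x" using v by (simp add: fibre_def)
  obtain U' Y where vS: "v \<in> S" and Y: "section_through S v U' Y"
    "\<And>t. t \<in> tangent_space x \<Longrightarrow> nabla Y x t \<in> S" using v by (auto simp: iff)
  note YD = section_throughD[OF Y(1), unfolded prv]
  show "fadd W v w \<in> second_fundamental_kernel S"
    unfolding iff[OF fadd_fibre[OF v(2) w(2)]]
  proof (intro conjI exI ballI)
    show "fadd W v w \<in> S" by (rule fibrewise_subspaceD(2)[OF S vS wS v(2) w(2)])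
    show "section_through S (fadd W v w) (U' \<inter> U) (\<lambda>y. fadd W (Y y) (X y))"
      by (rule section_through_fadd[OF S Y(1) X(1) v(2) w(2)])
    fix t assume t: "t \<in> tangent_space x"
    have o: "open (U' \<inter> U)" using U smooth_sectionD(1)[OF YD(1)] by auto
    have "nabla (\<lambda>y. fadd W (Y y) (X y)) x t = fadd W (nabla Y x t) (nabla X x t)"
      using smooth_section_subset[OF YD(1) o] smooth_section_subset[OF XD(1) o] XD(3) YD(3)
      by (intro nabla_add[OF _ _ _ t, where U="U' \<inter> U"]) auto
    also have "\<dots> \<in> S"
      by (rule fibrewise_subspaceD(2)[OF S Y(2)[OF t] X(2)[OF t] nabla_fibre[OF YD(1,3) t]
            nabla_fibre[OF XD(1,3) t]])
    finally show "nabla (\<lambda>y. fadd W (Y y) (X y)) x t \<in> S" .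
  qed
qed

lemma fibrewise_subspace_flag_V: "fibrewise_subspace (flag_V i)"
  by (induction i)
    (simp_all add: fibrewise_subspace_curvature_kernel fibrewise_subspace_second_fundamental_kernel
      fibrewise_subspace_section_part)

lemma fibrewise_subspace_flag_W: "fibrewise_subspace (flag_W i)"
  unfolding flag_W_def by (rule fibrewise_subspace_section_part[OF fibrewise_subspace_flag_V])

lemma flag_V_Suc: "flag_V (Suc i) = second_fundamental_kernel (flag_W i)"
  by (simp add: flag_W_def)

lemma flag_W_subset_V: "flag_W i \<subseteq> flag_V i"
  by (simp add: flag_W_def section_part_subset)

lemma flag_W_decreasing: "i \<le> j \<Longrightarrow> flag_W j \<subseteq> flag_W i"
proof (induction j rule: dec_induct)
  case (step j)
  have "flag_W (Suc j) \<subseteq> flag_V (Suc j)" by (rule flag_W_subset_V)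
  also have "\<dots> \<subseteq> flag_W j" unfolding flag_V_Suc second_fundamental_kernel_def by auto
  finally show ?case using step by auto
qed simp

lemma flag_W_subset_curvature_kernel: "flag_W i \<subseteq> curvature_kernel"
  using flag_W_decreasing[of 0 i] flag_W_subset_V[of 0] by auto

lemma flag_W_section: "w \<in> flag_W i \<Longrightarrow> \<exists>U X. section_through (flag_W i) w U X"
  unfolding flag_W_def by (rule section_part_section)

lemma flag_W_Suc_closed:
  assumes "w \<in> flag_W (Suc i)"
  shows "\<exists>V X. section_through (flag_W i) w V X \<and>
    (\<forall>v\<in>tangent_space (proj W w). nabla X (proj W w) v \<in> flag_W i)"
proof -
  have "w \<in> second_fundamental_kernel (flag_W i)"
    using assms flag_W_subset_V[of "Suc i"] unfolding flag_V_Suc by blast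
  then show ?thesis
    using second_fundamental_kernel_iff[OF fibrewise_subspace_flag_W, of w "proj W w" i]
    by (simp add: fibre_def)
qed

text \<open>A section of \<open>W\<^sup>(\<^sup>i\<^sup>)\<close> with derivatives in \<open>W\<^sup>(\<^sup>i\<^sup>)\<close> is itself the section that has to exist through each of
  its values.\<close>

lemma section_in_flag_W_Suc:
  assumes X: "smooth_section U X" and W: "\<And>y. y \<in> U \<Longrightarrow> X y \<in> flag_W i"
    and closed: "\<And>y v. y \<in> U \<Longrightarrow> v \<in> tangent_space y \<Longrightarrow> nabla X y v \<in> flag_W i"
    and y: "y \<in> U"
  shows "X y \<in> flag_W (Suc i)"
proof -
  have "X y \<in> flag_V (Suc i)" if y: "y \<in> U" for y
    unfolding flag_V_Suc
    by (subst second_fundamental_kernel_iff[OF fibrewise_subspace_flag_W smooth_sectionD(2)[OF X y]])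
      (use W y closed section_values_in_section_part(2)[OF X W y] in blast)
  then show ?thesis unfolding flag_W_def by (rule section_values_in_section_part(1)[OF X _ y])
qed

text \<open>For the curvature, the given section serves as its own extension; with coordinate fields \<open>A\<close>, \<open>B\<close>,
  the expressions \<open>\<nabla>\<^sub>B X\<close>, \<open>\<nabla>\<^sub>A X\<close> and \<open>\<nabla>\<^bsub>[A,B]\<^esub> X\<close> are all \<open>0\<close>.\<close>

lemma parallel_in_flag_W:
  assumes X: "parallel_section U X"
  shows "y \<in> U \<Longrightarrow> X y \<in> flag_W i"
proof -
  have s: "smooth_section U X" and par: "\<And>y v. y \<in> U \<Longrightarrow> v \<in> tangent_space y \<Longrightarrow> nabla X y v = fzero W y"
    using X by (auto simp: parallel_section_def)
  note U = smooth_sectionD(1)[OF s]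
  have ker: "X y \<in> flag_V 0" if y: "y \<in> U" for y
  proof -
    obtain N \<psi> where N: "y \<in> N" "local_trivialization N \<psi>" using ex_local_trivialization by blast
    obtain c where cy: "c \<in> charts_at y" using ex_chart by blast
    note c = charts_atD[OF cy]
    have "curvature_form c \<psi> (snd c y) u v (\<psi> (X y)) = 0" for u v
    proof -
      let ?A = "\<lambda>u y. coord_tangent c y u" and ?D = "fst c \<inter> U"
      have D: "open ?D" "y \<in> ?D" using U y c by (auto intro!: open_Int chart_dom_open)
      have A: "smooth_vector_field ?D (?A u)" for u
        by (rule smooth_vector_field_subset[OF coord_vector_field[OF c(1)] _ D(1)]) simp
      have t: "?A u z \<in> tangent_space z" if "z \<in> ?D" for u z
        using A that by (simp add: smooth_vector_field_def)
      have z: "nabla (\<lambda>z. nabla X z (?A u z)) y (?A v y) = fzero W y" for u v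
      proof -
        have "nabla (\<lambda>z. nabla X z (?A u z)) y (?A v y) = nabla (fzero W) y (?A v y)"
          by (rule nabla_cong[OF nabla_smooth[OF smooth_section_subset[OF s D(1)] A] D(1) order_refl D(2) _ t[OF D(2)]])
            (use par t in auto)
        then show ?thesis by (simp add: nabla_fzero[OF t[OF D(2)]])
      qed
      have l: "nabla X y (lie_bracket (?A u) (?A v) y) = fzero W y"
        by (rule par[OF y lie_bracket_tangent[OF A A D(2)]])
      have "\<psi> (curvature_fields (?A u) (?A v) X y) = 0"
        unfolding curvature_fields_def z l
        by (simp add: triv_add[OF N(2,1)] triv_scale[OF N(2,1)]
            triv_zero[OF N(2,1)] fzero_fibre fscale_fibre fadd_fibre)
      then show ?thesis
        using curvature_fields_coordinates(2)[OF c(1) N(2) A D(2) A D(2) s y N(1) c(2)]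
        by (simp add: coord_tangent_self[OF cy])
    qed
    then show ?thesis
      using curvature_kernel_iff[OF c(1) N(2,1) c(2) smooth_sectionD(2)[OF s y]] by simp
  qed
  show "y \<in> U \<Longrightarrow> X y \<in> flag_W i"
  proof (induction i arbitrary: y)
    case 0
    show ?case unfolding flag_W_def by (rule section_values_in_section_part(1)[OF s ker 0])
  next
    case (Suc i)
    show ?case
      by (rule section_in_flag_W_Suc[OF s Suc.IH _ Suc.prems])
        (use par fibrewise_subspaceD(1)[OF fibrewise_subspace_flag_W] in simp_all)
  qed
qed

end

section \<open>Stabilization of the derived flag\<close>

lemma nat_decreasing_repeats:
  fixes d :: "nat \<Rightarrow> nat"
  assumes "d 0 \<le> r" and "\<And>i. i \<le> r \<Longrightarrow> d (Suc i) \<le> d i"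
  shows "\<exists>i\<le>r. d (Suc i) = d i"
proof (rule ccontr)
  assume "\<not> ?thesis"
  then have less: "d (Suc i) < d i" if "i \<le> r" for i using assms(2)[OF that] that by force
  have "i \<le> Suc r \<Longrightarrow> d i + i \<le> r" for i
  proof (induction i)
    case (Suc i)
    then show ?case using less[of i] by simp
  qed (use assms in simp)
  from this[of "Suc r"] show False by simp
qed

context linear_connection
begin

text \<open>Over \<open>U\<close> the flag is stationary at the step \<open>i\<close> and its member has constant rank. Both are required
  on a whole open set: equality of two consecutive members at a single point does not persist.\<close>

definition settled_on :: "nat \<Rightarrow> 'm set \<Rightarrow> bool" where
  "settled_on i U \<longleftrightarrow> open U \<and>
     (\<exists>N \<psi> m. local_trivialization N \<psi> \<and> U \<subseteq> N \<and> (\<forall>y\<in>U. dim (\<psi> ` (flag_W i \<inter> fibre W y)) = m)) \<and>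
     (\<forall>y\<in>U. flag_W i \<inter> fibre W y \<subseteq> flag_W (Suc i))"

lemma settled_nabla_closed:
  assumes set: "settled_on i U" and Y: "smooth_section V Y" "\<And>y. y \<in> V \<Longrightarrow> y \<in> U \<Longrightarrow> Y y \<in> flag_W i"
    and x: "x \<in> V" "x \<in> U" and v: "v \<in> tangent_space x"
  shows "nabla Y x v \<in> flag_W i"
proof -
  obtain N \<psi> m where U: "open U" and N: "local_trivialization N \<psi>" "U \<subseteq> N"
    and rank: "\<And>y. y \<in> U \<Longrightarrow> dim (\<psi> ` (flag_W i \<inter> fibre W y)) = m"
    and sub: "\<And>y. y \<in> U \<Longrightarrow> flag_W i \<inter> fibre W y \<subseteq> flag_W (Suc i)"
    using set unfolding settled_on_def by blast
  have o: "open (V \<inter> U)" using smooth_sectionD(1)[OF Y(1)] U by auto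
  show ?thesis
  proof (rule nabla_closed_if_constant_rank[OF fibrewise_subspace_flag_W N(1) U N(2) rank flag_W_section])
    show "\<exists>V X. section_through (flag_W i) w V X \<and>
        (\<forall>v\<in>tangent_space (proj W w). nabla X (proj W w) v \<in> flag_W i)"
      if "w \<in> flag_W i" "proj W w \<in> U" for w
      by (rule flag_W_Suc_closed) (use sub[OF that(2)] that(1) in \<open>auto simp: fibre_def\<close>)
    show "smooth_section (V \<inter> U) Y" by (rule smooth_section_subset[OF Y(1) o]) simp
  qed (use Y(2) x v in auto)
qed

text \<open>A point where the rank of the next member is maximal has a neighbourhood where this rank is constant,
  by lower semicontinuity.\<close>

lemma constant_rank_subset:
  assumes U: "open U" "U \<noteq> {}" and N: "local_trivialization N \<psi>" "U \<subseteq> N"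
  shows "\<exists>U' d. open U' \<and> U' \<noteq> {} \<and> U' \<subseteq> U \<and>
    (\<forall>i<n. \<forall>y\<in>U'. dim (\<psi> ` (flag_W i \<inter> fibre W y)) = d i)"
proof (induction n)
  case 0
  then show ?case using U by auto
next
  case (Suc n)
  then obtain U' d where U': "open U'" "U' \<noteq> {}" "U' \<subseteq> U"
    and d: "\<And>i y. i < n \<Longrightarrow> y \<in> U' \<Longrightarrow> dim (\<psi> ` (flag_W i \<inter> fibre W y)) = d i" by blast
  let ?r = "\<lambda>y. dim (\<psi> ` (flag_W n \<inter> fibre W y))"
  obtain x0 where x0: "x0 \<in> U'" using U'(2) by blast
  have "\<exists>x. x \<in> U' \<and> (\<forall>y. y \<in> U' \<longrightarrow> ?r y \<le> ?r x)"
  proof (rule Lattices_Big.ex_has_greatest_nat[where b="Suc (dim (UNIV :: 'f set))"])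
    show "x0 \<in> U'" by (rule x0)
    show "\<forall>y. y \<in> U' \<longrightarrow> ?r y < Suc (dim (UNIV :: 'f set))"
      by (simp add: less_Suc_eq_le fd_dim_subset)
  qed
  then obtain x where x: "x \<in> U'" "\<And>y. y \<in> U' \<Longrightarrow> ?r y \<le> ?r x" by blast
  have xN: "x \<in> N" using x U' N by auto
  have "\<forall>\<^sub>F y in nhds x. ?r x \<le> ?r y"
    by (rule rank_lower_semicontinuous[OF N(1) xN flag_W_section])
  then obtain V where V: "open V" "x \<in> V" "\<And>y. y \<in> V \<Longrightarrow> ?r x \<le> ?r y"
    unfolding eventually_nhds by (elim exE conjE) simp
  have "\<forall>i<Suc n. \<forall>y\<in>U' \<inter> V. dim (\<psi> ` (flag_W i \<inter> fibre W y)) = (d(n := ?r x)) i"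
    using d x(2) V(3) by (auto simp: less_Suc_eq intro: antisym)
  moreover have "open (U' \<inter> V)" "U' \<inter> V \<noteq> {}" "U' \<inter> V \<subseteq> U" using U' V x by auto
  ultimately show ?case by blast
qed

text \<open>Among the first \<open>r + 2\<close> ranks, which decrease from at most \<open>r\<close>, two consecutive ones agree; the
  corresponding members are then equal.\<close>

lemma settled_dense:
  assumes "open U" "x \<in> U"
  shows "\<exists>i U' y. i \<le> dim (UNIV :: 'f set) \<and> settled_on i U' \<and> y \<in> U' \<and> y \<in> U"
proof -
  let ?r = "dim (UNIV :: 'f set)"
  obtain N \<psi> where N: "x \<in> N" "local_trivialization N \<psi>" using ex_local_trivialization by blast
  have o: "open (U \<inter> N)" "U \<inter> N \<noteq> {}" "U \<inter> N \<subseteq> N"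
    using assms N local_trivialization_open[OF N(2)] by auto
  obtain U' d where U': "open U'" "U' \<noteq> {}" "U' \<subseteq> U \<inter> N"
    and d: "\<And>i y. i < Suc (Suc ?r) \<Longrightarrow> y \<in> U' \<Longrightarrow> dim (\<psi> ` (flag_W i \<inter> fibre W y)) = d i"
    using constant_rank_subset[OF o(1,2) N(2) o(3), of "Suc (Suc ?r)"] by blast
  obtain y where y: "y \<in> U'" using U'(2) by blast
  have mono: "\<psi> ` (flag_W (Suc i) \<inter> fibre W z) \<subseteq> \<psi> ` (flag_W i \<inter> fibre W z)" for i z
    using flag_W_decreasing[of i "Suc i"] by auto
  have "\<exists>i\<le>?r. d (Suc i) = d i"
  proof (rule nat_decreasing_repeats)
    show "d 0 \<le> ?r" using d[of 0 y] y fd_dim_subset[of "\<psi> ` (flag_W 0 \<inter> fibre W y)" UNIV] by simp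
    show "d (Suc i) \<le> d i" if "i \<le> ?r" for i
      using d[of i y] d[of "Suc i" y] that y fd_dim_subset[OF mono[of i y]] by simp
  qed
  then obtain i where i: "i \<le> ?r" "d (Suc i) = d i" by blast
  have "settled_on i U'"
    unfolding settled_on_def
  proof (intro conjI exI ballI)
    show "open U'" "local_trivialization N \<psi>" "U' \<subseteq> N" using U' N by auto
    show "dim (\<psi> ` (flag_W i \<inter> fibre W z)) = d i" if "z \<in> U'" for z using d i that by simp
    fix z assume z: "z \<in> U'"
    then have zN: "z \<in> N" using U' by auto
    have "\<psi> ` (flag_W (Suc i) \<inter> fibre W z) = \<psi> ` (flag_W i \<inter> fibre W z)"
      by (rule fd_subspace_dim_equal[OF subspace_image[OF fibrewise_subspace_flag_W N(2) zN]
            subspace_image[OF fibrewise_subspace_flag_W N(2) zN] mono])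
        (use d[of i z] d[of "Suc i" z] i z in simp)
    then show "flag_W i \<inter> fibre W z \<subseteq> flag_W (Suc i)"
      using triv_mem_image_iff[OF N(2) zN] by blast
  qed
  then show ?thesis using i(1) y U'(3) by blast
qed

text \<open>The curvature form applied to a section is continuous, so it vanishes where it vanishes on a dense
  set.\<close>

lemma curvature_kernel_closed:
  assumes X: "smooth_section U X"
    and dense: "\<And>V. open V \<Longrightarrow> V \<subseteq> U \<Longrightarrow> V \<noteq> {} \<Longrightarrow> \<exists>y\<in>V. X y \<in> curvature_kernel"
    and x: "x \<in> U"
  shows "X x \<in> curvature_kernel"
proof -
  obtain N \<psi> where N: "x \<in> N" "local_trivialization N \<psi>" using ex_local_trivialization by blast
  obtain c where "c \<in> charts_at x" using ex_chart by blast
  then have c: "c \<in> atlas" "x \<in> fst c" by (rule charts_atD)+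
  let ?K = "curvature_form c \<psi>" and ?\<xi> = "in_chart c (\<lambda>y. \<psi> (X y))"
  let ?\<Omega> = "snd c ` ((U \<inter> N) \<inter> fst c)"
  have oUN: "open (U \<inter> N)" using smooth_sectionD(1)[OF X] local_trivialization_open[OF N(2)] by auto
  have \<Omega>: "open ?\<Omega>" by (rule chart_image_open[OF c(1) oUN])
  have "?K (snd c x) u v (\<psi> (X x)) = 0" for u v
  proof (rule ccontr)
    assume nz: "?K (snd c x) u v (\<psi> (X x)) \<noteq> 0"
    have \<xi>: "continuous_on ?\<Omega> ?\<xi>"
      by (rule smooth_on_imp_continuous_on[OF \<Omega> smooth_map_onD[OF smooth_section_trivial[OF X N(2)] c(1)]])
    have sub: "?\<Omega> \<subseteq> snd c ` (N \<inter> fst c)" by auto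
    have "continuous_on ?\<Omega> (\<lambda>p. \<Sum>b\<in>onb. (?\<xi> p \<bullet> b) *\<^sub>R ?K p u v b)"
      by (intro continuous_intros \<xi> continuous_on_subset[OF curvature_form_continuous[OF c(1) N(2)] sub])
    then have "continuous_on ?\<Omega> (\<lambda>p. ?K p u v (?\<xi> p))"
      by (rule continuous_on_eq) (rule linear_onb[OF curvature_form_linear[OF c(1) N(2)], symmetric])
    then have "open (?\<Omega> \<inter> (\<lambda>p. ?K p u v (?\<xi> p)) -` (- {0}))"
      using continuous_open_preimage[OF _ \<Omega>, of _ "- {0}"] by blast
    then have "open {y \<in> fst c. snd c y \<in> ?\<Omega> \<inter> (\<lambda>p. ?K p u v (?\<xi> p)) -` (- {0})}" (is "open ?V")
      by (rule chart_preimage_open[OF c(1)])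
    then have "open (?V \<inter> (U \<inter> N))" using oUN by auto
    moreover have "x \<in> ?V \<inter> (U \<inter> N)"
      using x N c nz by (auto simp: in_chart_apply[OF c])
    ultimately obtain y where y: "y \<in> ?V" "y \<in> U" "y \<in> N" "X y \<in> curvature_kernel"
      using dense[of "?V \<inter> (U \<inter> N)"] by blast
    have yc: "y \<in> fst c" using y(1) by simp
    have "?K (snd c y) u v (\<psi> (X y)) = 0"
      using curvature_kernel_iff[OF c(1) N(2) y(3) yc smooth_sectionD(2)[OF X y(2)]] y(4) by blast
    then show False using y(1) by (simp add: in_chart_apply[OF c(1) yc])
  qed
  then show ?thesis
    using curvature_kernel_iff[OF c(1) N(2,1) c(2) smooth_sectionD(2)[OF X x]] by blast
qed

text \<open>The bound on \<open>i\<close> makes all sections of \<open>W\<^sup>(\<^sup>r\<^sup>)\<close> settled, where \<open>r\<close> is the rank of the bundle.\<close>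

definition settled_section :: "'m set \<Rightarrow> ('m \<Rightarrow> 'w) \<Rightarrow> bool" where
  "settled_section U X \<longleftrightarrow> smooth_section U X \<and>
     (\<forall>i\<le>dim (UNIV :: 'f set). \<forall>U'. settled_on i U' \<longrightarrow> (\<forall>y\<in>U \<inter> U'. X y \<in> flag_W i))"

text \<open>The sections with this property are closed under covariant derivatives along vector fields, so a
  simultaneous induction over all of them is possible: the derivatives of \<open>X\<close> lie in \<open>W\<^sup>(\<^sup>j\<^sup>)\<close> by the
  induction hypothesis, which puts \<open>X\<close> into \<open>W\<^sup>(\<^sup>j\<^sup>+\<^sup>1\<^sup>)\<close>. The base case holds by density.\<close>

lemma settled_section_in_flag:
  "settled_section U X \<Longrightarrow> y \<in> U \<Longrightarrow> X y \<in> flag_W j"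
proof (induction j arbitrary: U X y)
  case 0
  have X: "smooth_section U X" using 0 by (simp add: settled_section_def)
  have "X y \<in> flag_V 0" if "y \<in> U" for y
    unfolding flag_V.simps
  proof (rule curvature_kernel_closed[OF X _ that])
    fix V assume V: "open V" "V \<subseteq> U" "V \<noteq> {}"
    then obtain x where "x \<in> V" by blast
    from settled_dense[OF V(1) this] obtain i U' y where
      "i \<le> dim (UNIV :: 'f set)" "settled_on i U'" "y \<in> U'" "y \<in> V" by blast
    then have "y \<in> V" "X y \<in> flag_W i" using 0(1) V(2) by (auto simp: settled_section_def)
    then show "\<exists>y\<in>V. X y \<in> curvature_kernel" using flag_W_subset_curvature_kernel by blast
  qed
  then show ?case unfolding flag_W_def by (rule section_values_in_section_part(1)[OF X _ 0(2)])
next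
  case (Suc j)
  have X: "smooth_section U X" using Suc.prems by (simp add: settled_section_def)
  show ?case
  proof (rule section_in_flag_W_Suc[OF X Suc.IH[OF Suc.prems(1)] _ Suc.prems(2)])
    fix y v assume y: "y \<in> U" and v: "v \<in> tangent_space y"
    obtain c where cy: "c \<in> charts_at y" using ex_chart by blast
    note c = charts_atD[OF cy]
    \<comment> \<open>A tangent vector is extended to a vector field, because the induction hypothesis speaks about
      sections.\<close>
    let ?A = "\<lambda>z. coord_tangent c z (v c)" and ?D = "U \<inter> fst c"
    have D: "open ?D" "y \<in> ?D" using smooth_sectionD(1)[OF X] chart_dom_open[OF c(1)] y c by auto
    have A: "smooth_vector_field ?D ?A"
      by (rule smooth_vector_field_subset[OF coord_vector_field[OF c(1)] _ D(1)]) simp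
    have XD: "smooth_section ?D X" by (rule smooth_section_subset[OF X D(1)]) simp
    have "settled_section ?D (\<lambda>z. nabla X z (?A z))"
      unfolding settled_section_def
    proof (intro conjI allI impI ballI)
      show "smooth_section ?D (\<lambda>z. nabla X z (?A z))" by (rule nabla_smooth[OF XD A])
      fix i U' z assume i: "i \<le> dim (UNIV :: 'f set)" "settled_on i U'" and z: "z \<in> ?D \<inter> U'"
      have "?A z \<in> tangent_space z" using A z by (simp add: smooth_vector_field_def)
      then show "nabla X z (?A z) \<in> flag_W i"
        using Suc.prems(1) i z by (intro settled_nabla_closed[OF i(2) X]) (auto simp: settled_section_def)
    qed
    from Suc.IH[OF this D(2)] show "nabla X y v \<in> flag_W j" by (simp add: coord_tangent_eq[OF v cy])
  qed
qed

lemma flag_W_stabilizes: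
  assumes "j \<ge> dim (UNIV :: 'f set)"
  shows "flag_W j = flag_W (dim (UNIV :: 'f set))"
proof
  show "flag_W j \<subseteq> flag_W (dim (UNIV :: 'f set))" by (rule flag_W_decreasing[OF assms])
  show "flag_W (dim (UNIV :: 'f set)) \<subseteq> flag_W j"
  proof
    fix w assume "w \<in> flag_W (dim (UNIV :: 'f set))"
    then obtain U X where "section_through (flag_W (dim (UNIV :: 'f set))) w U X"
      using flag_W_section by blast
    note X = section_throughD[OF this]
    have "settled_section U X"
      unfolding settled_section_def
    proof (intro conjI allI impI ballI)
      fix i U' y assume "i \<le> dim (UNIV :: 'f set)" "y \<in> U \<inter> U'"
      then show "X y \<in> flag_W i" using X(2)[of y] flag_W_decreasing[of i "dim (UNIV :: 'f set)"] by auto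
    qed (rule X(1))
    from settled_section_in_flag[OF this X(3)] show "w \<in> flag_W j" using X(4) by simp
  qed
qed

lemma flag_terminal_eq: "\<exists>k. flag_terminal = flag_W k \<and> flag_W (Suc k) = flag_W k"
proof -
  let ?P = "\<lambda>k. \<forall>l\<ge>k. flag_W l = flag_W k"
  have "?P (dim (UNIV :: 'f set))" by (intro allI impI flag_W_stabilizes)
  then have "?P (LEAST k. ?P k)" by (rule LeastI)
  then have "flag_W (Suc (LEAST k. ?P k)) = flag_W (LEAST k. ?P k)"
    by (rule allE[where x="Suc (LEAST k. ?P k)"]) (erule mp, rule le_SucI[OF order_refl])
  then show ?thesis
    unfolding flag_terminal_def by (intro exI[of _ "LEAST k. ?P k"] conjI refl)
qed


section \<open>Parallel sections\<close>

text \<open>Over a subbundle the flag is settled, so the connection form preserves the typical fibre \<open>F\<close>, and it is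
  flat on \<open>F\<close> because the subbundle is contained in the kernel of the curvature.\<close>

lemma parallel_section_exists:
  assumes reg: "regular_at x" and w: "w \<in> flag_terminal" "w \<in> fibre W x"
  shows "\<exists>U X. open U \<and> x \<in> U \<and> parallel_section U X \<and> X ` U \<subseteq> flag_terminal \<and> X x = w"
proof -
  obtain k where k: "flag_terminal = flag_W k" "flag_W (Suc k) = flag_W k"
    using flag_terminal_eq by blast
  obtain N \<psi> F where xN: "x \<in> N" and N: "local_trivialization N \<psi>" and F: "subspace F"
    and im: "\<And>y. y \<in> N \<Longrightarrow> \<psi> ` (flag_W k \<inter> fibre W y) = F"
  proof -
    obtain U where "x \<in> U" "subbundle_over U flag_terminal"
      using reg unfolding regular_at_def by blast
    then have "\<exists>N \<psi> F. x \<in> N \<and> N \<subseteq> U \<and> local_trivialization N \<psi> \<and> subspace F \<and>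
        (\<forall>y\<in>N. \<psi> ` (flag_W k \<inter> fibre W y) = F)"
      unfolding subbundle_over_def k(1) by (elim conjE) (erule (1) bspec)
    then show thesis by (elim exE conjE) (rule that, assumption+, erule (1) bspec)
  qed
  note oN = local_trivialization_open[OF N]
  obtain c where cx: "c \<in> charts_at x" using ex_chart by blast
  note c = charts_atD[OF cx]
  have set: "settled_on k N"
    unfolding settled_on_def k(2)
  proof (intro conjI exI ballI)
    show "dim (\<psi> ` (flag_W k \<inter> fibre W y)) = dim F" if "y \<in> N" for y using im[OF that] by simp
  qed (use N oN in auto)
  have mem: "z \<in> flag_W k \<longleftrightarrow> \<psi> z \<in> F" if "y \<in> N" "z \<in> fibre W y" for y z
    using triv_mem_image_iff[OF N that, of "flag_W k"] unfolding im[OF that(1)] by (rule sym)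
  let ?G = "christoffel c \<psi>" and ?\<Omega> = "snd c ` (N \<inter> fst c)"
  have \<Omega>: "open ?\<Omega>" "snd c x \<in> ?\<Omega>" using chart_image_open[OF c(1) oN] xN c(2) by auto
  have G: "smooth_on ?\<Omega> ?G" by (rule christoffel_smooth[OF c(1) N])
  have GF: "?G p v a \<in> F" if p: "p \<in> ?\<Omega>" and a: "a \<in> F" for p v a
  proof -
    obtain y where y: "y \<in> N" "y \<in> fst c" "p = snd c y" using p by auto
    have cy: "c \<in> charts_at y" using c y by (simp add: charts_at_def)
    let ?v = "coord_tangent c y v"
    note t = coord_tangent_in[OF cy, of v]
    have "nabla (\<lambda>y. lift \<psi> y a) y ?v \<in> flag_W k"
      by (rule settled_nabla_closed[OF set frame_section[OF c(1) N] _ y(1,1) t])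
        (simp add: mem lift_fibre[OF N] triv_lift[OF N] a)
    then have "\<psi> (nabla (\<lambda>y. lift \<psi> y a) y ?v) \<in> F"
      using mem[OF y(1) nabla_fibre[OF frame_section[OF c(1) N] y(1) t]] by simp
    then show ?thesis
      using christoffel_apply[OF c(1) N y(1,2) t, of a] y(3) by (simp add: coord_tangent_self[OF cy])
  qed
  have flat: "fderiv ?G p u v a - fderiv ?G p v u a + ?G p u (?G p v a) - ?G p v (?G p u a) = 0"
    if p: "p \<in> ?\<Omega>" and a: "a \<in> F" for p u v a
  proof -
    obtain y where y: "y \<in> N" "y \<in> fst c" "p = snd c y" using p by auto
    have l: "lift \<psi> y a \<in> fibre W y" by (rule lift_fibre[OF N y(1)])
    have "lift \<psi> y a \<in> curvature_kernel"
      using mem[OF y(1) l] a flag_W_subset_curvature_kernel by (auto simp: triv_lift[OF N y(1)])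
    then have "curvature_form c \<psi> p u v a = 0"
      using curvature_kernel_iff[OF c(1) N y(1,2) l] y(3) by (simp add: triv_lift[OF N y(1)])
    then show ?thesis by (simp add: curvature_form_def[OF c(1) N])
  qed
  have wF: "\<psi> w \<in> F" using mem[OF xN w(2)] w(1) k(1) by simp
  obtain r s where r: "r > 0" "ball (snd c x) r \<subseteq> ?\<Omega>" and s: "smooth_on (ball (snd c x) r) s"
    "s (snd c x) = \<psi> w" "\<And>p. p \<in> ball (snd c x) r \<Longrightarrow> s p \<in> F"
    "\<And>p. p \<in> ball (snd c x) r \<Longrightarrow> (s has_derivative (\<lambda>v. - ?G p v (s p))) (at p)"
    using flat_linear_system_solvable_in_subspace[OF \<Omega> G F wF GF flat] by blast
  let ?B = "ball (snd c x) r"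
  define U where "U = {y \<in> fst c. snd c y \<in> ?B}"
  have U: "open U" "x \<in> U" "U \<subseteq> fst c"
    unfolding U_def using chart_preimage_open[OF c(1) open_ball] c(2) r(1) by auto
  have UN: "U \<subseteq> N"
  proof
    fix y assume y: "y \<in> U"
    then have yc: "y \<in> fst c" and "snd c y \<in> ?\<Omega>" using r(2) by (auto simp: U_def)
    then obtain z where "z \<in> N" "z \<in> fst c" "snd c y = snd c z" by auto
    then show "y \<in> N" using inj_onD[OF chart_inj[OF c(1)], of y z] yc by simp
  qed
  define X where "X y = lift \<psi> y (s (snd c y))" for y
  have sm: "smooth_map_on U (\<lambda>y. s (snd c y))"
    unfolding U_def by (rule smooth_map_on_coordinates[OF c(1) open_ball s(1)])
  have X: "smooth_section U X"
    unfolding X_def[abs_def] by (rule smooth_section_lift[OF N U(1) UN sm])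
  have \<psi>X: "\<psi> (X y) = s (snd c y)" if "y \<in> U" for y
    using triv_lift[OF N] UN that by (auto simp: X_def)
  have val: "X ` U \<subseteq> flag_terminal"
  proof (rule image_subsetI)
    fix y assume y: "y \<in> U"
    have "\<psi> (X y) \<in> F" using s(3) \<psi>X[OF y] y by (simp add: U_def)
    then show "X y \<in> flag_terminal"
      using mem[of y, OF _ smooth_sectionD(2)[OF X y]] UN y k(1) by auto
  qed
  have "nabla X y v = fzero W y" if y: "y \<in> U" and v: "v \<in> tangent_space y" for y v
  proof -
    have yN: "y \<in> N" and yc: "y \<in> fst c" and yB: "snd c y \<in> ?B" using y UN by (auto simp: U_def)
    have cy: "c \<in> charts_at y" using c yc by (simp add: charts_at_def)
    have o: "open (snd c ` (U \<inter> fst c))" "snd c y \<in> snd c ` (U \<inter> fst c)"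
      using chart_image_open[OF c(1) U(1)] y yc by auto
    have "(in_chart c (\<lambda>y. \<psi> (X y)) has_derivative (\<lambda>v. - ?G (snd c y) v (s (snd c y)))) (at (snd c y))"
      by (rule has_derivative_transform_within_open[OF s(4)[OF yB] o])
        (use \<psi>X c in \<open>auto simp: in_chart_apply\<close>)
    from has_derivative_unique[OF this in_chart_has_derivative[OF smooth_section_trivial[OF X N] _ cy]]
    have "chart_deriv c (\<lambda>y. \<psi> (X y)) y (v c) = - ?G (snd c y) (v c) (s (snd c y))"
      using y yN by (simp add: fun_eq_iff)
    then have "\<psi> (nabla X y v) = 0"
      using nabla_coordinates[OF c(1) N X y yN yc v] \<psi>X[OF y] by simp
    then show ?thesis
      by (intro triv_inj[OF N yN nabla_fibre[OF X y v] fzero_fibre])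
        (simp add: triv_zero[OF N yN])
  qed
  then have "parallel_section U X" using X by (simp add: parallel_section_def)
  moreover have "X x = w" unfolding X_def s(2) by (rule lift_triv[OF N xN w(2)])
  ultimately show ?thesis using U val by blast
qed

end

theorem theorem1:
  fixes atlas :: "('m::{t2_space, second_countable_topology}, 'e::fin_dim_inner) chart set"
    and W :: "('m, 'w, 'f::fin_dim_inner) vbundle"
    and nabla :: "('m \<Rightarrow> 'w) \<Rightarrow> 'm \<Rightarrow> ('m, 'e) tangent \<Rightarrow> 'w"
  assumes connected: "connected (UNIV :: 'm set)"
    and connection: "linear_connection atlas W nabla"
  shows "(\<forall>U X. linear_connection.parallel_section atlas W nabla U X \<longrightarrow>
            X ` U \<subseteq> linear_connection.flag_terminal atlas W nabla) \<and>
         (\<forall>x. linear_connection.regular_at atlas W nabla x \<longrightarrow>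
            (\<forall>w \<in> linear_connection.flag_terminal atlas W nabla \<inter> fibre W x.
               \<exists>U X. open U \<and> x \<in> U \<and>
                 linear_connection.parallel_section atlas W nabla U X \<and>
                 X ` U \<subseteq> linear_connection.flag_terminal atlas W nabla \<and> X x = w))"
proof -
  interpret linear_connection atlas W nabla by (rule connection)
  show ?thesis
  proof (intro conjI allI impI ballI)
    fix U X assume "parallel_section U X"
    then show "X ` U \<subseteq> flag_terminal"
      unfolding flag_terminal_def using parallel_in_flag_W by blast
  next
    fix x w assume "regular_at x" "w \<in> flag_terminal \<inter> fibre W x"
    then show "\<exists>U X. open U \<and> x \<in> U \<and> parallel_section U X \<and> X ` U \<subseteq> flag_terminal \<and> X x = w"
      using parallel_section_exists by blast
  qed
qed

end
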